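(* Let $n\ge2$, let $\mu$ be a (nonnegative Borel) measure on $\mathbb{R}^n$, and let $T$ be any one of the following operators: $M$ or a $k$-fold iteration $M^k$ ($k\in\mathbb{N}$); $M_{L^{n',1}}$; $\mathcal M_{\mathbb{S}^{n-1}}$; $M_\Omega$ with $\Omega\in L^{n,\infty}(\mathbb{S}^{n-1})$; $T_\Omega$ or $T^\star_\Omega$ with $\Omega\in L^{n,\infty}(\mathbb{S}^{n-1})$ of mean zero on $\mathbb{S}^{n-1}$ (all these operators are defined in the context). Then there is a constant $C$, independent of $\mu$ and $f$, such that $$\|Tf\|_{L^{n',\infty}(\mu)}\le C\int_{\mathbb{R}^n}|\nabla f|\,(M\mu)^{\frac1{n'}}\,dx$$ for any $f\in C_c^\infty(\mathbb{R}^n)$. In particular, for $w\in A_{1,n'}$ and $f\in C_c^\infty(\mathbb{R}^n)$, $$\|Tf\|_{L^{n',\infty}(w^{n'})}\le C\,[w]_{A_{1,n'}}^{\frac1{n'}}\int_{\mathbb{R}^n}|\nabla f|\,w\,dx,$$ with $C$ independent of $w$ and $f$.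
   Context: A weight is a nonnegative locally integrable function; $n'=\frac n{n-1}$; $Q$ denotes cubes with sides parallel to the axes. $\|f\|_{L^{n',\infty}(\mu)}=\sup_{t>0}t\,\mu(\{x:|f(x)|>t\})^{1/n'}$, and $L^{n',\infty}(w^{n'})$ is the case $d\mu=w^{n'}dx$. $M\mu(x)=\sup_{Q\ni x}\frac{\mu(Q)}{|Q|}$. $w\in A_{1,n'}$ means $w^{n'}\in A_1$, with constant $[w]_{A_{1,n'}}=[w^{n'}]_{A_1}=\left\|\frac{M(w^{n'})}{w^{n'}}\right\|_{L^\infty(\mathbb{R}^n)}<\infty$. Notation for the operators: $\sigma$ is surface measure on $\mathbb{S}^{n-1}$; $\Omega$ is homogeneous of degree zero on $\mathbb{R}^n\setminus\{0\}$, and $\Omega\in L^{n,\infty}(\mathbb{S}^{n-1})$ means $\sup_{t>0}t\,\sigma(\{y'\in\mathbb{S}^{n-1}:|\Omega(y')|>t\})^{1/n}<\infty$. Operators: - Hardy–Littlewood maximal operator $Mf(x)=\sup_{Q\ni x}\frac1{|Q|}\int_Q|f|$, and $M^k$ its $k$-fold composition. - Lorentz maximal operator $M_{L^{n',1}}f(x)=\sup_{Q\ni x}\|f\|_{L^{n',1}(Q)}$, where $\|f\|_{L^{n',1}(Q)}=|Q|^{-1/n'}\,n'\int_0^\infty|\{y\in Q:|f(y)|>t\}|^{1/n'}\,dt$. - Spherical maximal operator $\mathcal M_{\mathbb{S}^{n-1}}f(x)=\sup_{t>0}\left|\int_{\mathbb{S}^{n-1}}f(x-ty')\,d\sigma(y')\right|$.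 - Rough maximal operator $M_\Omega f(x)=\sup_{t>0}\frac1{t^n}\int_{|y|<t}|\Omega(y)f(x-y)|\,dy$. - Rough singular integral $T_\Omega f(x)=\mathrm{p.v.}\int_{\mathbb{R}^n}\frac{\Omega(y)}{|y|^n}f(x-y)\,dy$. - Maximal rough singular integral $T^\star_\Omega f(x)=\sup_{t>0}\left|\int_{|y|>t}\frac{\Omega(y)}{|y|^n}f(x-y)\,dy\right|$. *)

theory Defs
  imports "HOL-Analysis.Analysis" "HOL-Probability.Essential_Supremum"
begin

text \<open>
  Functions on $\mathbb{R}^n$ are complex valued (the real case is the special case of
  \<open>complex_of_real \<circ> f\<close>). Quantities that may be infinite, in particular maximal functions and
  $|Tf|$, take values in \<^typ>\<open>ennreal\<close>; there, \<open>0 * \<infinity> = 0\<close>, \<open>0 / 0 = 0\<close>, and \<open>a / 0 = \<infinity>\<close> if \<open>a > 0\<close>.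
\<close>

definition dual_exponent :: "nat \<Rightarrow> real" where
  "dual_exponent n = real n / (real n - 1)"

text \<open>Used for exponents \<open>p > 0\<close> only, so that \<open>\<infinity>\<close> raised to the power \<open>p\<close> is \<open>\<infinity>\<close>.\<close>

definition epowr :: "ennreal \<Rightarrow> real \<Rightarrow> ennreal" where
  "epowr a p = (if a = \<infinity> then \<infinity> else ennreal (enn2real a powr p))"

definition enorm :: "('a \<Rightarrow> complex) \<Rightarrow> 'a \<Rightarrow> ennreal" where
  "enorm f x = ennreal (norm (f x))"

definition weak_norm :: "real \<Rightarrow> 'a measure \<Rightarrow> ('a \<Rightarrow> ennreal) \<Rightarrow> ennreal" where
  "weak_norm p M g =
     (SUP t\<in>{0<..}. ennreal t * epowr (emeasure M {x \<in> space M. ennreal t < g x}) (1 / p))"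


subsection \<open>Test functions\<close>

definition partial_deriv :: "(real^'n \<Rightarrow> complex) \<Rightarrow> 'n \<Rightarrow> real^'n \<Rightarrow> complex" where
  "partial_deriv f i x = frechet_derivative f (at x) (axis i 1)"

definition grad :: "(real^'n \<Rightarrow> complex) \<Rightarrow> real^'n \<Rightarrow> complex^'n" where
  "grad f x = (\<chi> i. partial_deriv f i x)"

primrec Ck :: "nat \<Rightarrow> (real^'n \<Rightarrow> complex) \<Rightarrow> bool" where
  "Ck 0 f \<longleftrightarrow> continuous_on UNIV f"
| "Ck (Suc k) f \<longleftrightarrow> (\<forall>x. f differentiable (at x)) \<and> (\<forall>i. Ck k (partial_deriv f i))"

definition test_function :: "(real^'n \<Rightarrow> complex) \<Rightarrow> bool" where
  "test_function f \<longleftrightarrow> (\<forall>k. Ck k f) \<and> compact (closure {x. f x \<noteq> 0})"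


subsection \<open>Cubes and maximal functions\<close>

definition cubes :: "(real^'n) set set" where
  "cubes = {cbox a (\<chi> i. a $ i + l) | a l. 0 < l}"

definition cubes_at :: "real^'n \<Rightarrow> (real^'n) set set" where
  "cubes_at x = {Q \<in> cubes. x \<in> Q}"

definition maximal_measure :: "(real^'n) measure \<Rightarrow> real^'n \<Rightarrow> ennreal" where
  "maximal_measure \<mu> x = (SUP Q\<in>cubes_at x. emeasure \<mu> Q / emeasure lebesgue Q)"

definition maximal :: "(real^'n \<Rightarrow> ennreal) \<Rightarrow> real^'n \<Rightarrow> ennreal" where
  "maximal g x = (SUP Q\<in>cubes_at x. (\<integral>\<^sup>+y\<in>Q. g y \<partial>lebesgue) / emeasure lebesgue Q)"

definition HL_maximal :: "(real^'n \<Rightarrow> complex) \<Rightarrow> real^'n \<Rightarrow> ennreal" where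
  "HL_maximal f = maximal (enorm f)"

definition iterated_maximal :: "nat \<Rightarrow> (real^'n \<Rightarrow> complex) \<Rightarrow> real^'n \<Rightarrow> ennreal" where
  "iterated_maximal k f = (maximal ^^ k) (enorm f)"

definition lorentz_norm :: "real \<Rightarrow> (real^'n) set \<Rightarrow> (real^'n \<Rightarrow> complex) \<Rightarrow> ennreal" where
  "lorentz_norm p Q f =
     ennreal p * (\<integral>\<^sup>+t\<in>{0<..}. epowr (emeasure lebesgue {y \<in> Q. t < norm (f y)}) (1 / p) \<partial>lborel)
       / epowr (emeasure lebesgue Q) (1 / p)"

definition lorentz_maximal :: "(real^'n \<Rightarrow> complex) \<Rightarrow> real^'n \<Rightarrow> ennreal" where
  "lorentz_maximal f x = (SUP Q\<in>cubes_at x. lorentz_norm (dual_exponent CARD('n)) Q f)"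


subsection \<open>Surface measure and spherical operators\<close>

text \<open>
  Surface measure on the unit sphere is given by polar coordinates: the measure of \<open>A\<close> is \<open>n\<close>
  times the Lebesgue measure of the truncated cone \<open>{r *\<^sub>R y | r y. 0 < r \<and> r < 1 \<and> y \<in> A}\<close>,
  cf. \<open>emeasure_sphere_measure\<close> below. Here \<open>sgn y = y /\<^sub>R norm y\<close>.
\<close>

definition sphere_measure :: "(real^'n) measure" where
  "sphere_measure =
     scale_measure (of_nat CARD('n))
       (distr (restrict_space lborel (ball 0 1 - {0})) (restrict_space borel (sphere 0 1)) sgn)"

lemma measurable_sgn_sphere:
  "sgn \<in> measurable (restrict_space lborel (ball (0::real^'n) 1 - {0})) (restrict_space borel (sphere 0 1))"
proof (rule measurable_restrict_space2)
  show "sgn \<in> space (restrict_space lborel (ball (0::real^'n) 1 - {0})) \<rightarrow> sphere 0 1"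
    by (auto simp: space_restrict_space norm_sgn)
  show "sgn \<in> borel_measurable (restrict_space lborel (ball (0::real^'n) 1 - {0}))"
    unfolding sgn_div_norm by (rule measurable_restrict_space1) measurable
qed

lemma emeasure_sphere_measure:
  fixes A :: "(real^'n) set"
  assumes A: "A \<in> sets borel" "A \<subseteq> sphere 0 1"
  shows "emeasure sphere_measure A =
           of_nat CARD('n) * emeasure lborel {r *\<^sub>R y | r y. 0 < r \<and> r < 1 \<and> y \<in> A}"
proof -
  let ?S = "ball (0::real^'n) 1 - {0}"
  have eq: "sgn -` A \<inter> ?S = {r *\<^sub>R y | r y. 0 < r \<and> r < 1 \<and> y \<in> A}" (is "_ = ?C")
  proof (intro set_eqI iffI)
    fix x assume x: "x \<in> sgn -` A \<inter> ?S"
    then have "x = norm x *\<^sub>R sgn x" "0 < norm x" "norm x < 1" "sgn x \<in> A"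
      by (auto simp: sgn_div_norm)
    then show "x \<in> ?C" by blast
  next
    fix x assume "x \<in> ?C"
    then obtain r y where x: "x = r *\<^sub>R y" "0 < r" "r < 1" "y \<in> A" by blast
    then have "norm y = 1" using A by auto
    moreover from this have "sgn x = y" using x by (simp add: sgn_div_norm)
    ultimately show "x \<in> sgn -` A \<inter> ?S" using x by auto
  qed
  have sub: "{r *\<^sub>R y | r y. 0 < r \<and> r < 1 \<and> y \<in> A} \<subseteq> ?S"
    unfolding eq[symmetric] by blast
  have sA: "A \<in> sets (restrict_space borel (sphere 0 1))"
    using A by (auto simp: sets_restrict_space)
  show ?thesis
    unfolding sphere_measure_def emeasure_scale_measure
    by (subst emeasure_distr[OF measurable_sgn_sphere sA])
       (simp add: space_restrict_space emeasure_restrict_space eq sub)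
qed

definition spherical_maximal :: "(real^'n \<Rightarrow> complex) \<Rightarrow> real^'n \<Rightarrow> ennreal" where
  "spherical_maximal f x =
     (SUP t\<in>{0<..}. ennreal (norm (LINT y|sphere_measure. f (x - t *\<^sub>R y))))"


subsection \<open>Rough operators\<close>

definition homogeneous0 :: "(real^'n \<Rightarrow> complex) \<Rightarrow> bool" where
  "homogeneous0 \<Omega> \<longleftrightarrow> (\<forall>x r. x \<noteq> 0 \<longrightarrow> 0 < r \<longrightarrow> \<Omega> (r *\<^sub>R x) = \<Omega> x)"

text \<open>
  The completion of the surface measure is used so that any function on the sphere that is
  measurable up to null sets is admitted.
\<close>

definition weak_sphere_kernel :: "(real^'n \<Rightarrow> complex) \<Rightarrow> bool" where
  "weak_sphere_kernel \<Omega> \<longleftrightarrow>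
     homogeneous0 \<Omega> \<and>
     \<Omega> \<in> borel_measurable (completion sphere_measure) \<and>
     weak_norm (real CARD('n)) (completion sphere_measure) (enorm \<Omega>) < \<infinity>"

definition mean_zero :: "(real^'n \<Rightarrow> complex) \<Rightarrow> bool" where
  "mean_zero \<Omega> \<longleftrightarrow> (LINT y|completion sphere_measure. \<Omega> y) = 0"

definition rough_maximal :: "(real^'n \<Rightarrow> complex) \<Rightarrow> (real^'n \<Rightarrow> complex) \<Rightarrow> real^'n \<Rightarrow> ennreal" where
  "rough_maximal \<Omega> f x =
     (SUP t\<in>{0<..}. (\<integral>\<^sup>+y\<in>ball 0 t. ennreal (norm (\<Omega> y * f (x - y))) \<partial>lebesgue)
                       / ennreal (t ^ CARD('n)))"

definition truncated_singular ::
    "(real^'n \<Rightarrow> complex) \<Rightarrow> real \<Rightarrow> (real^'n \<Rightarrow> complex) \<Rightarrow> real^'n \<Rightarrow> complex" where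
  "truncated_singular \<Omega> t f x =
     (LINT y:{y. t < norm y}|lebesgue. \<Omega> y / of_real (norm y ^ CARD('n)) * f (x - y))"

definition rough_singular ::
    "(real^'n \<Rightarrow> complex) \<Rightarrow> (real^'n \<Rightarrow> complex) \<Rightarrow> real^'n \<Rightarrow> complex" where
  "rough_singular \<Omega> f x = Lim (at_right 0) (\<lambda>t. truncated_singular \<Omega> t f x)"

definition maximal_rough_singular ::
    "(real^'n \<Rightarrow> complex) \<Rightarrow> (real^'n \<Rightarrow> complex) \<Rightarrow> real^'n \<Rightarrow> ennreal" where
  "maximal_rough_singular \<Omega> f x =
     (SUP t\<in>{0<..}. ennreal (norm (truncated_singular \<Omega> t f x)))"


subsection \<open>Weights\<close>

definition weight :: "(real^'n \<Rightarrow> real) \<Rightarrow> bool" where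
  "weight w \<longleftrightarrow> (\<forall>x. 0 \<le> w x) \<and> (\<forall>K. compact K \<longrightarrow> set_integrable lebesgue K w)"

definition A1_const :: "(real^'n \<Rightarrow> real) \<Rightarrow> ennreal" where
  "A1_const v = esssup lebesgue (\<lambda>x. maximal (\<lambda>y. ennreal (v y)) x / ennreal (v x))"

definition A1_weight :: "(real^'n \<Rightarrow> real) \<Rightarrow> bool" where
  "A1_weight v \<longleftrightarrow> weight v \<and> A1_const v < \<infinity>"

definition A1p_const :: "real \<Rightarrow> (real^'n \<Rightarrow> real) \<Rightarrow> ennreal" where
  "A1p_const p w = A1_const (\<lambda>x. w x powr p)"

definition A1p_weight :: "real \<Rightarrow> (real^'n \<Rightarrow> real) \<Rightarrow> bool" where
  "A1p_weight p w \<longleftrightarrow> weight w \<and> A1_weight (\<lambda>x. w x powr p)"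

end

theory Submission
  imports Defs
begin

text \<open>
  Write \<open>n\<close> for the dimension, \<open>n' = n / (n - 1)\<close> for the dual exponent, and
  \<open>I g x = \<integral> g y * \<bar>x - y\<bar> powr (1 - n) dy\<close> for the Riesz potential of order one. The theorem is the
  combination of two facts. First, every operator \<open>T\<close> in the list is dominated pointwise by the
  potential of the gradient: \<open>T f x \<le> C * I \<bar>\<nabla>f\<bar> x\<close>. Second, \<open>I\<close> satisfies
  \<open>\<parallel>I g\<parallel> \<le> C * \<integral> g * (M \<mu>) powr (1 / n')\<close> with the norm of weak \<open>L\<^sup>n\<^sup>'(\<mu>)\<close> on the left, for every measure
  \<open>\<mu>\<close> (lemma \<open>riesz_weak_type\<close>). For the statement about weights, \<open>\<mu>\<close> has density \<open>w powr n'\<close>, and the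
  \<open>A\<^sub>1\<close> condition says that \<open>M \<mu>\<close> is at most the constant of the weight times this density.

  The weak-type inequality is Minkowski's inequality in weak \<open>L\<^sup>n\<^sup>'(\<mu>)\<close>: the function
  \<open>\<lambda>x. \<bar>x - y\<bar> powr (1 - n)\<close> exceeds \<open>s\<close> only in a ball around \<open>y\<close>, and the measure of that ball is controlled
  by \<open>M \<mu> y\<close>.

  For the pointwise bounds, integrating \<open>\<nabla>f\<close> along rays and passing to polar coordinates gives
  \<open>\<bar>f x\<bar> \<le> C * I \<bar>\<nabla>f\<bar> x\<close>, and the same bound for all spherical means (\<open>spherical_mean_le_riesz\<close>). The kernel
  is an \<open>A\<^sub>1\<close> weight, hence so is every potential (\<open>maximal_riesz_le\<close>), which settles the iterated maximal
  operators. The Lorentz maximal operator and the rough operators need a Sobolev inequality with the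
  strong Lorentz norm of \<open>L\<close> with indices \<open>n'\<close> and \<open>1\<close> on the left (\<open>lorentz_sobolev\<close>); it follows
  from the weak-type inequality for Lebesgue measure by truncating \<open>f\<close> between the levels \<open>t / 2\<close> and \<open>t\<close> and
  integrating over \<open>t\<close>. A kernel \<open>\<Omega>\<close> in weak \<open>L\<^sup>n\<close> pairs with this Lorentz norm, which bounds the rough
  maximal operator. For the singular integrals the mean value zero of \<open>\<Omega>\<close> allows a constant to be subtracted from
  \<open>f\<close> on each annulus, so that Poincare's inequality leaves only the gradient
  (\<open>rough_kernel_annulus_bound\<close>); writing \<open>\<bar>y\<bar> powr (- n)\<close> as a superposition of indicators of balls
  reassembles the annuli into the Riesz potential (\<open>borel_singular_le_riesz\<close>).
\<close>

section \<open>Powers of extended nonnegative reals\<close>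

lemma epowr_top [simp]: "epowr \<infinity> p = \<infinity>" "epowr top p = top"
  by (auto simp: epowr_def)

lemma epowr_ennreal: "0 \<le> x \<Longrightarrow> epowr (ennreal x) p = ennreal (x powr p)"
  by (simp add: epowr_def)

lemma epowr_0 [simp]: "epowr 0 p = 0"
  by (simp add: epowr_def)

lemma epowr_1_right [simp]: "epowr a 1 = a"
  by (cases a) (auto simp: epowr_ennreal)

lemma epowr_1_left [simp]: "epowr 1 p = 1"
  by (simp add: epowr_def)

lemma epowr_eq_top_iff [simp]: "epowr a p = \<infinity> \<longleftrightarrow> a = \<infinity>"
  by (auto simp: epowr_def)

lemma epowr_mono: "a \<le> b \<Longrightarrow> 0 \<le> p \<Longrightarrow> epowr a p \<le> epowr b p"
  by (cases a; cases b) (auto simp: epowr_ennreal powr_mono2 top_unique)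

lemma epowr_mult: "0 < p \<Longrightarrow> epowr (a * b) p = epowr a p * epowr b p"
proof (cases a; cases b)
  fix x y :: real assume "0 \<le> x" "0 \<le> y" "a = ennreal x" "b = ennreal y"
  then show ?thesis
    by (simp add: ennreal_mult[symmetric] epowr_ennreal powr_mult)
qed (auto simp: epowr_ennreal ennreal_mult_top ennreal_top_mult)

lemma epowr_epowr: "epowr (epowr a p) q = epowr a (p * q)"
  by (cases a) (auto simp: epowr_ennreal powr_powr)

lemma epowr_le_imp_le:
  assumes "epowr a p \<le> b" "0 < p"
  shows "a \<le> epowr b (1 / p)"
  using epowr_mono[OF assms(1), of "1/p"] assms(2) by (simp add: epowr_epowr)

lemma le_imp_epowr_le:
  assumes "a \<le> epowr b (1 / p)" "0 < p"
  shows "epowr a p \<le> b"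
  using epowr_mono[OF assms(1), of p] assms(2) by (simp add: epowr_epowr)

lemma epowr_measurable [measurable]: "(\<lambda>a. epowr a p) \<in> borel_measurable borel"
  unfolding epowr_def by measurable

section \<open>Scaling, the layer cake formula and weak-type bounds\<close>

lemma nn_integral_lborel_affine:
  fixes F :: "'a::euclidean_space \<Rightarrow> ennreal"
  assumes [measurable]: "F \<in> borel_measurable borel" and c: "c \<noteq> 0"
  shows "(\<integral>\<^sup>+y. F (a + c *\<^sub>R y) \<partial>lborel) = ennreal (1 / \<bar>c\<bar> ^ DIM('a)) * (\<integral>\<^sup>+y. F y \<partial>lborel)"
proof -
  have "(\<integral>\<^sup>+y. F y \<partial>lborel) = ennreal (\<bar>c\<bar> ^ DIM('a)) * (\<integral>\<^sup>+y. F (a + c *\<^sub>R y) \<partial>lborel)"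
    by (subst lborel_affine[OF c, of a]) (simp add: nn_integral_density nn_integral_distr nn_integral_cmult)
  moreover have "ennreal (1 / \<bar>c\<bar> ^ DIM('a)) * ennreal (\<bar>c\<bar> ^ DIM('a)) = 1"
    using c by (simp add: ennreal_mult[symmetric])
  ultimately show ?thesis
    by (simp add: mult.assoc[symmetric])
qed

lemma nn_integral_lborel_reflect:
  fixes F :: "'a::euclidean_space \<Rightarrow> ennreal"
  assumes [measurable]: "F \<in> borel_measurable borel"
  shows "(\<integral>\<^sup>+y. F (x - y) \<partial>lborel) = (\<integral>\<^sup>+y. F y \<partial>lborel)"
  using nn_integral_lborel_affine[of F "-1" x] by simp

lemma emeasure_lborel_ennreal_less:
  "emeasure lborel {s::real. 0 < s \<and> ennreal s < a} = a"
proof (cases a)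
  case (real r)
  then have "{s::real. 0 < s \<and> ennreal s < a} = {0<..<r}"
    by (auto simp: ennreal_less_iff)
  then show ?thesis using real by simp
next
  case top
  have "{s::real. 0 < s \<and> ennreal s < a} = (\<Union>i::nat. {0<..<real i})"
    using top by (auto intro: reals_Archimedean2)
  moreover have "emeasure lborel (\<Union>i::nat. {0<..<real i}) = (SUP i::nat. emeasure lborel {0<..<real i})"
    by (rule SUP_emeasure_incseq[symmetric]) (auto simp: incseq_def)
  ultimately show ?thesis using top by (simp add: ennreal_SUP_of_nat_eq_top ennreal_of_nat_eq_real_of_nat[symmetric])
qed

text \<open>
  The value \<open>h x\<close> is the length of the interval of all \<open>s\<close> with \<open>0 <
  s < h x\<close>; exchange the order of integration.
\<close>

lemma nn_integral_layer_cake: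
  assumes M: "sigma_finite_measure M" and h [measurable]: "h \<in> borel_measurable M"
  shows "(\<integral>\<^sup>+x. h x \<partial>M) = (\<integral>\<^sup>+s\<in>{0<..}. emeasure M {x \<in> space M. ennreal s < h x} \<partial>lborel)"
proof -
  interpret M: sigma_finite_measure M by (rule M)
  interpret pair_sigma_finite M "lborel :: real measure"
    by (rule pair_sigma_finite.intro[OF M sigma_finite_lborel])
  have "(\<integral>\<^sup>+x. h x \<partial>M) = (\<integral>\<^sup>+x. (\<integral>\<^sup>+s. indicator {s::real. 0 < s \<and> ennreal s < h x} s \<partial>lborel) \<partial>M)"
    by (intro nn_integral_cong) (simp add: emeasure_lborel_ennreal_less)
  also have "\<dots> = (\<integral>\<^sup>+x. (\<integral>\<^sup>+s. (if 0 < s \<and> ennreal s < h x then 1 else 0) \<partial>lborel) \<partial>M)"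
    by (intro nn_integral_cong) (auto simp: indicator_def)
  also have "\<dots> = (\<integral>\<^sup>+s. (\<integral>\<^sup>+x. (if 0 < s \<and> ennreal s < h x then 1 else 0) \<partial>M) \<partial>lborel)"
    by (rule Fubini'[symmetric]) measurable
  also have "\<dots> = (\<integral>\<^sup>+s\<in>{0<..}. emeasure M {x \<in> space M. ennreal s < h x} \<partial>lborel)"
  proof (intro nn_integral_cong)
    fix s :: real
    have "(\<integral>\<^sup>+x. (if ennreal s < h x then 1 else 0) \<partial>M)
        = (\<integral>\<^sup>+x. indicator {x \<in> space M. ennreal s < h x} x \<partial>M)"
      by (intro nn_integral_cong) (auto simp: indicator_def)
    also have "\<dots> = emeasure M {x \<in> space M. ennreal s < h x}"
      by (rule nn_integral_indicator) measurable
    finally show "(\<integral>\<^sup>+x. (if 0 < s \<and> ennreal s < h x then 1 else 0) \<partial>M)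
        = emeasure M {x \<in> space M. ennreal s < h x} * indicator {0<..} s"
      by (cases "0 < s") auto
  qed
  finally show ?thesis .
qed

lemma nn_integral_powr_tail:
  assumes "1 < p" "0 < (b::real)"
  shows "(\<integral>\<^sup>+s\<in>{b..}. ennreal (s powr - p) \<partial>lborel) = ennreal (b powr (1 - p) / (p - 1))"
proof -
  define F where "F = (\<lambda>s::real. - (s powr (1 - p)) / (p - 1))"
  have d: "DERIV F x :> x powr - p" if "b \<le> x" for x
  proof -
    have "DERIV F x :> - ((1 - p) * x powr (1 - p - 1)) / (p - 1)"
      unfolding F_def using that assms by (auto intro!: derivative_eq_intros)
    moreover have "- ((1 - p) * x powr (1 - p - 1)) / (p - 1) = x powr - p"
      using assms by (simp add: field_simps)
    ultimately show ?thesis by simp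
  qed
  have lim: "((\<lambda>s::real. s powr (1 - p)) \<longlongrightarrow> 0) at_top"
    by (rule tendsto_neg_powr) (use assms in \<open>auto intro: filterlim_ident\<close>)
  have "(F \<longlongrightarrow> - 0 / (p - 1)) at_top"
    unfolding F_def by (intro tendsto_intros lim) (use assms in auto)
  then have "(\<integral>\<^sup>+s\<in>{b..}. ennreal (s powr - p) \<partial>lborel) = ennreal (0 - F b)"
    using d by (intro nn_integral_FTC_atLeast) auto
  then show ?thesis by (simp add: F_def)
qed

lemma AE_lborel_neI:
  fixes a :: "'a::euclidean_space"
  assumes "\<And>x. x \<noteq> a \<Longrightarrow> P x"
  shows "AE x in lborel. P x"
  using AE_lborel_singleton[of a] by eventually_elim (rule assms)

lemma nn_integral_powr_tail_open:
  assumes "1 < p" "0 < (b::real)"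
  shows "(\<integral>\<^sup>+s\<in>{b<..}. ennreal (s powr - p) \<partial>lborel) = ennreal (b powr (1 - p) / (p - 1))"
proof -
  have "(\<integral>\<^sup>+s\<in>{b<..}. ennreal (s powr - p) \<partial>lborel) = (\<integral>\<^sup>+s\<in>{b..}. ennreal (s powr - p) \<partial>lborel)"
    by (intro nn_integral_cong_AE AE_lborel_neI[of b]) (auto simp: indicator_def)
  then show ?thesis using nn_integral_powr_tail[OF assms] by simp
qed

text \<open>
  Kolmogorov's inequality: a function in weak \<open>L\<^sup>p\<close> with \<open>p > 1\<close> is
  integrable over sets of finite measure. A superlevel set inside \<open>E\<close> has measure at
  most \<open>m\<close> and at most \<open>a * s powr - p\<close>, and the layer cake formula is
  split where these two bounds cross. Below it is applied to the Riesz kernel (with an arbitrary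
  measure, \<open>p = n'\<close>) and to rough kernels (with Lebesgue measure, \<open>p =
  n\<close>).
\<close>

lemma nn_integral_le_of_weak_type:
  assumes M: "sigma_finite_measure M" and h [measurable]: "h \<in> borel_measurable M"
    and E [measurable]: "E \<in> sets M" and p: "1 < p" and a: "0 \<le> a" and m: "0 \<le> m"
    and mE: "emeasure M E \<le> ennreal m"
    and weak: "\<And>s. 0 < s \<Longrightarrow> emeasure M {x \<in> E. ennreal s < h x} \<le> ennreal (a * s powr - p)"
  shows "(\<integral>\<^sup>+x\<in>E. h x \<partial>M) \<le> ennreal (p / (p - 1) * a powr (1 / p) * m powr (1 - 1 / p))"
proof -
  have main: "(\<integral>\<^sup>+x\<in>E. h x \<partial>M) \<le> ennreal (m * b + a * (b powr (1 - p) / (p - 1)))" if b: "0 < b" for b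
  proof -
    have "(\<integral>\<^sup>+x\<in>E. h x \<partial>M)
        = (\<integral>\<^sup>+s\<in>{0<..}. emeasure M {x \<in> space M. ennreal s < h x * indicator E x} \<partial>lborel)"
      by (rule nn_integral_layer_cake[OF M]) measurable
    also have "\<dots> \<le> (\<integral>\<^sup>+s. ennreal m * indicator {0..b} s + ennreal a * (ennreal (s powr - p) * indicator {b..} s) \<partial>lborel)"
    proof (intro nn_integral_mono)
      fix s :: real
      show "emeasure M {x \<in> space M. ennreal s < h x * indicator E x} * indicator {0<..} s
          \<le> ennreal m * indicator {0..b} s + ennreal a * (ennreal (s powr - p) * indicator {b..} s)"
      proof (cases "0 < s")
        case True
        have eq: "{x \<in> space M. ennreal s < h x * indicator E x} = {x \<in> E. ennreal s < h x}"
          using sets.sets_into_space[OF E] by (auto simp: indicator_def split: if_splits)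
        have 1: "emeasure M {x \<in> E. ennreal s < h x} \<le> ennreal m"
          by (rule order_trans[OF emeasure_mono mE]) auto
        have 2: "emeasure M {x \<in> E. ennreal s < h x} \<le> ennreal a * ennreal (s powr - p)"
          using weak[OF True] a by (simp add: ennreal_mult)
        show ?thesis unfolding eq using 1 2 True
          by (cases "s \<le> b"; cases "b \<le> s") (auto simp: indicator_def add_increasing2)
      qed simp
    qed
    also have "\<dots> = ennreal m * ennreal b + ennreal a * ennreal (b powr (1 - p) / (p - 1))"
      using b p by (subst nn_integral_add) (auto simp: nn_integral_cmult nn_integral_powr_tail)
    also have "\<dots> = ennreal (m * b + a * (b powr (1 - p) / (p - 1)))"
      using a m b p by (simp add: ennreal_mult'[symmetric] ennreal_plus[symmetric] del: ennreal_plus)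
    finally show ?thesis .
  qed
  consider "m = 0" | "0 < m" "a = 0" | "0 < m" "0 < a"
    using a m by linarith
  then show ?thesis
  proof cases
    case 1
    then have "E \<in> null_sets M" using mE by (auto simp: null_sets_def)
    then show ?thesis by (simp add: nn_integral_null_set)
  next
    case 2
    have "(\<integral>\<^sup>+x\<in>E. h x \<partial>M) \<le> 0"
    proof (rule ennreal_le_epsilon)
      fix e :: real assume "0 < e"
      then show "(\<integral>\<^sup>+x\<in>E. h x \<partial>M) \<le> 0 + ennreal e"
        using main[of "e / m"] 2 by simp
    qed
    then show ?thesis by simp
  next
    case 3
    \<comment> \<open>the level at which the bounds \<open>m\<close> and \<open>a * b powr - p\<close> coincide\<close>
    define b where "b = (a / m) powr (1 / p)"
    have b: "0 < b" using 3 by (simp add: b_def)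
    have lb: "ln b = (ln a - ln m) / p" using 3 by (simp add: b_def ln_div ln_powr)
    have 1: "m * b = a powr (1 / p) * m powr (1 - 1 / p)"
      using 3 b p by (simp add: b_def powr_divide powr_diff)
    have 2: "a * b powr (1 - p) = a powr (1 / p) * m powr (1 - 1 / p)"
    proof -
      have "ln (a * b powr (1 - p)) = ln a + (1 - p) * ln b"
        using 3 b by (simp add: ln_mult ln_powr)
      also have "\<dots> = 1 / p * ln a + (1 - 1 / p) * ln m"
        using p unfolding lb by (simp add: divide_simps) (simp add: algebra_simps)
      also have "\<dots> = ln (a powr (1 / p) * m powr (1 - 1 / p))"
        using 3 by (simp add: ln_mult ln_powr)
      finally show ?thesis using 3 b by (subst (asm) ln_inj_iff) auto
    qed
    have "m * b + a * (b powr (1 - p) / (p - 1)) = (1 + 1 / (p - 1)) * (a powr (1 / p) * m powr (1 - 1 / p))"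
      using 1 2 by (simp add: field_simps)
    also have "1 + 1 / (p - 1) = p / (p - 1)" using p by (simp add: field_simps)
    finally show ?thesis using main[OF b] by (simp add: mult.assoc)
  qed
qed

section \<open>Polar coordinates\<close>

lemma space_sphere_measure [simp]: "space sphere_measure = sphere 0 1"
  by (simp add: sphere_measure_def space_scale_measure space_restrict_space)

lemma sets_sphere_measure: "sets sphere_measure = sets (restrict_space borel (sphere 0 1))"
  by (simp add: sphere_measure_def)

lemma measurable_sphere_measure:
  "f \<in> measurable borel N \<Longrightarrow> f \<in> measurable sphere_measure N"
  using measurable_restrict_space1 measurable_cong_sets[OF sets_sphere_measure refl] by blast

lemma nn_integral_sphere_measure:
  fixes g :: "real^'n \<Rightarrow> ennreal"
  assumes g: "g \<in> borel_measurable sphere_measure"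
  shows "(\<integral>\<^sup>+\<theta>. g \<theta> \<partial>sphere_measure)
       = of_nat CARD('n) * (\<integral>\<^sup>+y\<in>ball 0 1 - {0}. g (sgn y) \<partial>lborel)"
proof -
  have g': "g \<in> borel_measurable (restrict_space borel (sphere 0 1))"
    using g by (simp add: measurable_cong_sets[OF sets_sphere_measure refl])
  show ?thesis
    unfolding sphere_measure_def using g'
    by (subst nn_integral_scale_measure)
       (auto simp: nn_integral_distr[OF measurable_sgn_sphere] nn_integral_restrict_space)
qed

text \<open>
  Since the surface measure is the image of \<open>n\<close> times Lebesgue measure on the unit ball
  under \<open>sgn\<close>, the right-hand side is an integral over the ball of integrals along
  rays. The substitutions \<open>r = \<bar>y\<bar> * s\<close> and then \<open>z = s * y\<close>
  turn it into the integral of \<open>F z * \<bar>z\<bar>\<^sup>n\<close> times \<open>n\<close>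
  times the integral of \<open>s powr - (n + 1)\<close> over \<open>s > \<bar>z\<bar>\<close>, and
  the last two factors cancel \<open>\<bar>z\<bar>\<^sup>n\<close>.
\<close>

lemma polar_coordinates:
  fixes F :: "real^'n \<Rightarrow> ennreal"
  assumes [measurable]: "F \<in> borel_measurable borel"
  shows "(\<integral>\<^sup>+y. F y \<partial>lborel)
       = (\<integral>\<^sup>+\<theta>. (\<integral>\<^sup>+r\<in>{0<..}. F (r *\<^sub>R \<theta>) * ennreal (r ^ (CARD('n) - 1)) \<partial>lborel) \<partial>sphere_measure)"
proof -
  let ?n = "CARD('n)"
  have n: "0 < ?n" by simp
  have pw: "r ^ ?n = r * r ^ (?n - 1)" for r :: real
    using n by (metis Suc_diff_1 power_Suc)
  let ?f = "\<lambda>\<theta> r. F (r *\<^sub>R \<theta>) * ennreal (r ^ (?n - 1))"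
  let ?g = "\<lambda>y s. F (s *\<^sub>R y) * ennreal (norm y ^ ?n * s ^ (?n - 1))"
  let ?h = "\<lambda>z s. F z * ennreal (norm z ^ ?n) * ennreal (s powr - (real ?n + 1))"
  have inner: "(\<integral>\<^sup>+r\<in>{0<..}. ?f (sgn y) r \<partial>lborel)
      = (\<integral>\<^sup>+s\<in>{0<..}. ?g y s \<partial>lborel)" if "y \<noteq> 0" for y
  proof -
    have "(\<integral>\<^sup>+r\<in>{0<..}. ?f (sgn y) r \<partial>lborel)
        = ennreal (norm y) * (\<integral>\<^sup>+s. F ((norm y * s) *\<^sub>R sgn y) * ennreal ((norm y * s) ^ (?n - 1))
            * indicator {0<..} (norm y * s) \<partial>lborel)"
      using that by (subst nn_integral_real_affine[where c="norm y" and t=0]) auto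
    also have "\<dots> = (\<integral>\<^sup>+s. ennreal (norm y) * (F ((norm y * s) *\<^sub>R sgn y) * ennreal ((norm y * s) ^ (?n - 1))
            * indicator {0<..} (norm y * s)) \<partial>lborel)"
      by (subst nn_integral_cmult) auto
    also have "\<dots> = (\<integral>\<^sup>+s\<in>{0<..}. ?g y s \<partial>lborel)"
    proof (intro nn_integral_cong)
      fix s :: real
      have "(norm y * s) *\<^sub>R sgn y = s *\<^sub>R y" using that by (simp add: sgn_div_norm)
      then show "ennreal (norm y) * (F ((norm y * s) *\<^sub>R sgn y) * ennreal ((norm y * s) ^ (?n - 1))
            * indicator {0<..} (norm y * s)) = ?g y s * indicator {0<..} s"
        using that
        by (auto simp: indicator_def zero_less_mult_iff power_mult_distrib pw ennreal_mult[symmetric] ennreal_mult' mult_ac)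
    qed
    finally show ?thesis .
  qed
  have scale: "(\<integral>\<^sup>+y\<in>ball 0 1 - {0}. ?g y s \<partial>lborel)
      = (\<integral>\<^sup>+z\<in>ball 0 s - {0}. ?h z s \<partial>lborel)"
    if s: "0 < s" for s
  proof -
    have "(\<integral>\<^sup>+y\<in>ball 0 1 - {0}. ?g y s \<partial>lborel)
      = (\<integral>\<^sup>+y. F (0 + s *\<^sub>R y) * ennreal (norm (0 + s *\<^sub>R y) ^ ?n * (s ^ (?n - 1) / s ^ ?n))
          * indicator (ball 0 s - {0}) (0 + s *\<^sub>R y) \<partial>lborel)"
      using s by (intro nn_integral_cong) (auto simp: indicator_def power_mult_distrib)
    also have "\<dots> = ennreal (1 / s ^ ?n) * (\<integral>\<^sup>+y. F y * ennreal (norm y ^ ?n * (s ^ (?n - 1) / s ^ ?n))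
          * indicator (ball 0 s - {0}) y \<partial>lborel)"
      using s by (subst nn_integral_lborel_affine) (measurable, auto)
    also have "\<dots> = (\<integral>\<^sup>+y. ennreal (1 / s ^ ?n) * (F y * ennreal (norm y ^ ?n * (s ^ (?n - 1) / s ^ ?n))
          * indicator (ball 0 s - {0}) y) \<partial>lborel)"
      by (rule nn_integral_cmult[symmetric], rule borel_measurable_times_ennreal)
         (auto intro!: borel_measurable_indicator sets.Diff)
    also have "\<dots> = (\<integral>\<^sup>+z\<in>ball 0 s - {0}. ?h z s \<partial>lborel)"
    proof (intro nn_integral_cong)
      fix y :: "real^'n"
      have "s powr (real ?n + 1) = s ^ ?n * s"
        using s by (simp add: powr_add powr_realpow)
      then have eq: "s powr - (real ?n + 1) = 1 / s ^ ?n * (s ^ (?n - 1) / s ^ ?n)"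
        using s unfolding powr_minus_divide by (simp add: pw)
      have "ennreal (s powr - (real ?n + 1)) = ennreal (1 / s ^ ?n) * ennreal (s ^ (?n - 1) / s ^ ?n)"
        unfolding eq using s by (intro ennreal_mult) auto
      moreover have "ennreal (norm y ^ ?n * (s ^ (?n - 1) / s ^ ?n)) = ennreal (norm y ^ ?n) * ennreal (s ^ (?n - 1) / s ^ ?n)"
        using s by (intro ennreal_mult) auto
      ultimately show "ennreal (1 / s ^ ?n) * (F y * ennreal (norm y ^ ?n * (s ^ (?n - 1) / s ^ ?n)) * indicator (ball 0 s - {0}) y)
        = F y * ennreal (norm y ^ ?n) * ennreal (s powr - (real ?n + 1)) * indicator (ball 0 s - {0}) y"
        by (simp add: mult_ac)
    qed
    finally show ?thesis .
  qed
  have radial: "of_nat ?n * (\<integral>\<^sup>+s\<in>{norm z<..}. ennreal (s powr - (real ?n + 1)) \<partial>lborel) = ennreal (1 / norm z ^ ?n)"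
    if "z \<noteq> 0" for z :: "real^'n"
  proof -
    have "(\<integral>\<^sup>+s\<in>{norm z<..}. ennreal (s powr - (real ?n + 1)) \<partial>lborel)
        = ennreal (norm z powr (1 - (real ?n + 1)) / (real ?n + 1 - 1))"
      using that n by (intro nn_integral_powr_tail_open) auto
    also have "\<dots> = ennreal (1 / norm z ^ ?n / real ?n)"
      using that by (simp add: powr_minus powr_realpow divide_inverse)
    finally show ?thesis
      using n by (simp add: ennreal_of_nat_eq_real_of_nat ennreal_mult[symmetric])
  qed
  have "(\<integral>\<^sup>+\<theta>. (\<integral>\<^sup>+r\<in>{0<..}. ?f \<theta> r \<partial>lborel) \<partial>sphere_measure)
      = of_nat ?n * (\<integral>\<^sup>+y\<in>ball 0 1 - {0}. (\<integral>\<^sup>+r\<in>{0<..}. ?f (sgn y) r \<partial>lborel) \<partial>lborel)"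
    by (intro nn_integral_sphere_measure measurable_sphere_measure) measurable
  also have "\<dots> = of_nat ?n * (\<integral>\<^sup>+y\<in>ball 0 1 - {0}. (\<integral>\<^sup>+s\<in>{0<..}. ?g y s \<partial>lborel) \<partial>lborel)"
  proof (rule arg_cong[where f="\<lambda>x. _ * x"], rule nn_integral_cong)
    fix y :: "real^'n"
    show "(\<integral>\<^sup>+r\<in>{0<..}. ?f (sgn y) r \<partial>lborel) * indicator (ball 0 1 - {0}) y
        = (\<integral>\<^sup>+s\<in>{0<..}. ?g y s \<partial>lborel) * indicator (ball 0 1 - {0}) y"
      by (cases "y = 0") (simp_all only: inner not_False_eq_True, simp)
  qed
  also have "\<dots> = of_nat ?n * (\<integral>\<^sup>+y. (\<integral>\<^sup>+s. ?g y s * indicator {0<..} s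
        * (if norm y < 1 \<and> y \<noteq> 0 then 1 else 0) \<partial>lborel) \<partial>lborel)"
  proof (rule arg_cong[where f="\<lambda>x. _ * x"], rule nn_integral_cong)
    fix y :: "real^'n"
    have ind: "indicator (ball 0 1 - {0}) y = (if norm y < 1 \<and> y \<noteq> 0 then 1 else 0::ennreal)"
      by (simp add: indicator_def)
    show "(\<integral>\<^sup>+s\<in>{0<..}. ?g y s \<partial>lborel) * indicator (ball 0 1 - {0}) y
        = (\<integral>\<^sup>+s. ?g y s * indicator {0<..} s
            * (if norm y < 1 \<and> y \<noteq> 0 then 1 else 0) \<partial>lborel)"
      unfolding ind by (rule nn_integral_multc[symmetric]) measurable
  qed
  also have "\<dots> = of_nat ?n * (\<integral>\<^sup>+s. (\<integral>\<^sup>+y. ?g y s * indicator {0<..} s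
        * (if norm y < 1 \<and> y \<noteq> 0 then 1 else 0) \<partial>lborel) \<partial>lborel)"
    by (intro arg_cong[where f="\<lambda>x. _ * x"] lborel_pair.Fubini') measurable
  also have "\<dots> = of_nat ?n * (\<integral>\<^sup>+s. (\<integral>\<^sup>+z. ?h z s
        * indicator (ball 0 s - {0}) z * indicator {0<..} s \<partial>lborel) \<partial>lborel)"
  proof (rule arg_cong[where f="\<lambda>x. _ * x"], rule nn_integral_cong)
    fix s :: real
    show "(\<integral>\<^sup>+y. ?g y s * indicator {0<..} s
        * (if norm y < 1 \<and> y \<noteq> 0 then 1 else 0) \<partial>lborel)
      = (\<integral>\<^sup>+z. ?h z s
        * indicator (ball 0 s - {0}) z * indicator {0<..} s \<partial>lborel)"
    proof (cases "0 < s")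
      case True
      then have ind: "indicator {0<..} s = (1::ennreal)" by simp
      have "(\<integral>\<^sup>+y. ?g y s
          * (if norm y < 1 \<and> y \<noteq> 0 then 1 else 0) \<partial>lborel)
        = (\<integral>\<^sup>+y\<in>ball 0 1 - {0}. ?g y s \<partial>lborel)"
        by (intro nn_integral_cong) (auto simp: indicator_def)
      then show ?thesis unfolding ind mult_1_right using scale[OF True] by simp
    qed simp
  qed
  also have "\<dots> = of_nat ?n * (\<integral>\<^sup>+s. (\<integral>\<^sup>+z. ?h z s
        * (if norm z < s \<and> z \<noteq> 0 then 1 else 0) \<partial>lborel) \<partial>lborel)"
    by (intro arg_cong[where f="\<lambda>x. _ * x"] nn_integral_cong)
       (auto simp: indicator_def dest: less_le_trans[OF _ norm_ge_zero] intro: le_less_trans[OF norm_ge_zero])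
  also have "\<dots> = of_nat ?n * (\<integral>\<^sup>+z. (\<integral>\<^sup>+s. ?h z s
        * (if norm z < s \<and> z \<noteq> 0 then 1 else 0) \<partial>lborel) \<partial>lborel)"
    by (intro arg_cong[where f="\<lambda>x. _ * x"] lborel_pair.Fubini') measurable
  also have "\<dots> = (\<integral>\<^sup>+z. of_nat ?n * (\<integral>\<^sup>+s. ?h z s
        * (if norm z < s \<and> z \<noteq> 0 then 1 else 0) \<partial>lborel) \<partial>lborel)"
    by (rule nn_integral_cmult[symmetric]) measurable
  also have "\<dots> = (\<integral>\<^sup>+z. F z \<partial>lborel)"
  proof (intro nn_integral_cong_AE AE_lborel_neI[of 0])
    fix z :: "real^'n" assume z: "z \<noteq> 0"
    have "of_nat ?n * (\<integral>\<^sup>+s. ?h z s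
        * (if norm z < s \<and> z \<noteq> 0 then 1 else 0) \<partial>lborel)
      = of_nat ?n * (\<integral>\<^sup>+s. F z * ennreal (norm z ^ ?n) * (ennreal (s powr - (real ?n + 1))
        * indicator {norm z<..} s) \<partial>lborel)"
      using z by (intro arg_cong[where f="\<lambda>x. _ * x"] nn_integral_cong) (auto simp: indicator_def)
    also have "\<dots> = F z * ennreal (norm z ^ ?n) * (of_nat ?n * (\<integral>\<^sup>+s\<in>{norm z<..}. ennreal (s powr - (real ?n + 1)) \<partial>lborel))"
      by (subst nn_integral_cmult) (auto simp: mult_ac)
    also have "\<dots> = F z * (ennreal (norm z ^ ?n) * ennreal (1 / norm z ^ ?n))"
      unfolding radial[OF z] by (simp add: mult_ac)
    also have "\<dots> = F z"
      using z by (simp add: ennreal_mult[symmetric])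
    finally show "of_nat ?n * (\<integral>\<^sup>+s. ?h z s
        * (if norm z < s \<and> z \<noteq> 0 then 1 else 0) \<partial>lborel) = F z" .
  qed
  finally show ?thesis by simp
qed

lemma emeasure_sphere_measure_pos: "0 < emeasure (sphere_measure :: (real^'n) measure) (sphere 0 1)"
  and emeasure_sphere_measure_finite: "emeasure (sphere_measure :: (real^'n) measure) (sphere 0 1) < \<infinity>"
proof -
  have "emeasure (sphere_measure :: (real^'n) measure) (sphere 0 1)
      = (\<integral>\<^sup>+\<theta>. 1 \<partial>(sphere_measure :: (real^'n) measure))"
    by (metis nn_integral_const mult_1 space_sphere_measure)
  also have "\<dots> = of_nat CARD('n) * (\<integral>\<^sup>+y\<in>ball (0::real^'n) 1 - {0}. 1 \<partial>lborel)"
    by (subst nn_integral_sphere_measure) auto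
  also have "\<dots> = of_nat CARD('n) * emeasure lborel (ball (0::real^'n) 1 - {0})"
    by simp
  also have "emeasure lborel (ball (0::real^'n) 1 - {0}) = emeasure lborel (ball (0::real^'n) 1)"
    by (intro emeasure_Diff_null_set) (auto simp: null_sets_def)
  finally have eq: "emeasure (sphere_measure :: (real^'n) measure) (sphere 0 1)
      = of_nat CARD('n) * emeasure lborel (ball (0::real^'n) 1)" .
  have "0 < emeasure lborel (ball (0::real^'n) 1)"
    by (simp add: emeasure_ball)
  moreover have "emeasure lborel (ball (0::real^'n) 1) < \<infinity>"
    by (rule emeasure_bounded_finite) auto
  ultimately show "0 < emeasure (sphere_measure :: (real^'n) measure) (sphere 0 1)"
    "emeasure (sphere_measure :: (real^'n) measure) (sphere 0 1) < \<infinity>"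
    unfolding eq by (auto simp: ennreal_zero_less_mult_iff ennreal_mult_less_top of_nat_less_top)
qed

section \<open>Functions with a bound on the gradient\<close>

text \<open>
  Everything below depends on the gradient only through a continuous upper bound \<open>G\<close>
  for its length. Such bounds, unlike exact lengths of gradients, are easily computed for
  truncations and for products with cutoff functions.
\<close>

definition grad_bound :: "('a::euclidean_space \<Rightarrow> 'b::real_normed_vector) \<Rightarrow> ('a \<Rightarrow> real) \<Rightarrow> bool" where
  "grad_bound f G \<longleftrightarrow> continuous_on UNIV G \<and>
     (\<forall>x. \<exists>D. (f has_derivative D) (at x) \<and> (\<forall>v. norm (D v) \<le> G x * norm v))"

lemma grad_bound_nonneg: "grad_bound f G \<Longrightarrow> 0 \<le> G x"
proof -
  assume "grad_bound f G"
  then obtain D :: "'a \<Rightarrow> 'b" where "\<forall>v. norm (D v) \<le> G x * norm v"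
    unfolding grad_bound_def by blast
  moreover obtain v :: 'a where "norm v = 1"
    using norm_Basis SOME_Basis by blast
  ultimately show "0 \<le> G x"
    by (metis mult.right_neutral norm_ge_zero order_trans)
qed

lemma grad_bound_continuous: "grad_bound f G \<Longrightarrow> continuous_on UNIV G"
  by (simp add: grad_bound_def)

lemma grad_bound_continuous_fun: "grad_bound f G \<Longrightarrow> continuous_on UNIV f"
  unfolding grad_bound_def by (meson continuous_at_imp_continuous_on has_derivative_continuous)

lemma grad_bound_measurable: "grad_bound f G \<Longrightarrow> G \<in> borel_measurable borel"
  by (intro borel_measurable_continuous_onI grad_bound_continuous)

lemma grad_bound_measurable_fun: "grad_bound f G \<Longrightarrow> f \<in> borel_measurable borel"
  by (intro borel_measurable_continuous_onI grad_bound_continuous_fun)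

text \<open>
  The mean value inequality, with a primitive of \<open>G\<close> along the segment as the
  comparison function.
\<close>

lemma grad_bound_segment:
  assumes f: "grad_bound f G" and "a \<le> b"
  shows "ennreal (norm (f (p + b *\<^sub>R v) - f (p + a *\<^sub>R v)))
       \<le> ennreal (norm v) * (\<integral>\<^sup>+s\<in>{a..b}. ennreal (G (p + s *\<^sub>R v)) \<partial>lborel)"
proof (cases "a = b")
  case False
  then have ab: "a < b" using \<open>a \<le> b\<close> by simp
  define g where "g = (\<lambda>s. G (p + s *\<^sub>R v))"
  have g: "continuous_on UNIV g"
    unfolding g_def by (intro continuous_on_compose2[OF grad_bound_continuous[OF f]] continuous_intros) auto
  have g0: "0 \<le> g s" for s by (simp add: g_def grad_bound_nonneg[OF f])
  define \<Phi> where "\<Phi> = (\<lambda>s. integral {a - 1..s} g)"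
  have \<Phi>: "DERIV \<Phi> s :> g s" if "a \<le> s" "s \<le> b" for s
  proof -
    have "(\<Phi> has_vector_derivative g s) (at s within {a - 1..b + 1})"
      unfolding \<Phi>_def using that
      by (intro integral_has_vector_derivative continuous_on_subset[OF g]) auto
    moreover have "at s within {a - 1..b + 1} = at s"
      using that by (intro at_within_interior) auto
    ultimately show ?thesis by (simp add: has_real_derivative_iff_has_vector_derivative)
  qed
  obtain D where D: "\<And>x. (f has_derivative D x) (at x)" "\<And>x v. norm (D x v) \<le> G x * norm v"
    using f unfolding grad_bound_def by metis
  have curve: "((\<lambda>s. f (p + s *\<^sub>R v)) has_vector_derivative D (p + s *\<^sub>R v) v) (at s)" for s
  proof -
    have "((\<lambda>s. p + s *\<^sub>R v) has_derivative (\<lambda>h. h *\<^sub>R v)) (at s)"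
      by (auto intro!: derivative_eq_intros)
    from has_derivative_compose[OF this D(1)]
    have "((\<lambda>s. f (p + s *\<^sub>R v)) has_derivative (\<lambda>h. D (p + s *\<^sub>R v) (h *\<^sub>R v))) (at s)" .
    moreover have "D (p + s *\<^sub>R v) (h *\<^sub>R v) = h *\<^sub>R D (p + s *\<^sub>R v) v" for h
      using D(1) has_derivative_linear linear_cmul by blast
    ultimately show ?thesis by (simp add: has_vector_derivative_def)
  qed
  have "norm (f (p + b *\<^sub>R v) - f (p + a *\<^sub>R v)) \<le> norm v * \<Phi> b - norm v * \<Phi> a"
  proof (rule differentiable_bound_general[OF ab _ _ curve])
    show "continuous_on {a..b} (\<lambda>s. f (p + s *\<^sub>R v))"
      using curve by (intro continuous_at_imp_continuous_on ballI has_vector_derivative_continuous) blast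
    show "continuous_on {a..b} (\<lambda>s. norm v * \<Phi> s)"
      using \<Phi> by (intro continuous_intros continuous_at_imp_continuous_on ballI DERIV_isCont) auto
    show "((\<lambda>s. norm v * \<Phi> s) has_vector_derivative norm v * g s) (at s)" if "a < s" "s < b" for s
      using \<Phi>[of s] that by (auto simp: has_real_derivative_iff_has_vector_derivative[symmetric] intro!: derivative_eq_intros)
    show "norm (D (p + s *\<^sub>R v) v) \<le> norm v * g s" for s
      using D(2)[of "p + s *\<^sub>R v" v] by (simp add: g_def mult.commute)
  qed
  then have "ennreal (norm (f (p + b *\<^sub>R v) - f (p + a *\<^sub>R v))) \<le> ennreal (norm v * (\<Phi> b - \<Phi> a))"
    by (simp add: right_diff_distrib ennreal_leI)
  also have "\<dots> = ennreal (norm v) * ennreal (\<Phi> b - \<Phi> a)"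
    by (simp add: ennreal_mult')
  also have "ennreal (\<Phi> b - \<Phi> a) = (\<integral>\<^sup>+s\<in>{a..b}. ennreal (g s) \<partial>lborel)"
    using ab \<Phi> g0 borel_measurable_continuous_onI[OF g]
    by (intro nn_integral_FTC_Icc[symmetric]) (auto intro: DERIV_subset has_field_derivative_at_within)
  finally show ?thesis by (simp add: g_def)
qed simp

text \<open>
  The segment ends where \<open>f\<close> vanishes.
\<close>

lemma grad_bound_ray:
  assumes f: "grad_bound f G" and supp: "bounded {x. f x \<noteq> 0}" and v: "norm v = 1"
  shows "ennreal (norm (f (p + t *\<^sub>R v))) \<le> (\<integral>\<^sup>+s\<in>{t..}. ennreal (G (p + s *\<^sub>R v)) \<partial>lborel)"
proof -
  obtain B where B: "\<And>x. f x \<noteq> 0 \<Longrightarrow> norm x \<le> B"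
    using supp by (auto simp: bounded_iff)
  define b where "b = max t (norm p + \<bar>B\<bar> + 1)"
  have "norm (b *\<^sub>R v) \<le> norm (p + b *\<^sub>R v) + norm p"
    using norm_triangle_ineq4[of "p + b *\<^sub>R v" p] by simp
  moreover have "norm (b *\<^sub>R v) \<ge> norm p + \<bar>B\<bar> + 1"
    using v by (simp add: b_def)
  ultimately have "f (p + b *\<^sub>R v) = 0"
    using B[of "p + b *\<^sub>R v"] by force
  then have "ennreal (norm (f (p + t *\<^sub>R v))) \<le> (\<integral>\<^sup>+s\<in>{t..b}. ennreal (G (p + s *\<^sub>R v)) \<partial>lborel)"
    using grad_bound_segment[OF f, of t b p v] v by (simp add: b_def norm_minus_commute)
  also have "\<dots> \<le> (\<integral>\<^sup>+s\<in>{t..}. ennreal (G (p + s *\<^sub>R v)) \<partial>lborel)"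
    by (intro nn_integral_mono) (auto simp: indicator_def)
  finally show ?thesis .
qed

section \<open>The Riesz potential and spherical means\<close>

text \<open>
  At the origin, where the kernel is singular, its value is \<open>0\<close> because of the
  convention for division by zero; estimates from below therefore exclude that point.
\<close>

definition riesz_kernel :: "real^'n \<Rightarrow> ennreal" where
  "riesz_kernel z = ennreal (1 / norm z ^ (CARD('n) - 1))"

definition riesz :: "(real^'n \<Rightarrow> ennreal) \<Rightarrow> real^'n \<Rightarrow> ennreal" where
  "riesz g x = (\<integral>\<^sup>+y. g y * riesz_kernel (x - y) \<partial>lborel)"

lemma riesz_kernel_measurable [measurable]: "riesz_kernel \<in> borel_measurable borel"
  unfolding riesz_kernel_def[abs_def] by measurable

lemma riesz_measurable [measurable (raw)]:
  assumes [measurable]: "g \<in> borel_measurable borel"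
  shows "riesz g \<in> borel_measurable borel"
  unfolding riesz_def[abs_def] by measurable

lemma riesz_reflect:
  assumes [measurable]: "g \<in> borel_measurable borel"
  shows "riesz g x = (\<integral>\<^sup>+y. g (x - y) * riesz_kernel y \<partial>lborel)"
  unfolding riesz_def using nn_integral_lborel_reflect[of "\<lambda>y. g y * riesz_kernel (x - y)" x] by simp

text \<open>
  Each value of \<open>f\<close> on the sphere is bounded by the integral of \<open>G\<close> along
  the rest of the ray, and in polar coordinates the kernel cancels the Jacobian \<open>r ^ (n -
  1)\<close>. For \<open>t = 0\<close> this is the classical representation of \<open>f\<close> by
  its gradient.
\<close>

lemma spherical_mean_le_riesz:
  fixes f :: "real^'n \<Rightarrow> 'b::real_normed_vector"
  assumes f: "grad_bound f G" and supp: "bounded {x. f x \<noteq> 0}" and t: "0 \<le> t"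
  shows "(\<integral>\<^sup>+\<theta>. ennreal (norm (f (x - t *\<^sub>R \<theta>))) \<partial>sphere_measure) \<le> riesz (\<lambda>y. ennreal (G y)) x"
proof -
  note [measurable] = grad_bound_measurable[OF f]
  let ?h = "\<lambda>\<theta> r. ennreal (G (x - r *\<^sub>R \<theta>)) * riesz_kernel (r *\<^sub>R \<theta>) * ennreal (r ^ (CARD('n) - 1))"
  have "(\<integral>\<^sup>+\<theta>. ennreal (norm (f (x - t *\<^sub>R \<theta>))) \<partial>sphere_measure)
      \<le> (\<integral>\<^sup>+\<theta>. (\<integral>\<^sup>+r\<in>{0<..}. ?h \<theta> r \<partial>lborel) \<partial>sphere_measure)"
  proof (intro nn_integral_mono)
    fix \<theta> :: "real^'n" assume "\<theta> \<in> space sphere_measure"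
    then have \<theta>: "norm \<theta> = 1" by simp
    have "ennreal (norm (f (x - t *\<^sub>R \<theta>))) \<le> (\<integral>\<^sup>+s\<in>{t..}. ennreal (G (x + s *\<^sub>R (- \<theta>))) \<partial>lborel)"
      using grad_bound_ray[OF f supp, of "- \<theta>" x t] \<theta> by simp
    also have "\<dots> \<le> (\<integral>\<^sup>+r\<in>{0<..}. ?h \<theta> r \<partial>lborel)"
    proof (intro nn_integral_mono_AE AE_lborel_neI[of 0])
      fix r :: real assume "r \<noteq> 0"
      show "ennreal (G (x + r *\<^sub>R - \<theta>)) * indicator {t..} r
          \<le> ?h \<theta> r * indicator {0<..} r"
      proof (cases "0 < r")
        case True
        have "riesz_kernel (r *\<^sub>R \<theta>) * ennreal (r ^ (CARD('n) - 1)) = 1"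
          unfolding riesz_kernel_def using True \<theta> by (subst ennreal_mult[symmetric]) auto
        then show ?thesis using True by (simp add: mult.assoc indicator_def)
      next
        case False
        then show ?thesis using t \<open>r \<noteq> 0\<close> by (simp add: indicator_def)
      qed
    qed
    finally show "ennreal (norm (f (x - t *\<^sub>R \<theta>))) \<le> \<dots>" .
  qed
  also have "\<dots> = (\<integral>\<^sup>+y. ennreal (G (x - y)) * riesz_kernel y \<partial>lborel)"
    by (rule polar_coordinates[symmetric]) measurable
  also have "\<dots> = riesz (\<lambda>y. ennreal (G y)) x"
    by (rule riesz_reflect[symmetric]) measurable
  finally show ?thesis .
qed

text \<open>
  The pointwise domination that is proved for every operator. The constant is uniform in
  \<open>f\<close>, and \<open>G\<close> instead of the gradient itself makes the bound applicable
  to truncated functions.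
\<close>

definition riesz_bound :: "((real^'n \<Rightarrow> 'b::real_normed_vector) \<Rightarrow> real^'n \<Rightarrow> ennreal) \<Rightarrow> real \<Rightarrow> bool" where
  "riesz_bound T C \<longleftrightarrow> 0 < C \<and> (\<forall>f G x. grad_bound f G \<longrightarrow> bounded {x. f x \<noteq> 0} \<longrightarrow>
     T f x \<le> ennreal C * riesz (\<lambda>y. ennreal (G y)) x)"

lemma riesz_boundI:
  assumes "0 < C" "\<And>f G x. grad_bound f G \<Longrightarrow> bounded {x. f x \<noteq> 0} \<Longrightarrow>
    T f x \<le> ennreal C * riesz (\<lambda>y. ennreal (G y)) x"
  shows "riesz_bound T C"
  using assms by (simp add: riesz_bound_def)

lemma riesz_boundD:
  assumes "riesz_bound T C"
  shows "0 < C"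
    and "grad_bound f G \<Longrightarrow> bounded {x. f x \<noteq> 0} \<Longrightarrow> T f x \<le> ennreal C * riesz (\<lambda>y. ennreal (G y)) x"
  using assms by (simp_all add: riesz_bound_def)

lemma norm_le_riesz:
  obtains C where "riesz_bound (\<lambda>(f :: real^'n \<Rightarrow> 'b::real_normed_vector) x. ennreal (norm (f x))) C"
proof -
  let ?S = "emeasure (sphere_measure :: (real^'n) measure) (sphere 0 1)"
  obtain c where c: "?S = ennreal c" "0 < c"
    using emeasure_sphere_measure_pos[where 'n='n] emeasure_sphere_measure_finite[where 'n='n] by (cases ?S) auto
  show ?thesis
  proof (rule that[OF riesz_boundI])
    show "0 < 1 / c" using c by simp
    fix f :: "real^'n \<Rightarrow> 'b" and G x assume f: "grad_bound f G" "bounded {x. f x \<noteq> 0}"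
    have "ennreal (norm (f x)) * ennreal c \<le> riesz (\<lambda>y. ennreal (G y)) x"
      using spherical_mean_le_riesz[OF f, of 0 x] c(1) by simp
    then have "ennreal (1 / c) * (ennreal (norm (f x)) * ennreal c) \<le> ennreal (1 / c) * riesz (\<lambda>y. ennreal (G y)) x"
      by (rule mult_left_mono) simp
    moreover have "ennreal (1 / c) * (ennreal (norm (f x)) * ennreal c) = ennreal (norm (f x))"
      using c by (simp add: ennreal_mult[symmetric])
    ultimately show "ennreal (norm (f x)) \<le> ennreal (1 / c) * riesz (\<lambda>y. ennreal (G y)) x" by simp
  qed
qed

section \<open>The weak-type inequality for the Riesz potential\<close>

lemma riesz_kernel_superlevel:
  fixes z :: "real^'n"
  assumes n: "2 \<le> CARD('n)" and s: "0 < s" and z: "ennreal s < riesz_kernel z"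
  shows "norm z < s powr - (1 / (real CARD('n) - 1))"
proof (cases "z = 0")
  case False
  define k where "k = CARD('n) - 1"
  have k: "0 < k" "real CARD('n) - 1 = real k" using n by (auto simp: k_def of_nat_diff)
  have "s < 1 / norm z ^ k"
    using z s by (simp add: riesz_kernel_def k_def ennreal_less_iff)
  then have "norm z ^ k < 1 / s" using False s by (simp add: field_simps)
  then have "(norm z ^ k) powr (1 / real k) < (1 / s) powr (1 / real k)"
    using k by (intro powr_less_mono2) auto
  moreover have "(norm z ^ k) powr (1 / real k) = norm z"
    using False k by (simp add: powr_realpow[symmetric] powr_powr)
  moreover have "(1 / s) powr (1 / real k) = s powr - (1 / real k)"
    using s by (simp add: powr_divide powr_minus_divide)
  ultimately show ?thesis by (simp add: k(2))
qed (use s in simp)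

lemma dual_exponent_simps:
  assumes "2 \<le> n"
  shows "1 < dual_exponent n" "dual_exponent n / (dual_exponent n - 1) = real n"
    "1 / dual_exponent n = 1 - 1 / real n" "0 < dual_exponent n"
  using assms by (auto simp: dual_exponent_def field_simps)

text \<open>
  If balls around \<open>y\<close> have measure at most \<open>a * r ^ n\<close>, then the kernel
  with pole \<open>y\<close> is in weak \<open>L\<^sup>n\<^sup>'(\<mu>)\<close>, because its
  superlevel sets are contained in such balls.
\<close>

lemma nn_integral_riesz_kernel_le:
  fixes y :: "real^'n"
  assumes n: "2 \<le> CARD('n)" and \<mu>: "sigma_finite_measure \<mu>" "sets \<mu> = sets borel"
    and E: "E \<in> sets borel" and a: "0 \<le> a" and m: "0 \<le> m" and mE: "emeasure \<mu> E \<le> ennreal m"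
    and ball: "\<And>r. 0 < r \<Longrightarrow> emeasure \<mu> (ball y r) \<le> ennreal (a * r ^ CARD('n))"
  shows "(\<integral>\<^sup>+x\<in>E. riesz_kernel (x - y) \<partial>\<mu>)
       \<le> ennreal (real CARD('n) * a powr (1 / dual_exponent CARD('n)) * m powr (1 / real CARD('n)))"
proof -
  let ?p = "dual_exponent CARD('n)"
  note p = dual_exponent_simps[OF n]
  have "(\<integral>\<^sup>+x\<in>E. riesz_kernel (x - y) \<partial>\<mu>) \<le> ennreal (?p / (?p - 1) * a powr (1 / ?p) * m powr (1 - 1 / ?p))"
  proof (rule nn_integral_le_of_weak_type[OF \<mu>(1) _ _ p(1) a m mE])
    show "(\<lambda>x. riesz_kernel (x - y)) \<in> borel_measurable \<mu>"
      unfolding measurable_cong_sets[OF \<mu>(2) refl] by measurable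
    show "E \<in> sets \<mu>" using E \<mu>(2) by simp
    fix s :: real assume s: "0 < s"
    define r where "r = s powr - (1 / (real CARD('n) - 1))"
    have r: "0 < r" using s by (simp add: r_def)
    have "emeasure \<mu> {x \<in> E. ennreal s < riesz_kernel (x - y)} \<le> emeasure \<mu> (ball y r)"
      using riesz_kernel_superlevel[OF n s] \<mu>(2)
      by (intro emeasure_mono) (auto simp: r_def dist_norm norm_minus_commute)
    also have "\<dots> \<le> ennreal (a * r ^ CARD('n))" by (rule ball[OF r])
    also have "r ^ CARD('n) = s powr - ?p"
      using r s n by (simp add: powr_realpow[symmetric] r_def powr_powr dual_exponent_def)
    finally show "emeasure \<mu> {x \<in> E. ennreal s < riesz_kernel (x - y)} \<le> ennreal (a * s powr - ?p)" .
  qed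
  then show ?thesis using p by simp
qed

definition cube :: "real^'n \<Rightarrow> real \<Rightarrow> (real^'n) set" where
  "cube a l = cbox a (\<chi> i. a $ i + l)"

lemma mem_cube: "x \<in> cube a l \<longleftrightarrow> (\<forall>i. a $ i \<le> x $ i \<and> x $ i \<le> a $ i + l)"
  by (auto simp: cube_def mem_box_cart)

lemma cubes_at_cases:
  assumes "Q \<in> cubes_at x"
  obtains a l where "Q = cube a l" "0 < l" "x \<in> cube a l"
  using assms by (auto simp: cubes_at_def cubes_def cube_def)

lemma cube_in_cubes_at: "0 < l \<Longrightarrow> x \<in> cube a l \<Longrightarrow> cube a l \<in> cubes_at x"
  by (auto simp: cubes_at_def cubes_def cube_def)

lemma cube_borel [measurable, simp]: "cube a l \<in> sets borel"
  by (simp add: cube_def)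

lemma emeasure_cube:
  fixes a :: "real^'n"
  assumes "0 < l"
  shows "emeasure lborel (cube a l) = ennreal (l ^ CARD('n))"
    and "emeasure lebesgue (cube a l) = ennreal (l ^ CARD('n))"
proof -
  have ne: "cube a l \<noteq> {}"
    using assms by (auto simp: cube_def interval_ne_empty_cart)
  have "measure lborel (cube a l) = l ^ CARD('n)"
    using content_cbox_cart[OF ne[unfolded cube_def]] by (simp add: cube_def)
  moreover have "emeasure lborel (cube a l) = ennreal (measure lborel (cube a l))"
    unfolding cube_def using emeasure_lborel_cbox_finite[of a "\<chi> i. a $ i + l"]
    by (intro emeasure_eq_ennreal_measure) (simp add: less_top)
  ultimately show "emeasure lborel (cube a l) = ennreal (l ^ CARD('n))" by simp
  then show "emeasure lebesgue (cube a l) = ennreal (l ^ CARD('n))"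
    by (simp add: emeasure_completion)
qed

lemma dist_cube_le:
  fixes x :: "real^'n"
  assumes "x \<in> cube a l" "z \<in> cube a l"
  shows "norm (z - x) \<le> real CARD('n) * l"
proof -
  have "norm (z - x) \<le> (\<Sum>i\<in>UNIV. \<bar>(z - x) $ i\<bar>)" by (rule norm_le_l1_cart)
  also have "\<dots> \<le> (\<Sum>i\<in>(UNIV::'n set). l)"
  proof (rule sum_mono)
    fix i :: 'n
    have "a $ i \<le> x $ i \<and> x $ i \<le> a $ i + l" "a $ i \<le> z $ i \<and> z $ i \<le> a $ i + l"
      using assms unfolding mem_cube by blast+
    then show "\<bar>(z - x) $ i\<bar> \<le> l" unfolding vector_minus_component by linarith
  qed
  finally show ?thesis by simp
qed

lemma cball_subset_cube:
  fixes y :: "real^'n"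
  shows "cball y r \<subseteq> cube (\<chi> i. y $ i - r) (2 * r)"
proof
  fix z assume z: "z \<in> cball y r"
  have "\<bar>(z - y) $ i\<bar> \<le> r" for i
    using component_le_norm_cart[of "z - y" i] z by (simp add: dist_norm norm_minus_commute)
  then have "y $ i - r \<le> z $ i \<and> z $ i \<le> y $ i - r + 2 * r" for i
    unfolding vector_minus_component by (smt (verit))
  then show "z \<in> cube (\<chi> i. y $ i - r) (2 * r)"
    by (simp add: mem_cube)
qed

lemma ennreal_average_times:
  assumes "0 < r"
  shows "(a :: ennreal) / ennreal r * ennreal r = a"
  using assms by (simp add: ennreal_divide_times ennreal_times_divide[symmetric] ennreal_divide_self)

lemma circumscribed_cube:
  fixes x :: "real^'n"
  assumes r: "0 < r"
  obtains Q where "Q \<in> cubes_at x" "ball x r \<subseteq> Q" "Q \<in> sets borel"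
    "emeasure lebesgue Q = ennreal ((2 * r) ^ CARD('n))"
proof
  let ?Q = "cube (\<chi> i. x $ i - r) (2 * r)"
  have sub: "cball x r \<subseteq> ?Q" by (rule cball_subset_cube)
  then show "ball x r \<subseteq> ?Q" using ball_subset_cball by blast
  have "x \<in> cball x r" using r by simp
  then have "x \<in> ?Q" using sub by blast
  then show "?Q \<in> cubes_at x" using r by (intro cube_in_cubes_at) auto
qed (use r in \<open>simp_all add: emeasure_cube\<close>)

lemma emeasure_ball_le_maximal_measure:
  fixes y :: "real^'n"
  assumes \<mu>: "sets \<mu> = sets borel" and r: "0 < r"
  shows "emeasure \<mu> (ball y r) \<le> maximal_measure \<mu> y * ennreal ((2 * r) ^ CARD('n))"
proof -
  obtain Q where Q: "Q \<in> cubes_at y" "ball y r \<subseteq> Q" "Q \<in> sets borel"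
    "emeasure lebesgue Q = ennreal ((2 * r) ^ CARD('n))"
    using circumscribed_cube[OF r] by blast
  have "emeasure \<mu> (ball y r) \<le> emeasure \<mu> Q"
    using Q(2,3) \<mu> by (intro emeasure_mono) auto
  also have "\<dots> = emeasure \<mu> Q / emeasure lebesgue Q * ennreal ((2 * r) ^ CARD('n))"
    unfolding Q(4) using r by (intro ennreal_average_times[symmetric]) simp
  also have "\<dots> \<le> maximal_measure \<mu> y * ennreal ((2 * r) ^ CARD('n))"
    unfolding maximal_measure_def by (intro mult_right_mono SUP_upper Q(1)) auto
  finally show ?thesis .
qed

text \<open>
  A cube that contains both \<open>x\<close> and the ball has infinite measure.
\<close>

lemma maximal_measure_top:
  fixes x :: "real^'n"
  assumes \<mu>: "sets \<mu> = sets borel" and r: "emeasure \<mu> (ball y r) = \<infinity>"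
  shows "maximal_measure \<mu> x = \<infinity>"
proof -
  define R where "R = dist x y + \<bar>r\<bar> + 1"
  have sub: "ball y r \<subseteq> ball x R"
  proof
    fix z assume "z \<in> ball y r"
    then show "z \<in> ball x R"
      using dist_triangle[of x z y] by (auto simp: R_def)
  qed
  have R: "0 < R" by (simp add: R_def add_nonneg_pos)
  have "emeasure \<mu> (ball x R) = \<infinity>"
    using emeasure_mono[OF sub, of \<mu>] r \<mu> by (simp add: top_unique)
  then have "maximal_measure \<mu> x * ennreal ((2 * R) ^ CARD('n)) = \<infinity>"
    using emeasure_ball_le_maximal_measure[OF \<mu> R, of x] by (simp add: top_unique)
  then show ?thesis by (simp add: ennreal_mult_eq_top_iff)
qed

text \<open>
  For a superlevel set \<open>E\<close> of finite measure, \<open>t * \<mu>(E)\<close> is at most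
  the integral of the potential over \<open>E\<close>. By Tonelli and the previous bounds for the
  kernel, this is at most a constant times \<open>\<mu>(E) powr (1 / n)\<close> times the integral
  of \<open>g * (M \<mu>) powr (1 / n')\<close>; divide by \<open>\<mu>(E) powr (1 / n)\<close>.
  Superlevel sets are first intersected with balls to make them finite. If a ball has infinite
  measure, then \<open>M \<mu>\<close> is infinite everywhere, and the right-hand side is infinite
  unless \<open>g\<close> vanishes almost everywhere.
\<close>

lemma riesz_weak_type:
  fixes g :: "real^'n \<Rightarrow> ennreal"
  assumes n: "2 \<le> CARD('n)" and \<mu>: "sets \<mu> = sets borel"
    and g [measurable]: "g \<in> borel_measurable borel" and t: "0 < t"
  shows "ennreal t * epowr (emeasure \<mu> {x. ennreal t < riesz g x}) (1 / dual_exponent CARD('n))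
       \<le> ennreal (real CARD('n) * 2 ^ (CARD('n) - 1))
          * (\<integral>\<^sup>+y. g y * epowr (maximal_measure \<mu> y) (1 / dual_exponent CARD('n)) \<partial>lborel)"
    (is "_ \<le> ennreal ?C * ?R")
proof (cases "\<exists>k::nat. emeasure \<mu> (ball 0 (real k)) = \<infinity>")
  case True
  then have top: "maximal_measure \<mu> y = \<infinity>" for y
    using maximal_measure_top[OF \<mu>] by blast
  show ?thesis
  proof (cases "AE y in lborel. g y = 0")
    case True
    then have "riesz g x = 0" for x
      unfolding riesz_def by (subst nn_integral_0_iff_AE) auto
    then show ?thesis by simp
  next
    case False
    then have "(\<integral>\<^sup>+y. g y \<partial>lborel) \<noteq> 0" by (subst nn_integral_0_iff_AE) auto
    moreover have "?R = (\<integral>\<^sup>+y. g y \<partial>lborel) * \<infinity>"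
      unfolding top epowr_top by (rule nn_integral_multc) measurable
    ultimately have "?R = \<infinity>" by (simp add: ennreal_mult_top)
    moreover have "0 < ?C" by simp
    ultimately show ?thesis by (simp add: ennreal_mult_top)
  qed
next
  case False
  let ?p = "dual_exponent CARD('n)"
  note p = dual_exponent_simps[OF n]
  have sf: "sigma_finite_measure \<mu>"
  proof (rule sigma_finite_measure.intro, intro exI[of _ "range (\<lambda>k::nat. ball (0::real^'n) (real k))"] conjI ballI)
    show "countable (range (\<lambda>k::nat. ball (0::real^'n) (real k)))" by simp
    show "range (\<lambda>k::nat. ball (0::real^'n) (real k)) \<subseteq> sets \<mu>"
      unfolding \<mu> by auto
    have "x \<in> (\<Union>k::nat. ball 0 (real k))" for x :: "real^'n"
      using reals_Archimedean2[of "norm x"] by auto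
    then show "(\<Union>k::nat. ball (0::real^'n) (real k)) = space \<mu>"
      unfolding sets_eq_imp_space_eq[OF \<mu>] by auto
    fix B assume "B \<in> range (\<lambda>k::nat. ball (0::real^'n) (real k))"
    then show "emeasure \<mu> B \<noteq> \<infinity>" using False by blast
  qed
  interpret \<mu>: sigma_finite_measure \<mu> by (rule sf)
  interpret pair_sigma_finite \<mu> "lborel :: (real^'n) measure"
    by (rule pair_sigma_finite.intro[OF sf sigma_finite_lborel])
  note [measurable_cong] = \<mu>
  have C0: "0 < ?C" by simp
  define E where "E = (\<lambda>k::nat. {x \<in> ball 0 (real k). ennreal t < riesz g x})"
  have E [measurable]: "E k \<in> sets borel" for k unfolding E_def by measurable
  let ?N = "\<lambda>k y. \<integral>\<^sup>+x\<in>E k. riesz_kernel (x - y) \<partial>\<mu>"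
  let ?S = "{x. ennreal t < riesz g x}"
  let ?e = "\<lambda>k. epowr (emeasure \<mu> (E k)) (1 / ?p)"
  have step: "ennreal t * ?e k \<le> ennreal ?C * ?R" for k
  proof -
    have "emeasure \<mu> (E k) \<le> emeasure \<mu> (ball 0 (real k))"
      using \<mu> by (intro emeasure_mono) (auto simp: E_def)
    also have "\<dots> < \<infinity>" using False by (simp add: less_top[symmetric])
    finally obtain m where m: "emeasure \<mu> (E k) = ennreal m" "0 \<le> m"
      by (cases "emeasure \<mu> (E k)") auto
    show ?thesis
    proof (cases "m = 0")
      case False
      then have m0: "0 < m" using m(2) by simp
      \<comment> \<open>\<open>b\<close> collects all constants of the kernel bound. It is divided out on the side of the kernel, whose integrals are measurable in \<open>y\<close>, rather than on the side of the maximal function.\<close>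
      define b where "b = ?C * m powr (1 / real CARD('n))"
      have b: "0 < b" using m0 by (simp add: b_def)
      have kernel: "?N k y \<le> ennreal b * epowr (maximal_measure \<mu> y) (1 / ?p)" for y
      proof (cases "maximal_measure \<mu> y")
        case (real a)
        have "?N k y
            \<le> ennreal (real CARD('n) * (a * 2 ^ CARD('n)) powr (1 / ?p) * m powr (1 / real CARD('n)))"
        proof (rule nn_integral_riesz_kernel_le[OF n sf \<mu> E _ m(2)])
          fix r :: real assume r: "0 < r"
          show "emeasure \<mu> (ball y r) \<le> ennreal (a * 2 ^ CARD('n) * r ^ CARD('n))"
            using emeasure_ball_le_maximal_measure[OF \<mu> r, of y] real r
            by (simp add: ennreal_mult[symmetric] power_mult_distrib mult_ac)
        qed (use real m in auto)
        also have "(a * 2 ^ CARD('n)) powr (1 / ?p) = a powr (1 / ?p) * 2 ^ (CARD('n) - 1)"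
        proof -
          have "(2 ^ CARD('n)) powr (1 / ?p) = (2::real) powr (real CARD('n) * (1 / ?p))"
            by (simp add: powr_realpow[symmetric] powr_powr)
          also have "real CARD('n) * (1 / ?p) = real (CARD('n) - 1)"
            using n p(3) by (simp add: field_simps of_nat_diff)
          also have "2 powr real (CARD('n) - 1) = (2::real) ^ (CARD('n) - 1)"
            by (rule powr_realpow) simp
          finally show ?thesis using real by (simp add: powr_mult)
        qed
        finally show ?thesis
          using real b by (simp add: epowr_ennreal ennreal_mult[symmetric] b_def mult_ac)
      qed (use b in \<open>simp add: ennreal_mult_top\<close>)
      have "ennreal t * ennreal m = (\<integral>\<^sup>+x\<in>E k. ennreal t \<partial>\<mu>)"
        using \<mu> by (simp add: nn_integral_cmult_indicator m(1))
      also have "\<dots> \<le> (\<integral>\<^sup>+x\<in>E k. riesz g x \<partial>\<mu>)"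
        by (intro nn_integral_mono) (auto simp: E_def indicator_def)
      also have "\<dots> = (\<integral>\<^sup>+x. (\<integral>\<^sup>+y. g y * riesz_kernel (x - y) * indicator (E k) x \<partial>lborel) \<partial>\<mu>)"
        unfolding riesz_def by (intro nn_integral_cong nn_integral_multc[symmetric]) measurable
      also have "\<dots> = (\<integral>\<^sup>+y. (\<integral>\<^sup>+x. g y * riesz_kernel (x - y) * indicator (E k) x \<partial>\<mu>) \<partial>lborel)"
        by (rule Fubini'[symmetric]) measurable
      also have "\<dots> = (\<integral>\<^sup>+y. g y * ?N k y \<partial>lborel)"
        unfolding mult.assoc by (intro nn_integral_cong nn_integral_cmult) measurable
      finally have le: "ennreal t * ennreal m \<le> \<dots>" .
      have "ennreal (1 / b) * (ennreal t * ennreal m)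
          \<le> ennreal (1 / b) * (\<integral>\<^sup>+y. g y * ?N k y \<partial>lborel)"
        by (rule mult_left_mono[OF le]) simp
      also have "\<dots> = (\<integral>\<^sup>+y. ennreal (1 / b) * (g y * ?N k y) \<partial>lborel)"
        by (rule nn_integral_cmult[symmetric]) measurable
      also have "\<dots> \<le> ?R"
      proof (rule nn_integral_mono)
        fix y :: "real^'n"
        have "ennreal (1 / b) * (g y * ?N k y)
            \<le> ennreal (1 / b) * (g y * (ennreal b * epowr (maximal_measure \<mu> y) (1 / ?p)))"
          by (intro mult_left_mono kernel) auto
        also have "\<dots> = (ennreal (1 / b) * ennreal b) * (g y * epowr (maximal_measure \<mu> y) (1 / ?p))"
          by (simp add: mult_ac)
        also have "ennreal (1 / b) * ennreal b = 1"
          using b by (simp add: ennreal_mult[symmetric])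
        finally show "ennreal (1 / b) * (g y * ?N k y)
            \<le> g y * epowr (maximal_measure \<mu> y) (1 / ?p)" by simp
      qed
      finally have "ennreal ?C * (ennreal (1 / b) * (ennreal t * ennreal m)) \<le> ennreal ?C * ?R"
        by (rule mult_left_mono) simp
      moreover have "ennreal ?C * (ennreal (1 / b) * (ennreal t * ennreal m)) = ennreal (?C * (1 / b * (t * m)))"
        using b t m0 by (simp add: ennreal_mult[symmetric])
      moreover have "?C * (1 / b * (t * m)) = t * m powr (1 / ?p)"
        using m0 C0 by (simp add: b_def p(3) powr_diff)
      ultimately show ?thesis
        using t m0 by (simp add: m(1) epowr_ennreal ennreal_mult)
    qed (simp add: m)
  qed
  have bound: "emeasure \<mu> (E k) \<le> epowr (ennreal (1 / t) * (ennreal ?C * ?R)) ?p" for k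
  proof -
    have "ennreal (1 / t) * (ennreal t * ?e k) \<le> ennreal (1 / t) * (ennreal ?C * ?R)"
      by (rule mult_left_mono[OF step]) simp
    moreover have "ennreal (1 / t) * (ennreal t * ?e k) = ?e k"
      using t by (simp add: mult.assoc[symmetric] ennreal_mult[symmetric])
    ultimately show ?thesis
      using epowr_le_imp_le[of "emeasure \<mu> (E k)" "1 / ?p"] p(4) by simp
  qed
  have "\<exists>k. x \<in> ball 0 (real k)" for x :: "real^'n"
    using reals_Archimedean2[of "norm x"] by simp
  then have "?S = (\<Union>k. E k)"
    by (simp add: E_def set_eq_iff)
  also have "emeasure \<mu> (\<Union>k. E k) = (SUP k. emeasure \<mu> (E k))"
  proof (rule SUP_emeasure_incseq[symmetric])
    show "range E \<subseteq> sets \<mu>" unfolding \<mu> using E by blast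
    show "incseq E"
    proof (rule incseq_SucI)
      show "E k \<subseteq> E (Suc k)" for k by (simp add: E_def subset_iff)
    qed
  qed
  also have "\<dots> \<le> epowr (ennreal (1 / t) * (ennreal ?C * ?R)) ?p"
    by (intro SUP_least bound)
  finally have "emeasure \<mu> ?S \<le> epowr (ennreal (1 / t) * (ennreal ?C * ?R)) ?p" .
  then have "epowr (emeasure \<mu> ?S) (1 / ?p) \<le> ennreal (1 / t) * (ennreal ?C * ?R)"
    using le_imp_epowr_le[of "emeasure \<mu> ?S" _ "1 / ?p"] p(4) by simp
  then have "ennreal t * epowr (emeasure \<mu> ?S) (1 / ?p)
      \<le> ennreal t * (ennreal (1 / t) * (ennreal ?C * ?R))"
    by (rule mult_left_mono) simp
  also have "\<dots> = ennreal ?C * ?R"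
    using t by (simp add: mult.assoc[symmetric] ennreal_mult[symmetric])
  finally show ?thesis .
qed

section \<open>Maximal functions of Riesz potentials\<close>

lemma nn_integral_lebesgue_eq:
  "(\<integral>\<^sup>+x. f x \<partial>(lebesgue :: 'a::euclidean_space measure)) = (\<integral>\<^sup>+x. f x \<partial>lborel)"
  by (rule nn_integral_completion)

lemma maximal_mono: "(\<And>y. g y \<le> h y) \<Longrightarrow> maximal g x \<le> maximal h x"
  unfolding maximal_def
  by (intro SUP_mono' divide_right_mono_ennreal nn_integral_mono mult_right_mono) auto

lemma maximal_cmult_le:
  fixes g :: "real^'n \<Rightarrow> ennreal"
  assumes [measurable]: "g \<in> borel_measurable borel"
  shows "maximal (\<lambda>y. c * g y) x \<le> c * maximal g x"
  unfolding maximal_def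
proof (rule SUP_least)
  fix Q assume Q: "Q \<in> cubes_at x"
  then obtain a l where al: "Q = cube a l" by (rule cubes_at_cases)
  have "(\<integral>\<^sup>+y\<in>Q. c * g y \<partial>lebesgue) = c * (\<integral>\<^sup>+y\<in>Q. g y \<partial>lebesgue)"
    unfolding al nn_integral_lebesgue_eq mult.assoc by (rule nn_integral_cmult) measurable
  then have "(\<integral>\<^sup>+y\<in>Q. c * g y \<partial>lebesgue) / emeasure lebesgue Q
      = c * ((\<integral>\<^sup>+y\<in>Q. g y \<partial>lebesgue) / emeasure lebesgue Q)"
    by (simp add: ennreal_times_divide)
  also have "\<dots> \<le> c * (SUP Q\<in>cubes_at x. (\<integral>\<^sup>+y\<in>Q. g y \<partial>lebesgue) / emeasure lebesgue Q)"
    by (intro mult_left_mono SUP_upper Q) auto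
  finally show "(\<integral>\<^sup>+y\<in>Q. c * g y \<partial>lebesgue) / emeasure lebesgue Q \<le> \<dots>" .
qed

text \<open>
  The first summand serves cubes far from the pole of the kernel, the second one cubes near it.
\<close>

definition riesz_maximal_const :: "nat \<Rightarrow> real" where
  "riesz_maximal_const n = 2 ^ (n - 1)
     + real n * unit_ball_vol (real n) powr (1 / dual_exponent n) * (2 * real n) ^ (n - 1)"

text \<open>
  The kernel is an \<open>A\<^sub>1\<close> weight. On a cube whose distance from the pole is large
  compared to its side length \<open>l\<close>, the kernel is constant up to a factor. Otherwise its
  average is at most a constant times \<open>l powr (1 - n)\<close>, and \<open>l\<close> is at
  least a multiple of \<open>\<bar>x - y\<bar>\<close>.
\<close>

lemma riesz_kernel_average_le:
  fixes x y :: "real^'n"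
  assumes n: "2 \<le> CARD('n)" and l: "0 < l" and x: "x \<in> cube a l" and ne: "y \<noteq> x"
  shows "(\<integral>\<^sup>+z\<in>cube a l. riesz_kernel (z - y) \<partial>lborel)
       \<le> ennreal (riesz_maximal_const CARD('n) * l ^ CARD('n)) * riesz_kernel (x - y)"
proof -
  let ?n = "CARD('n)" and ?Q = "cube a l"
  define d where "d = norm (x - y)"
  have d: "0 < d" using ne by (simp add: d_def)
  have pw: "r ^ ?n = r * r ^ (?n - 1)" for r :: real
    by (metis Suc_diff_1 power_Suc zero_less_card_finite)
  define v where "v = unit_ball_vol (real ?n)"
  have v: "0 \<le> v" by (simp add: v_def less_imp_le)
  have rhs: "ennreal (riesz_maximal_const ?n * l ^ ?n) * riesz_kernel (x - y)
      = ennreal (riesz_maximal_const ?n * l ^ ?n / d ^ (?n - 1))"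
    using l d v by (simp add: riesz_kernel_def d_def riesz_maximal_const_def ennreal_mult[symmetric] v_def)
  show ?thesis
  proof (cases "2 * real ?n * l \<le> d")
    case True
    have "(\<integral>\<^sup>+z\<in>?Q. riesz_kernel (z - y) \<partial>lborel) \<le> (\<integral>\<^sup>+z\<in>?Q. ennreal (2 ^ (?n - 1) / d ^ (?n - 1)) \<partial>lborel)"
    proof (intro nn_integral_mono)
      fix z
      show "riesz_kernel (z - y) * indicator ?Q z \<le> ennreal (2 ^ (?n - 1) / d ^ (?n - 1)) * indicator ?Q z"
      proof (cases "z \<in> ?Q")
        case z: True
        have "norm (z - x) \<le> d / 2" using dist_cube_le[OF x z] True by simp
        then have "d / 2 \<le> norm (z - y)"
          using norm_triangle_ineq[of "z - y" "x - z"] by (simp add: d_def norm_minus_commute)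
        then have "1 / norm (z - y) ^ (?n - 1) \<le> 1 / (d / 2) ^ (?n - 1)"
          using d by (intro divide_left_mono power_mono mult_pos_pos zero_less_power) auto
        then show ?thesis
          using z by (auto simp: riesz_kernel_def power_divide intro!: ennreal_leI)
      qed simp
    qed
    also have "\<dots> = ennreal (2 ^ (?n - 1) / d ^ (?n - 1)) * ennreal (l ^ ?n)"
      using l by (simp add: nn_integral_cmult_indicator emeasure_cube)
    also have "\<dots> = ennreal (2 ^ (?n - 1) * l ^ ?n / d ^ (?n - 1))"
      using l d by (simp add: ennreal_mult[symmetric])
    also have "\<dots> \<le> ennreal (riesz_maximal_const ?n * l ^ ?n / d ^ (?n - 1))"
      using l d v by (intro ennreal_leI divide_right_mono mult_right_mono) (auto simp: riesz_maximal_const_def v_def)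
    finally show ?thesis unfolding rhs .
  next
    case False
    have "(\<integral>\<^sup>+z\<in>?Q. riesz_kernel (z - y) \<partial>lborel)
        \<le> ennreal (real ?n * v powr (1 / dual_exponent ?n) * (l ^ ?n) powr (1 / real ?n))"
      using l v by (intro nn_integral_riesz_kernel_le[OF n sigma_finite_lborel])
        (auto simp: emeasure_cube emeasure_ball v_def)
    also have "(l ^ ?n) powr (1 / real ?n) = l"
      using l by (simp add: powr_realpow[symmetric] powr_powr)
    also have "ennreal (real ?n * v powr (1 / dual_exponent ?n) * l)
        \<le> ennreal (riesz_maximal_const ?n * l ^ ?n / d ^ (?n - 1))"
    proof (rule ennreal_leI)
      have "d ^ (?n - 1) \<le> (2 * real ?n * l) ^ (?n - 1)"
        using False d by (intro power_mono) auto
      then have "l * d ^ (?n - 1) \<le> l * ((2 * real ?n) ^ (?n - 1) * l ^ (?n - 1))"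
        using l by (intro mult_left_mono) (auto simp: power_mult_distrib)
      also have "\<dots> = (2 * real ?n) ^ (?n - 1) * l ^ ?n" by (simp add: pw)
      finally have "l \<le> (2 * real ?n) ^ (?n - 1) * l ^ ?n / d ^ (?n - 1)"
        using d by (simp add: pos_le_divide_eq)
      then have "real ?n * v powr (1 / dual_exponent ?n) * l
          \<le> real ?n * v powr (1 / dual_exponent ?n) * ((2 * real ?n) ^ (?n - 1) * l ^ ?n / d ^ (?n - 1))"
        by (intro mult_left_mono) auto
      also have "\<dots> \<le> riesz_maximal_const ?n * l ^ ?n / d ^ (?n - 1)"
      proof -
        have "real ?n * v powr (1 / dual_exponent ?n) * (2 * real ?n) ^ (?n - 1) \<le> riesz_maximal_const ?n"
          unfolding riesz_maximal_const_def v_def by simp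
        then have "real ?n * v powr (1 / dual_exponent ?n) * (2 * real ?n) ^ (?n - 1) * (l ^ ?n / d ^ (?n - 1))
            \<le> riesz_maximal_const ?n * (l ^ ?n / d ^ (?n - 1))"
          using l d by (intro mult_right_mono) auto
        then show ?thesis by (simp only: times_divide_eq_right mult.assoc)
      qed
      finally show "real ?n * v powr (1 / dual_exponent ?n) * l \<le> riesz_maximal_const ?n * l ^ ?n / d ^ (?n - 1)" .
    qed
    finally show ?thesis unfolding rhs .
  qed
qed

lemma riesz_maximal_const_nonneg: "0 \<le> riesz_maximal_const n"
  unfolding riesz_maximal_const_def by (intro add_nonneg_nonneg mult_nonneg_nonneg) auto

text \<open>
  A superposition of \<open>A\<^sub>1\<close> weights with a common constant is again one.
\<close>

lemma maximal_riesz_le: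
  fixes g :: "real^'n \<Rightarrow> ennreal"
  assumes n: "2 \<le> CARD('n)" and [measurable]: "g \<in> borel_measurable borel"
  shows "maximal (riesz g) x \<le> ennreal (riesz_maximal_const CARD('n)) * riesz g x"
  unfolding maximal_def
proof (rule SUP_least)
  fix Q assume Q: "Q \<in> cubes_at x"
  then obtain a l where al: "Q = cube a l" "0 < l" "x \<in> cube a l" by (rule cubes_at_cases)
  let ?A = "ennreal (riesz_maximal_const CARD('n))"
  have "(\<integral>\<^sup>+z\<in>Q. riesz g z \<partial>lebesgue)
      = (\<integral>\<^sup>+z. (\<integral>\<^sup>+y. g y * riesz_kernel (z - y) * indicator (cube a l) z \<partial>lborel) \<partial>lborel)"
    unfolding al(1) nn_integral_lebesgue_eq riesz_def
    by (intro nn_integral_cong nn_integral_multc[symmetric]) measurable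
  also have "\<dots> = (\<integral>\<^sup>+y. (\<integral>\<^sup>+z. g y * riesz_kernel (z - y) * indicator (cube a l) z \<partial>lborel) \<partial>lborel)"
    by (rule lborel_pair.Fubini'[symmetric]) measurable
  also have "\<dots> = (\<integral>\<^sup>+y. g y * (\<integral>\<^sup>+z\<in>cube a l. riesz_kernel (z - y) \<partial>lborel) \<partial>lborel)"
    unfolding mult.assoc by (intro nn_integral_cong nn_integral_cmult) measurable
  also have "\<dots> \<le> (\<integral>\<^sup>+y. g y * (ennreal (riesz_maximal_const CARD('n) * l ^ CARD('n)) * riesz_kernel (x - y)) \<partial>lborel)"
    using al n by (intro nn_integral_mono_AE AE_lborel_neI[of x] mult_left_mono riesz_kernel_average_le) auto
  also have "\<dots> = (\<integral>\<^sup>+y. (?A * ennreal (l ^ CARD('n))) * (g y * riesz_kernel (x - y)) \<partial>lborel)"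
    using al riesz_maximal_const_nonneg by (intro nn_integral_cong) (simp add: ennreal_mult mult_ac)
  also have "\<dots> = ?A * ennreal (l ^ CARD('n)) * riesz g x"
    unfolding riesz_def by (rule nn_integral_cmult) measurable
  finally have "(\<integral>\<^sup>+z\<in>Q. riesz g z \<partial>lebesgue) / emeasure lebesgue Q
      \<le> ?A * ennreal (l ^ CARD('n)) * riesz g x / ennreal (l ^ CARD('n))"
    using al by (simp add: emeasure_cube divide_right_mono_ennreal)
  also have "\<dots> = ?A * riesz g x * (ennreal (l ^ CARD('n)) / ennreal (l ^ CARD('n)))"
    by (simp add: ennreal_times_divide mult_ac)
  also have "ennreal (l ^ CARD('n)) / ennreal (l ^ CARD('n)) = 1"
    using al by (intro ennreal_divide_self) auto
  finally show "(\<integral>\<^sup>+z\<in>Q. riesz g z \<partial>lebesgue) / emeasure lebesgue Q \<le> ?A * riesz g x" by simp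
qed

lemma nn_integral_ball_le_maximal:
  fixes x :: "real^'n"
  assumes r: "0 < r"
  shows "(\<integral>\<^sup>+y\<in>ball x r. h y \<partial>lborel) \<le> maximal h x * ennreal ((2 * r) ^ CARD('n))"
proof -
  obtain Q where Q: "Q \<in> cubes_at x" "ball x r \<subseteq> Q" "Q \<in> sets borel"
    "emeasure lebesgue Q = ennreal ((2 * r) ^ CARD('n))"
    using circumscribed_cube[OF r] by blast
  have "(\<integral>\<^sup>+y\<in>ball x r. h y \<partial>lborel) \<le> (\<integral>\<^sup>+y\<in>Q. h y \<partial>lebesgue)"
    unfolding nn_integral_lebesgue_eq
    using Q(2) by (intro nn_integral_mono mult_left_mono) (auto simp: indicator_def)
  also have "\<dots> = (\<integral>\<^sup>+y\<in>Q. h y \<partial>lebesgue) / emeasure lebesgue Q * ennreal ((2 * r) ^ CARD('n))"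
    unfolding Q(4) using r by (intro ennreal_average_times[symmetric]) simp
  also have "\<dots> \<le> maximal h x * ennreal ((2 * r) ^ CARD('n))"
    unfolding maximal_def by (intro mult_right_mono SUP_upper Q(1)) auto
  finally show ?thesis .
qed

lemma nn_integral_ball_le_riesz:
  fixes x :: "real^'n"
  assumes r: "0 < r" and [measurable]: "g \<in> borel_measurable borel"
  shows "(\<integral>\<^sup>+y\<in>ball x r. g y \<partial>lborel) \<le> ennreal (r ^ (CARD('n) - 1)) * riesz g x"
proof -
  have "(\<integral>\<^sup>+y\<in>ball x r. g y \<partial>lborel)
      \<le> (\<integral>\<^sup>+y. ennreal (r ^ (CARD('n) - 1)) * (g y * riesz_kernel (x - y)) \<partial>lborel)"
  proof (intro nn_integral_mono_AE AE_lborel_neI[of x])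
    fix y assume y: "y \<noteq> x"
    show "g y * indicator (ball x r) y \<le> ennreal (r ^ (CARD('n) - 1)) * (g y * riesz_kernel (x - y))"
    proof (cases "y \<in> ball x r")
      case True
      have "1 \<le> r ^ (CARD('n) - 1) * (1 / norm (x - y) ^ (CARD('n) - 1))"
        using True y by (simp add: dist_norm power_mono pos_le_divide_eq)
      then have "1 \<le> ennreal (r ^ (CARD('n) - 1)) * riesz_kernel (x - y)"
        using r unfolding riesz_kernel_def by (subst ennreal_mult[symmetric]) auto
      then have "g y * 1 \<le> g y * (ennreal (r ^ (CARD('n) - 1)) * riesz_kernel (x - y))"
        by (rule mult_left_mono) simp
      then show ?thesis using True by (simp add: mult_ac)
    qed simp
  qed
  also have "\<dots> = ennreal (r ^ (CARD('n) - 1)) * riesz g x"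
    unfolding riesz_def by (rule nn_integral_cmult) measurable
  finally show ?thesis .
qed

section \<open>Smooth truncation\<close>

declare borel_open[OF open_ball, measurable]

text \<open>
  A continuously differentiable transition from \<open>0\<close> to \<open>1\<close> on the unit
  interval; its derivative is a tent of height \<open>2\<close>.
\<close>

definition smooth_step :: "real \<Rightarrow> real" where
  "smooth_step u = 2 * (max 0 u)\<^sup>2 - 4 * (max 0 (u - 1 / 2))\<^sup>2 + 2 * (max 0 (u - 1))\<^sup>2"

definition smooth_step' :: "real \<Rightarrow> real" where
  "smooth_step' u = 4 * max 0 u - 8 * max 0 (u - 1 / 2) + 4 * max 0 (u - 1)"

lemma DERIV_pos_part_squared: "((\<lambda>u::real. (max 0 u)\<^sup>2) has_real_derivative 2 * max 0 u) (at u)"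
proof -
  consider "0 < u" | "u < 0" | "u = 0" by linarith
  then show ?thesis
  proof cases
    case 1
    have "((\<lambda>u::real. u\<^sup>2) has_real_derivative 2 * max 0 u) (at u)"
      using 1 by (auto intro!: derivative_eq_intros)
    then show ?thesis
      by (rule has_field_derivative_transform_within_open[where S="{0<..}"]) (use 1 in auto)
  next
    case 2
    have "((\<lambda>u::real. 0) has_real_derivative 2 * max 0 u) (at u)"
      using 2 by (auto intro!: derivative_eq_intros)
    then show ?thesis
      by (rule has_field_derivative_transform_within_open[where S="{..<0}"]) (use 2 in auto)
  next
    case 3
    have "((\<lambda>h::real. (max 0 h)\<^sup>2 / h) \<longlongrightarrow> 0) (at 0)"
    proof (rule Lim_null_comparison)
      show "\<forall>\<^sub>F h in at (0::real). norm ((max 0 h)\<^sup>2 / h) \<le> \<bar>h\<bar>"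
        by (rule always_eventually) (auto simp: max_def power2_eq_square)
      show "((\<lambda>h::real. \<bar>h\<bar>) \<longlongrightarrow> 0) (at 0)"
        by (rule tendsto_eq_intros | simp)+
    qed
    then show ?thesis
      using 3 by (simp add: has_field_derivative_iff)
  qed
qed

lemma DERIV_smooth_step: "(smooth_step has_real_derivative smooth_step' u) (at u)"
proof -
  have shift: "((\<lambda>u. (max 0 (u - c))\<^sup>2) has_real_derivative 2 * max 0 (u - c)) (at u)" for c
  proof -
    have "((\<lambda>u. u - c) has_real_derivative 1) (at u)"
      by (auto intro!: derivative_eq_intros)
    from DERIV_chain2[OF DERIV_pos_part_squared this] show ?thesis by simp
  qed
  have "((\<lambda>u. 2 * (max 0 (u - 0))\<^sup>2 - 4 * (max 0 (u - 1 / 2))\<^sup>2 + 2 * (max 0 (u - 1))\<^sup>2)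
      has_real_derivative 2 * (2 * max 0 (u - 0)) - 4 * (2 * max 0 (u - 1 / 2)) + 2 * (2 * max 0 (u - 1))) (at u)"
    by (intro DERIV_add DERIV_diff DERIV_cmult shift)
  then show ?thesis
    by (simp add: smooth_step_def[abs_def] smooth_step'_def)
qed

lemma smooth_step_le_0: "u \<le> 0 \<Longrightarrow> smooth_step u = 0"
  by (simp add: smooth_step_def)

lemma smooth_step_ge_1: "1 \<le> u \<Longrightarrow> smooth_step u = 1"
  by (simp add: smooth_step_def power2_eq_square algebra_simps)

lemma smooth_step'_eq_0: "u \<le> 0 \<or> 1 \<le> u \<Longrightarrow> smooth_step' u = 0"
  by (auto simp: smooth_step'_def)

lemma smooth_step'_bounds: "0 \<le> smooth_step' u" "smooth_step' u \<le> 2"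
  by (auto simp: smooth_step'_def max_def)

lemma smooth_step_mono: "u \<le> v \<Longrightarrow> smooth_step u \<le> smooth_step v"
  by (rule DERIV_nonneg_imp_nondecreasing) (use DERIV_smooth_step smooth_step'_bounds(1) in blast)+

lemma smooth_step_bounds: "0 \<le> smooth_step u" "smooth_step u \<le> 1"
  using smooth_step_mono[of "min 0 u" u] smooth_step_mono[of u "max 1 u"]
  by (simp_all add: smooth_step_le_0 smooth_step_ge_1)

lemma continuous_on_smooth_step': "continuous_on UNIV smooth_step'"
  unfolding smooth_step'_def[abs_def] by (intro continuous_intros)

text \<open>
  This is \<open>0\<close> for \<open>0 \<le> a \<le> \<rho>\<close> and \<open>1\<close> for
  \<open>2 * \<rho> \<le> a\<close>. It is a function of the square of \<open>a\<close>, so that its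
  composition with the norm of a differentiable function is differentiable also where the latter
  vanishes.
\<close>

definition level_cut :: "real \<Rightarrow> real \<Rightarrow> real" where
  "level_cut \<rho> a = smooth_step ((a\<^sup>2 / \<rho>\<^sup>2 - 1) / 3)"

lemma level_cut_bounds: "0 \<le> level_cut \<rho> a" "level_cut \<rho> a \<le> 1"
  by (simp_all add: level_cut_def smooth_step_bounds)

lemma level_cut_eq_0: "0 < \<rho> \<Longrightarrow> 0 \<le> a \<Longrightarrow> a \<le> \<rho> \<Longrightarrow> level_cut \<rho> a = 0"
  unfolding level_cut_def by (rule smooth_step_le_0) (simp add: power_mono)

lemma level_cut_eq_1:
  assumes "0 < \<rho>" "2 * \<rho> \<le> a"
  shows "level_cut \<rho> a = 1"
proof -
  have "(2 * \<rho>)\<^sup>2 \<le> a\<^sup>2" using assms by (intro power_mono) auto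
  then show ?thesis
    unfolding level_cut_def using assms by (intro smooth_step_ge_1) (simp add: field_simps)
qed

text \<open>
  The truncation sees the gradient only on the set where the size of \<open>f\<close> lies between
  \<open>\<rho>\<close> and \<open>2 * \<rho>\<close>, up to the unavoidable factor \<open>1 /
  \<rho>\<close>. For \<open>f y = x - y\<close> it yields a cutoff function for balls.
\<close>

lemma grad_bound_level_cut:
  fixes f :: "'a::euclidean_space \<Rightarrow> 'b::real_inner"
  assumes f: "grad_bound f G" and \<rho>: "0 < \<rho>"
  obtains H where "grad_bound (\<lambda>x. level_cut \<rho> (norm (f x))) H"
    "\<And>x. H x \<le> (if \<rho> < norm (f x) \<and> norm (f x) < 2 * \<rho> then 3 / \<rho> * G x else 0)"
proof
  define u where "u = (\<lambda>x. ((f x \<bullet> f x) / \<rho>\<^sup>2 - 1) / 3)"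
  define H where "H = (\<lambda>x. smooth_step' (u x) * (2 / (3 * \<rho>\<^sup>2)) * norm (f x) * G x)"
  have cut: "level_cut \<rho> (norm (f x)) = smooth_step (u x)" for x
    by (simp add: level_cut_def u_def power2_norm_eq_inner)
  show "grad_bound (\<lambda>x. level_cut \<rho> (norm (f x))) H"
    unfolding grad_bound_def cut
  proof (intro conjI allI)
    have "continuous_on UNIV u"
      unfolding u_def by (intro continuous_intros grad_bound_continuous_fun[OF f]) (use \<rho> in auto)
    then show "continuous_on UNIV H"
      unfolding H_def
      by (intro continuous_intros grad_bound_continuous_fun[OF f] grad_bound_continuous[OF f]
          continuous_on_compose2[OF continuous_on_smooth_step']) auto
    fix x
    obtain D where D: "(f has_derivative D) (at x)" "\<And>v. norm (D v) \<le> G x * norm v"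
      using f unfolding grad_bound_def by metis
    have "(u has_derivative (\<lambda>v. (2 / (3 * \<rho>\<^sup>2)) * (f x \<bullet> D v))) (at x)"
      unfolding u_def using \<rho>
      by (auto intro!: derivative_eq_intros D(1) simp: inner_commute field_simps)
    from has_derivative_compose[OF this DERIV_smooth_step[unfolded has_field_derivative_def]]
    have "((\<lambda>x. smooth_step (u x)) has_derivative (\<lambda>v. smooth_step' (u x) * ((2 / (3 * \<rho>\<^sup>2)) * (f x \<bullet> D v)))) (at x)" .
    moreover have "norm (smooth_step' (u x) * ((2 / (3 * \<rho>\<^sup>2)) * (f x \<bullet> D v))) \<le> H x * norm v" for v
    proof -
      have "\<bar>f x \<bullet> D v\<bar> \<le> norm (f x) * (G x * norm v)"
        using Cauchy_Schwarz_ineq2[of "f x" "D v"] D(2)[of v]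
        by (meson mult_left_mono norm_ge_zero order_trans)
      then have "smooth_step' (u x) * (2 / (3 * \<rho>\<^sup>2)) * \<bar>f x \<bullet> D v\<bar>
          \<le> smooth_step' (u x) * (2 / (3 * \<rho>\<^sup>2)) * (norm (f x) * (G x * norm v))"
        using smooth_step'_bounds(1)[of "u x"] by (intro mult_left_mono) auto
      then show ?thesis
        using smooth_step'_bounds(1)[of "u x"] by (simp add: H_def abs_mult mult_ac)
    qed
    ultimately show "\<exists>D. ((\<lambda>x. smooth_step (u x)) has_derivative D) (at x) \<and> (\<forall>v. norm (D v) \<le> H x * norm v)"
      by blast
  qed
  fix x
  have G: "0 \<le> G x" by (rule grad_bound_nonneg[OF f])
  show "H x \<le> (if \<rho> < norm (f x) \<and> norm (f x) < 2 * \<rho> then 3 / \<rho> * G x else 0)"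
  proof (cases "\<rho> < norm (f x) \<and> norm (f x) < 2 * \<rho>")
    case True
    have "smooth_step' (u x) * (2 / (3 * \<rho>\<^sup>2)) * norm (f x) \<le> 2 * (2 / (3 * \<rho>\<^sup>2)) * (2 * \<rho>)"
      using True \<rho> smooth_step'_bounds[of "u x"] by (intro mult_mono) auto
    also have "\<dots> \<le> 3 / \<rho>" using \<rho> by (simp add: field_simps power2_eq_square)
    finally have "H x \<le> 3 / \<rho> * G x" unfolding H_def by (rule mult_right_mono[OF _ G])
    then show ?thesis using True by simp
  next
    case False
    then have "norm (f x) \<le> \<rho> \<or> 2 * \<rho> \<le> norm (f x)" by auto
    then have "(norm (f x))\<^sup>2 \<le> \<rho>\<^sup>2 \<or> (2 * \<rho>)\<^sup>2 \<le> (norm (f x))\<^sup>2"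
      using \<rho> by (meson less_imp_le mult_nonneg_nonneg norm_ge_zero power_mono zero_le_numeral)
    then have "u x \<le> 0 \<or> 1 \<le> u x"
      using \<rho> by (auto simp: u_def power2_norm_eq_inner[symmetric] field_simps)
    then have "H x = 0" by (simp add: H_def smooth_step'_eq_0)
    then show ?thesis using False by auto
  qed
qed

lemma grad_bound_const_minus:
  assumes "grad_bound f G"
  shows "grad_bound (\<lambda>x. c - f x) G"
  unfolding grad_bound_def
proof (intro conjI allI)
  show "continuous_on UNIV G" by (rule grad_bound_continuous[OF assms])
  fix x
  obtain D where D: "(f has_derivative D) (at x)" "\<And>v. norm (D v) \<le> G x * norm v"
    using assms unfolding grad_bound_def by metis
  have "((\<lambda>x. c - f x) has_derivative (\<lambda>v. - D v)) (at x)"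
    by (auto intro!: derivative_eq_intros D(1))
  then show "\<exists>D. ((\<lambda>x. c - f x) has_derivative D) (at x) \<and> (\<forall>v. norm (D v) \<le> G x * norm v)"
    using D(2) by (intro exI[of _ "\<lambda>v. - D v"]) auto
qed

lemma grad_bound_reflect:
  assumes "grad_bound f G"
  shows "grad_bound (\<lambda>y. f (x - y)) (\<lambda>y. G (x - y))"
  unfolding grad_bound_def
proof (intro conjI allI)
  show "continuous_on UNIV (\<lambda>y. G (x - y))"
    by (intro continuous_on_compose2[OF grad_bound_continuous[OF assms]] continuous_intros) auto
  fix y
  obtain D where D: "(f has_derivative D) (at (x - y))" "\<And>v. norm (D v) \<le> G (x - y) * norm v"
    using assms unfolding grad_bound_def by metis
  have "((\<lambda>y. x - y) has_derivative (\<lambda>v. - v)) (at y)"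
    by (auto intro!: derivative_eq_intros)
  from has_derivative_compose[OF this D(1)]
  have "((\<lambda>y. f (x - y)) has_derivative (\<lambda>v. D (- v))) (at y)" .
  moreover have "norm (D (- v)) \<le> G (x - y) * norm v" for v
    using D(2)[of "- v"] by simp
  ultimately show "\<exists>D. ((\<lambda>y. f (x - y)) has_derivative D) (at y) \<and> (\<forall>v. norm (D v) \<le> G (x - y) * norm v)"
    by blast
qed

lemma grad_bound_scaleR:
  fixes f :: "'a::euclidean_space \<Rightarrow> 'b::real_normed_vector"
  assumes \<psi>: "grad_bound \<psi> H" and f: "grad_bound f G"
  shows "grad_bound (\<lambda>x. \<psi> x *\<^sub>R f x) (\<lambda>x. \<bar>\<psi> x\<bar> * G x + H x * norm (f x))"
  unfolding grad_bound_def
proof (intro conjI allI)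
  show "continuous_on UNIV (\<lambda>x. \<bar>\<psi> x\<bar> * G x + H x * norm (f x))"
    using grad_bound_continuous[OF f] grad_bound_continuous_fun[OF f]
      grad_bound_continuous[OF \<psi>] grad_bound_continuous_fun[OF \<psi>]
    by (intro continuous_intros)
  fix x
  obtain D where D: "(f has_derivative D) (at x)" "\<And>v. norm (D v) \<le> G x * norm v"
    using f unfolding grad_bound_def by metis
  obtain D' where D': "(\<psi> has_derivative D') (at x)" "\<And>v. norm (D' v) \<le> H x * norm v"
    using \<psi> unfolding grad_bound_def by metis
  have "((\<lambda>x. \<psi> x *\<^sub>R f x) has_derivative (\<lambda>v. \<psi> x *\<^sub>R D v + D' v *\<^sub>R f x)) (at x)"
    using D(1) D'(1) by (rule has_derivative_scaleR[rotated])
  moreover have "norm (\<psi> x *\<^sub>R D v + D' v *\<^sub>R f x) \<le> (\<bar>\<psi> x\<bar> * G x + H x * norm (f x)) * norm v" for v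
  proof -
    have "norm (\<psi> x *\<^sub>R D v + D' v *\<^sub>R f x) \<le> \<bar>\<psi> x\<bar> * norm (D v) + norm (D' v) * norm (f x)"
      using norm_triangle_ineq[of "\<psi> x *\<^sub>R D v" "D' v *\<^sub>R f x"] by simp
    also have "\<dots> \<le> \<bar>\<psi> x\<bar> * (G x * norm v) + (H x * norm v) * norm (f x)"
      by (intro add_mono mult_left_mono mult_right_mono D(2) D'(2)) auto
    finally show ?thesis by (simp add: algebra_simps)
  qed
  ultimately show "\<exists>D. ((\<lambda>x. \<psi> x *\<^sub>R f x) has_derivative D) (at x)
      \<and> (\<forall>v. norm (D v) \<le> (\<bar>\<psi> x\<bar> * G x + H x * norm (f x)) * norm v)"
    by blast
qed

section \<open>The Sobolev inequality with a Lorentz norm\<close>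

lemma maximal_measure_lborel_le: "maximal_measure lborel x \<le> 1"
  unfolding maximal_measure_def
proof (rule SUP_least)
  fix Q assume "Q \<in> cubes_at x"
  then obtain a l where al: "Q = cube a l" "0 < l" by (rule cubes_at_cases)
  then have "emeasure lborel Q / emeasure lebesgue Q = ennreal (l ^ CARD('a)) / ennreal (l ^ CARD('a))"
    by (simp add: emeasure_cube)
  also have "\<dots> = 1" using al by (intro ennreal_divide_self) auto
  finally show "emeasure lborel Q / emeasure lebesgue Q \<le> 1" by simp
qed

text \<open>
  The weak-type inequality for Lebesgue measure alone gives only weak
  \<open>L\<^sup>n\<^sup>'\<close>. Applied to the truncation of \<open>f\<close> between \<open>t /
  2\<close> and \<open>t\<close>, it bounds the integrand at \<open>t\<close> by \<open>C /
  t\<close> times the integral of \<open>G\<close> over the set where \<open>t / 2 < \<bar>f\<bar> <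
  t\<close>. Integrating over \<open>t\<close> first, every \<open>x\<close> contributes for
  \<open>t\<close> between \<open>\<bar>f x\<bar>\<close> and \<open>2 * \<bar>f x\<bar>\<close>,
  where \<open>1 / t\<close> has integral at most \<open>1\<close>.
\<close>

lemma lorentz_sobolev:
  assumes n: "2 \<le> CARD('n)"
  obtains C where "0 < C" "\<And>(f :: real^'n \<Rightarrow> 'b::real_inner) G. grad_bound f G \<Longrightarrow> bounded {x. f x \<noteq> 0} \<Longrightarrow>
    (\<integral>\<^sup>+t\<in>{0<..}. epowr (emeasure lborel {x. t < norm (f x)}) (1 / dual_exponent CARD('n)) \<partial>lborel)
      \<le> ennreal C * (\<integral>\<^sup>+x. ennreal (G x) \<partial>lborel)"
proof -
  let ?p = "dual_exponent CARD('n)"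
  note p = dual_exponent_simps[OF n]
  obtain A where "riesz_bound (\<lambda>(f :: real^'n \<Rightarrow> real) x. ennreal (norm (f x))) A"
    using norm_le_riesz by blast
  note A = riesz_boundD[OF this]
  define K where "K = real CARD('n) * 2 ^ (CARD('n) - 1)"
  have K: "0 < K" by (simp add: K_def)
  define C where "C = 2 * A * K * 6"
  show thesis
  proof
    show "0 < C" using A K by (simp add: C_def)
    fix f :: "real^'n \<Rightarrow> 'b" and G assume f: "grad_bound f G" and supp: "bounded {x. f x \<noteq> 0}"
    have [measurable]: "G \<in> borel_measurable borel" by (rule grad_bound_measurable[OF f])
    have [measurable]: "(\<lambda>x. norm (f x)) \<in> borel_measurable borel"
      by (intro borel_measurable_continuous_onI continuous_intros grad_bound_continuous_fun[OF f])
    let ?\<mu> = "\<lambda>t. epowr (emeasure lborel {x. t < norm (f x)}) (1 / ?p)"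
    let ?\<kappa> = "\<lambda>t x. if t / 2 < norm (f x) \<and> norm (f x) < t then ennreal (G x) * ennreal (1 / t) else 0"
    let ?k = "\<lambda>t x. ennreal C * (if 0 < t \<and> t / 2 < norm (f x) \<and> norm (f x) < t then ennreal (G x) * ennreal (1 / t) else 0)"
    have level: "?\<mu> t
        \<le> (\<integral>\<^sup>+x. ennreal C * ?\<kappa> t x \<partial>lborel)"
      if t: "0 < t" for t
    proof -
      obtain H where H: "grad_bound (\<lambda>x. level_cut (t / 2) (norm (f x))) H"
        "\<And>x. H x \<le> (if t / 2 < norm (f x) \<and> norm (f x) < 2 * (t / 2) then 3 / (t / 2) * G x else 0)"
        using grad_bound_level_cut[OF f, of "t / 2"] t by auto
      have [measurable]: "H \<in> borel_measurable borel" by (rule grad_bound_measurable[OF H(1)])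
      have "bounded {x. level_cut (t / 2) (norm (f x)) \<noteq> 0}"
        using level_cut_eq_0[of "t / 2" 0] t by (intro bounded_subset[OF supp]) auto
      note riesz = A(2)[OF H(1) this]
      let ?E = "{x. ennreal (1 / (2 * A)) < riesz (\<lambda>y. ennreal (H y)) x}"
      have sub: "{x. t < norm (f x)} \<subseteq> ?E"
      proof
        fix x assume "x \<in> {x. t < norm (f x)}"
        then have "level_cut (t / 2) (norm (f x)) = 1" using t by (intro level_cut_eq_1) auto
        then have "1 \<le> ennreal A * riesz (\<lambda>y. ennreal (H y)) x" using riesz[of x] by simp
        then have "ennreal (1 / A) * 1 \<le> ennreal (1 / A) * (ennreal A * riesz (\<lambda>y. ennreal (H y)) x)"
          by (rule mult_left_mono) simp
        also have "\<dots> = riesz (\<lambda>y. ennreal (H y)) x"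
          using A(1) by (simp add: mult.assoc[symmetric] ennreal_mult[symmetric])
        finally have "ennreal (1 / A) \<le> riesz (\<lambda>y. ennreal (H y)) x" by simp
        moreover have "ennreal (1 / (2 * A)) < ennreal (1 / A)"
          using A(1) by (intro ennreal_lessI) (auto simp: field_simps)
        ultimately show "x \<in> ?E" by auto
      qed
      have "ennreal (1 / (2 * A)) * ?\<mu> t
          \<le> ennreal (1 / (2 * A)) * epowr (emeasure lborel ?E) (1 / ?p)"
        using sub p by (intro mult_left_mono epowr_mono emeasure_mono) auto
      also have "\<dots> \<le> ennreal K * (\<integral>\<^sup>+y. ennreal (H y) * epowr (maximal_measure lborel y) (1 / ?p) \<partial>lborel)"
        unfolding K_def using A(1) by (intro riesz_weak_type[OF n]) auto
      also have "\<dots> \<le> ennreal K * (\<integral>\<^sup>+y. ennreal (H y) * 1 \<partial>lborel)"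
      proof (intro mult_left_mono nn_integral_mono)
        show "epowr (maximal_measure lborel y) (1 / ?p) \<le> 1" for y :: "real^'n"
          using epowr_mono[OF maximal_measure_lborel_le, of "1 / ?p" y] p by simp
      qed auto
      finally have le: "ennreal (1 / (2 * A)) * ?\<mu> t
          \<le> ennreal K * (\<integral>\<^sup>+y. ennreal (H y) \<partial>lborel)" by simp
      have "?\<mu> t
          = ennreal (2 * A) * (ennreal (1 / (2 * A)) * ?\<mu> t)"
        using A(1) by (simp add: mult.assoc[symmetric] ennreal_mult[symmetric])
      also have "\<dots> \<le> ennreal (2 * A) * (ennreal K * (\<integral>\<^sup>+y. ennreal (H y) \<partial>lborel))"
        by (rule mult_left_mono[OF le]) simp
      also have "\<dots> = (\<integral>\<^sup>+y. ennreal (2 * A * K) * ennreal (H y) \<partial>lborel)"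
        using A(1) K by (simp add: nn_integral_cmult ennreal_mult mult.assoc)
      also have "\<dots> \<le> (\<integral>\<^sup>+x. ennreal C * ?\<kappa> t x \<partial>lborel)"
      proof (rule nn_integral_mono)
        fix x
        have "ennreal (2 * A * K) * ennreal (H x) = ennreal (2 * A * K * H x)"
          using A(1) K by (simp add: ennreal_mult')
        also have "\<dots> \<le> ennreal (2 * A * K * (if t / 2 < norm (f x) \<and> norm (f x) < t then 6 / t * G x else 0))"
          using H(2)[of x] A(1) K by (intro ennreal_leI mult_left_mono) auto
        also have "\<dots> = ennreal C * ?\<kappa> t x"
          using A(1) K t grad_bound_nonneg[OF f, of x] by (simp add: C_def ennreal_mult[symmetric])
        finally show "ennreal (2 * A * K) * ennreal (H x)
            \<le> ennreal C * ?\<kappa> t x" .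
      qed
      finally show ?thesis .
    qed
    have "(\<integral>\<^sup>+t\<in>{0<..}. ?\<mu> t \<partial>lborel)
        \<le> (\<integral>\<^sup>+t. (\<integral>\<^sup>+x. ?k t x \<partial>lborel) \<partial>lborel)"
    proof (rule nn_integral_mono)
      fix t :: real
      show "?\<mu> t * indicator {0<..} t
        \<le> (\<integral>\<^sup>+x. ?k t x \<partial>lborel)"
        using level[of t] by (cases "0 < t") auto
    qed
    also have "\<dots> = (\<integral>\<^sup>+x. (\<integral>\<^sup>+t. ?k t x \<partial>lborel) \<partial>lborel)"
      by (rule lborel_pair.Fubini') measurable
    also have "\<dots> \<le> (\<integral>\<^sup>+x. ennreal C * ennreal (G x) \<partial>lborel)"
    proof (rule nn_integral_mono)
      fix x
      let ?a = "norm (f x)"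
      have "(\<integral>\<^sup>+t. ennreal C * (if 0 < t \<and> t / 2 < ?a \<and> ?a < t then ennreal (G x) * ennreal (1 / t) else 0) \<partial>lborel)
          \<le> (\<integral>\<^sup>+t. ennreal C * ennreal (G x) * ennreal (1 / ?a) * indicator {?a..2 * ?a} t \<partial>lborel)"
      proof (rule nn_integral_mono)
        fix t :: real
        show "ennreal C * (if 0 < t \<and> t / 2 < ?a \<and> ?a < t then ennreal (G x) * ennreal (1 / t) else 0)
            \<le> ennreal C * ennreal (G x) * ennreal (1 / ?a) * indicator {?a..2 * ?a} t"
        proof (cases "0 < t \<and> t / 2 < ?a \<and> ?a < t")
          case True
          then have "ennreal (1 / t) \<le> ennreal (1 / ?a)"
            by (intro ennreal_leI divide_left_mono mult_pos_pos) auto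
          then have "ennreal C * (ennreal (G x) * ennreal (1 / t)) \<le> ennreal C * (ennreal (G x) * ennreal (1 / ?a))"
            by (intro mult_left_mono) auto
          then show ?thesis using True by (simp add: mult.assoc)
        next
          case False
          then show ?thesis by (simp only: if_False mult_zero_right zero_le)
        qed
      qed
      also have "\<dots> = ennreal C * ennreal (G x) * (ennreal (1 / ?a) * ennreal ?a)"
        by (subst nn_integral_cmult_indicator) (simp_all add: mult.assoc)
      also have "\<dots> \<le> ennreal C * ennreal (G x) * 1"
        by (intro mult_left_mono) (auto simp: ennreal_mult[symmetric])
      finally show "(\<integral>\<^sup>+t. ennreal C * (if 0 < t \<and> t / 2 < ?a \<and> ?a < t then ennreal (G x) * ennreal (1 / t) else 0) \<partial>lborel)
          \<le> ennreal C * ennreal (G x)" by simp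
    qed
    also have "\<dots> = ennreal C * (\<integral>\<^sup>+x. ennreal (G x) \<partial>lborel)"
      by (rule nn_integral_cmult) measurable
    finally show "(\<integral>\<^sup>+t\<in>{0<..}. ?\<mu> t \<partial>lborel)
        \<le> ennreal C * (\<integral>\<^sup>+x. ennreal (G x) \<partial>lborel)" .
  qed
qed

text \<open>
  The right-hand side of the Sobolev inequality on a ball of radius \<open>R\<close>. The doubled
  radius leaves room for a cutoff function, whose gradient causes the second term.
\<close>

definition local_energy :: "('a::euclidean_space \<Rightarrow> 'b::real_normed_vector) \<Rightarrow> ('a \<Rightarrow> real) \<Rightarrow> 'a \<Rightarrow> real \<Rightarrow> ennreal" where
  "local_energy f G x R = (\<integral>\<^sup>+y\<in>ball x (2 * R). ennreal (G y) \<partial>lborel)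
     + ennreal (1 / R) * (\<integral>\<^sup>+y\<in>ball x (2 * R). ennreal (norm (f y)) \<partial>lborel)"

lemma lorentz_sobolev_local:
  assumes n: "2 \<le> CARD('n)"
  obtains C where "0 < C" "\<And>(f :: real^'n \<Rightarrow> 'b::real_inner) G x R. grad_bound f G \<Longrightarrow> 0 < R \<Longrightarrow>
    (\<integral>\<^sup>+t\<in>{0<..}. epowr (emeasure lborel {y \<in> ball x R. t < norm (f y)}) (1 / dual_exponent CARD('n)) \<partial>lborel)
      \<le> ennreal C * local_energy f G x R"
proof -
  let ?p = "dual_exponent CARD('n)"
  obtain A where A: "0 < A" "\<And>(f :: real^'n \<Rightarrow> 'b) G. grad_bound f G \<Longrightarrow> bounded {x. f x \<noteq> 0} \<Longrightarrow>
    (\<integral>\<^sup>+t\<in>{0<..}. epowr (emeasure lborel {x. t < norm (f x)}) (1 / ?p) \<partial>lborel)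
      \<le> ennreal A * (\<integral>\<^sup>+x. ennreal (G x) \<partial>lborel)"
    using lorentz_sobolev[OF n, where 'b='b] by blast
  show thesis
  proof
    show "0 < A * 3" using A by simp
    fix f :: "real^'n \<Rightarrow> 'b" and G and x :: "real^'n" and R :: real
    assume f: "grad_bound f G" and R: "0 < R"
    have [measurable]: "G \<in> borel_measurable borel" by (rule grad_bound_measurable[OF f])
    have [measurable]: "(\<lambda>x. norm (f x)) \<in> borel_measurable borel"
      by (intro borel_measurable_continuous_onI continuous_intros grad_bound_continuous_fun[OF f])
    have "grad_bound (\<lambda>y. y) (\<lambda>y::real^'n. 1)"
      unfolding grad_bound_def by (auto intro!: exI[of _ "\<lambda>v. v"])
    then have "grad_bound (\<lambda>y. x - y) (\<lambda>y::real^'n. 1)" by (rule grad_bound_const_minus)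
    from grad_bound_level_cut[OF this R]
    obtain H where H: "grad_bound (\<lambda>y. level_cut R (norm (x - y))) H"
      "\<And>y. H y \<le> (if R < norm (x - y) \<and> norm (x - y) < 2 * R then 3 / R * 1 else 0)"
      by blast
    define \<psi> where "\<psi> = (\<lambda>y. 1 - level_cut R (norm (x - y)))"
    have \<psi>: "grad_bound \<psi> H" unfolding \<psi>_def by (rule grad_bound_const_minus[OF H(1)])
    have \<psi>_in: "\<psi> y = 1" if "y \<in> ball x R" for y
      using that R by (simp add: \<psi>_def level_cut_eq_0 dist_norm)
    have \<psi>_out: "\<psi> y = 0" if "y \<notin> ball x (2 * R)" for y
      using that R by (simp add: \<psi>_def level_cut_eq_1 dist_norm)
    have \<psi>_le: "\<bar>\<psi> y\<bar> \<le> 1" for y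
      using level_cut_bounds[of R "norm (x - y)"] by (simp add: \<psi>_def)
    \<comment> \<open>\<open>\<psi>\<close> is a cutoff function for the ball of radius \<open>R\<close>, so the Sobolev inequality applies to the product with \<open>f\<close>.\<close>
    have "bounded {y. \<psi> y *\<^sub>R f y \<noteq> 0}"
      using \<psi>_out by (intro bounded_subset[OF bounded_ball[of x "2 * R"]]) force
    note sob = A(2)[OF grad_bound_scaleR[OF \<psi> f] this]
    have "(\<integral>\<^sup>+t\<in>{0<..}. epowr (emeasure lborel {y \<in> ball x R. t < norm (f y)}) (1 / ?p) \<partial>lborel)
        \<le> (\<integral>\<^sup>+t\<in>{0<..}. epowr (emeasure lborel {y. t < norm (\<psi> y *\<^sub>R f y)}) (1 / ?p) \<partial>lborel)"
    proof (intro nn_integral_mono mult_right_mono epowr_mono emeasure_mono)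
      fix t :: real
      show "{y \<in> ball x R. t < norm (f y)} \<subseteq> {y. t < norm (\<psi> y *\<^sub>R f y)}"
        using \<psi>_in by auto
      have [measurable]: "(\<lambda>y. norm (\<psi> y *\<^sub>R f y)) \<in> borel_measurable borel"
        by (intro borel_measurable_continuous_onI continuous_intros grad_bound_continuous_fun[OF f]
            grad_bound_continuous_fun[OF \<psi>])
      show "{y. t < norm (\<psi> y *\<^sub>R f y)} \<in> sets lborel" by measurable
    qed (use dual_exponent_simps[OF n] in auto)
    also have "\<dots> \<le> ennreal A * (\<integral>\<^sup>+y. ennreal (\<bar>\<psi> y\<bar> * G y + H y * norm (f y)) \<partial>lborel)"
      by (rule sob)
    also have "\<dots> \<le> ennreal A * (\<integral>\<^sup>+y. ennreal 3 * (ennreal (G y) * indicator (ball x (2 * R)) y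
        + ennreal (1 / R) * (ennreal (norm (f y)) * indicator (ball x (2 * R)) y)) \<partial>lborel)"
    proof (intro mult_left_mono nn_integral_mono)
      fix y
      show "ennreal (\<bar>\<psi> y\<bar> * G y + H y * norm (f y)) \<le> ennreal 3 * (ennreal (G y) * indicator (ball x (2 * R)) y
        + ennreal (1 / R) * (ennreal (norm (f y)) * indicator (ball x (2 * R)) y))"
      proof (cases "y \<in> ball x (2 * R)")
        case True
        have G: "0 \<le> G y" by (rule grad_bound_nonneg[OF f])
        have "H y \<le> 3 / R" using H(2)[of y] R by (auto split: if_splits intro: order_trans)
        then have "H y * norm (f y) \<le> 3 / R * norm (f y)" by (rule mult_right_mono) simp
        moreover have "\<bar>\<psi> y\<bar> * G y \<le> 3 * G y" using \<psi>_le[of y] G by (intro mult_right_mono) auto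
        ultimately have "\<bar>\<psi> y\<bar> * G y + H y * norm (f y) \<le> 3 * (G y + 1 / R * norm (f y))"
          by (simp add: algebra_simps)
        then have "ennreal (\<bar>\<psi> y\<bar> * G y + H y * norm (f y)) \<le> ennreal (3 * (G y + 1 / R * norm (f y)))"
          by (rule ennreal_leI)
        also have "\<dots> = ennreal 3 * ennreal (G y + 1 / R * norm (f y))"
          by (rule ennreal_mult') simp
        also have "ennreal (G y + 1 / R * norm (f y)) = ennreal (G y) + ennreal (1 / R * norm (f y))"
          using G R by (intro ennreal_plus) auto
        also have "ennreal (1 / R * norm (f y)) = ennreal (1 / R) * ennreal (norm (f y))"
          using R by (intro ennreal_mult') simp
        finally show ?thesis using True by simp
      next
        case False
        then have "H y \<le> 0" using H(2)[of y] by (auto simp: dist_norm split: if_splits)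
        then have "\<bar>\<psi> y\<bar> * G y + H y * norm (f y) \<le> 0"
          using \<psi>_out[OF False] by (simp add: mult_nonpos_nonneg)
        then show ?thesis by (simp add: ennreal_neg)
      qed
    qed auto
    also have "\<dots> = ennreal (A * 3) * local_energy f G x R"
      using A(1) by (simp add: local_energy_def nn_integral_cmult nn_integral_add ennreal_mult mult.assoc)
    finally show "(\<integral>\<^sup>+t\<in>{0<..}. epowr (emeasure lborel {y \<in> ball x R. t < norm (f y)}) (1 / ?p) \<partial>lborel)
        \<le> ennreal (A * 3) * local_energy f G x R" .
  qed
qed

section \<open>Poincare's inequality\<close>

text \<open>
  The contraction towards \<open>z\<close> with ratio \<open>s\<close> maps the ball into itself, by
  convexity, and has Jacobian at least \<open>1 / 2 ^ n\<close>.
\<close>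

lemma nn_integral_contracted_ball_le:
  fixes x z :: "'a::euclidean_space"
  assumes [measurable]: "g \<in> borel_measurable borel" and z: "z \<in> ball x R" and s: "1 / 2 \<le> s" "s \<le> 1"
  shows "(\<integral>\<^sup>+y\<in>ball x R. g (z + s *\<^sub>R (y - z)) \<partial>lborel)
       \<le> ennreal (2 ^ DIM('a)) * (\<integral>\<^sup>+y\<in>ball x R. g y \<partial>lborel)"
proof -
  have "(\<integral>\<^sup>+y\<in>ball x R. g (z + s *\<^sub>R (y - z)) \<partial>lborel)
      \<le> (\<integral>\<^sup>+y. g ((1 - s) *\<^sub>R z + s *\<^sub>R y) * indicator (ball x R) ((1 - s) *\<^sub>R z + s *\<^sub>R y) \<partial>lborel)"
  proof (rule nn_integral_mono)
    fix y
    have eq: "z + s *\<^sub>R (y - z) = (1 - s) *\<^sub>R z + s *\<^sub>R y" by (simp add: algebra_simps)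
    show "g (z + s *\<^sub>R (y - z)) * indicator (ball x R) y
        \<le> g ((1 - s) *\<^sub>R z + s *\<^sub>R y) * indicator (ball x R) ((1 - s) *\<^sub>R z + s *\<^sub>R y)"
    proof (cases "y \<in> ball x R")
      case True
      then have "(1 - s) *\<^sub>R z + s *\<^sub>R y \<in> ball x R"
        using convexD[OF convex_ball z, of y "1 - s" s] s by simp
      then show ?thesis by (simp add: eq indicator_def)
    qed simp
  qed
  also have "\<dots> = ennreal (1 / s ^ DIM('a)) * (\<integral>\<^sup>+y\<in>ball x R. g y \<partial>lborel)"
    using s by (subst nn_integral_lborel_affine[of "\<lambda>y. g y * indicator (ball x R) y" s "(1 - s) *\<^sub>R z"]) auto
  also have "\<dots> \<le> ennreal (2 ^ DIM('a)) * (\<integral>\<^sup>+y\<in>ball x R. g y \<partial>lborel)"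
  proof (intro mult_right_mono ennreal_leI)
    have "(1 / s) ^ DIM('a) \<le> 2 ^ DIM('a)" using s by (intro power_mono) (auto simp: field_simps)
    then show "1 / s ^ DIM('a) \<le> 2 ^ DIM('a)" by (simp add: power_divide)
  qed simp
  finally show ?thesis .
qed

text \<open>
  On the segment from \<open>z\<close> to \<open>y\<close>, the point with parameter \<open>s \<ge>
  1 / 2\<close> arises from \<open>y\<close> by a contraction towards \<open>z\<close>, and for
  \<open>s \<le> 1 / 2\<close> from \<open>z\<close> by a contraction towards \<open>y\<close>; the
  variable that moves is integrated first.
\<close>

lemma poincare_double_integral:
  fixes f :: "'a::euclidean_space \<Rightarrow> 'b::real_normed_vector"
  assumes f: "grad_bound f G" and R: "0 < R"
  shows "(\<integral>\<^sup>+z\<in>ball x R. (\<integral>\<^sup>+y\<in>ball x R. ennreal (norm (f y - f z)) \<partial>lborel) \<partial>lborel)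
       \<le> ennreal (2 ^ Suc DIM('a) * R) * (\<integral>\<^sup>+y\<in>ball x R. ennreal (G y) \<partial>lborel) * emeasure lborel (ball x R)"
proof -
  let ?B = "ball x R" and ?I = "\<integral>\<^sup>+y\<in>ball x R. ennreal (G y) \<partial>lborel"
  let ?J = "\<lambda>s z. \<integral>\<^sup>+y\<in>?B. ennreal (G (z + s *\<^sub>R (y - z))) \<partial>lborel"
  let ?g = "\<lambda>s z y. ennreal (2 * R) * (ennreal (G (z + s *\<^sub>R (y - z))) * indicator ?B y * indicator ?B z * indicator {0..1} s)"
  let ?D = "\<lambda>z y. ennreal (norm (f y - f z))"
  have [measurable]: "G \<in> borel_measurable borel" by (rule grad_bound_measurable[OF f])
  have slice: "(\<integral>\<^sup>+z\<in>?B. ?J s z \<partial>lborel)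
      \<le> ennreal (2 ^ DIM('a)) * ?I * emeasure lborel ?B" if s: "1 / 2 \<le> s" "s \<le> 1" for s
  proof -
    have "(\<integral>\<^sup>+z\<in>?B. ?J s z \<partial>lborel)
        \<le> (\<integral>\<^sup>+z. ennreal (2 ^ DIM('a)) * ?I * indicator ?B z \<partial>lborel)"
    proof (rule nn_integral_mono)
      fix z
      show "?J s z * indicator ?B z
          \<le> ennreal (2 ^ DIM('a)) * ?I * indicator ?B z"
        using nn_integral_contracted_ball_le[of "\<lambda>y. ennreal (G y)" z x R s] s
        by (cases "z \<in> ?B") auto
    qed
    then show ?thesis by (simp add: nn_integral_cmult_indicator)
  qed
  have slice': "(\<integral>\<^sup>+z\<in>?B. ?J s z \<partial>lborel)
      \<le> ennreal (2 ^ DIM('a)) * ?I * emeasure lborel ?B" if s: "0 \<le> s" "s \<le> 1" for s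
  proof (cases "1 / 2 \<le> s")
    case False
    have "(\<integral>\<^sup>+z\<in>?B. ?J s z \<partial>lborel)
        = (\<integral>\<^sup>+z. (\<integral>\<^sup>+y. ennreal (G (z + s *\<^sub>R (y - z))) * indicator ?B y * indicator ?B z \<partial>lborel) \<partial>lborel)"
      by (intro nn_integral_cong nn_integral_multc[symmetric]) measurable
    also have "\<dots> = (\<integral>\<^sup>+y. (\<integral>\<^sup>+z. ennreal (G (z + s *\<^sub>R (y - z))) * indicator ?B y * indicator ?B z \<partial>lborel) \<partial>lborel)"
      by (rule lborel_pair.Fubini'[symmetric]) measurable
    also have "\<dots> = (\<integral>\<^sup>+y. (\<integral>\<^sup>+z. ennreal (G (y + (1 - s) *\<^sub>R (z - y))) * indicator ?B z * indicator ?B y \<partial>lborel) \<partial>lborel)"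
    proof (intro nn_integral_cong)
      fix y z :: 'a
      have "z + s *\<^sub>R (y - z) = y + (1 - s) *\<^sub>R (z - y)" by (simp add: algebra_simps)
      then show "ennreal (G (z + s *\<^sub>R (y - z))) * indicator ?B y * indicator ?B z
          = ennreal (G (y + (1 - s) *\<^sub>R (z - y))) * indicator ?B z * indicator ?B y"
        by (simp add: mult_ac)
    qed
    also have "\<dots> = (\<integral>\<^sup>+y\<in>?B. (\<integral>\<^sup>+z\<in>?B. ennreal (G (y + (1 - s) *\<^sub>R (z - y))) \<partial>lborel) \<partial>lborel)"
      by (intro nn_integral_cong nn_integral_multc) measurable
    also have "\<dots> \<le> ennreal (2 ^ DIM('a)) * ?I * emeasure lborel ?B"
      using False s by (intro slice) auto
    finally show ?thesis .
  qed (use slice s in blast)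
  have "(\<integral>\<^sup>+z\<in>?B. (\<integral>\<^sup>+y\<in>?B. ?D z y \<partial>lborel) \<partial>lborel)
      \<le> (\<integral>\<^sup>+z. (\<integral>\<^sup>+y. (\<integral>\<^sup>+s. ?g s z y \<partial>lborel) \<partial>lborel) \<partial>lborel)"
  proof -
    have "?D z y * indicator ?B y * indicator ?B z
        \<le> (\<integral>\<^sup>+s. ?g s z y \<partial>lborel)" for y z
    proof (cases "y \<in> ?B \<and> z \<in> ?B")
      case True
      then have "norm (y - z) \<le> 2 * R"
        using dist_triangle2[of y z x] by (simp add: dist_norm norm_minus_commute)
      then have "ennreal (norm (y - z)) \<le> ennreal (2 * R)" by (rule ennreal_leI)
      then have "ennreal (norm (y - z)) * (\<integral>\<^sup>+s\<in>{0..1}. ennreal (G (z + s *\<^sub>R (y - z))) \<partial>lborel)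
          \<le> ennreal (2 * R) * (\<integral>\<^sup>+s\<in>{0..1}. ennreal (G (z + s *\<^sub>R (y - z))) \<partial>lborel)"
        by (rule mult_right_mono) simp
      then have "?D z y \<le> ennreal (2 * R) * (\<integral>\<^sup>+s\<in>{0..1}. ennreal (G (z + s *\<^sub>R (y - z))) \<partial>lborel)"
        using grad_bound_segment[OF f, of 0 1 z "y - z"] by simp
      also have "\<dots> = (\<integral>\<^sup>+s. ennreal (2 * R) * (ennreal (G (z + s *\<^sub>R (y - z))) * indicator {0..1} s) \<partial>lborel)"
        by (rule nn_integral_cmult[symmetric]) measurable
      finally show ?thesis using True by simp
    qed auto
    note pointwise = this
    show ?thesis
    proof (rule nn_integral_mono)
      fix z
      have "(\<integral>\<^sup>+y\<in>?B. ?D z y \<partial>lborel) * indicator ?B z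
          = (\<integral>\<^sup>+y. ?D z y * indicator ?B y * indicator ?B z \<partial>lborel)"
        by (cases "z \<in> ?B") auto
      also have "\<dots> \<le> (\<integral>\<^sup>+y. (\<integral>\<^sup>+s. ?g s z y \<partial>lborel) \<partial>lborel)"
        by (intro nn_integral_mono pointwise)
      finally show "(\<integral>\<^sup>+y\<in>?B. ?D z y \<partial>lborel) * indicator ?B z \<le> \<dots>" .
    qed
  qed
  also have "\<dots> = (\<integral>\<^sup>+s. (\<integral>\<^sup>+z. (\<integral>\<^sup>+y. ?g s z y \<partial>lborel) \<partial>lborel) \<partial>lborel)"
  proof -
    have "(\<integral>\<^sup>+z. (\<integral>\<^sup>+y. (\<integral>\<^sup>+s. ?g s z y \<partial>lborel) \<partial>lborel) \<partial>lborel)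
        = (\<integral>\<^sup>+z. (\<integral>\<^sup>+s. (\<integral>\<^sup>+y. ?g s z y \<partial>lborel) \<partial>lborel) \<partial>lborel)"
      by (rule nn_integral_cong, rule lborel_pair.Fubini') measurable
    also have "\<dots> = (\<integral>\<^sup>+s. (\<integral>\<^sup>+z. (\<integral>\<^sup>+y. ?g s z y \<partial>lborel) \<partial>lborel) \<partial>lborel)"
      by (rule lborel_pair.Fubini') measurable
    finally show ?thesis .
  qed
  also have "\<dots> = (\<integral>\<^sup>+s. ennreal (2 * R) * (\<integral>\<^sup>+z\<in>?B. ?J s z \<partial>lborel)
      * indicator {0..1} s \<partial>lborel)"
  proof (rule nn_integral_cong)
    fix s :: real
    have "(\<integral>\<^sup>+z. (\<integral>\<^sup>+y. ?g s z y \<partial>lborel) \<partial>lborel)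
        = (\<integral>\<^sup>+z. ennreal (2 * R) * (?J s z * indicator ?B z * indicator {0..1} s) \<partial>lborel)"
      by (rule nn_integral_cong) (simp add: nn_integral_cmult nn_integral_multc)
    also have "\<dots> = ennreal (2 * R) * (\<integral>\<^sup>+z\<in>?B. ?J s z \<partial>lborel)
      * indicator {0..1} s"
      by (subst nn_integral_cmult, measurable, subst nn_integral_multc) (measurable, simp add: mult.assoc)
    finally show "(\<integral>\<^sup>+z. (\<integral>\<^sup>+y. ?g s z y \<partial>lborel) \<partial>lborel) = \<dots>" .
  qed
  also have "\<dots> \<le> (\<integral>\<^sup>+s. ennreal (2 * R) * (ennreal (2 ^ DIM('a)) * ?I * emeasure lborel ?B) * indicator {0..1::real} s \<partial>lborel)"
  proof (rule nn_integral_mono)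
    fix s :: real
    show "ennreal (2 * R) * (\<integral>\<^sup>+z\<in>?B. ?J s z \<partial>lborel) * indicator {0..1} s
        \<le> ennreal (2 * R) * (ennreal (2 ^ DIM('a)) * ?I * emeasure lborel ?B) * indicator {0..1} s"
    proof (cases "s \<in> {0..1}")
      case True
      then show ?thesis by (intro mult_right_mono mult_left_mono slice') auto
    qed simp
  qed
  also have "\<dots> = ennreal (2 ^ Suc DIM('a) * R) * ?I * emeasure lborel ?B"
    using R by (subst nn_integral_cmult_indicator) (simp_all add: ennreal_mult mult_ac)
  finally show ?thesis .
qed

section \<open>Rough kernels\<close>

text \<open>
  The equation \<open>W (sgn y) = W y\<close> expresses homogeneity of degree zero; \<open>A\<close>
  bounds the \<open>n\<close>-th power of the weak \<open>L\<^sup>n\<close> norm on the sphere. In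
  contrast to a general kernel, which is measurable only up to null sets of the sphere,
  \<open>W\<close> is Borel measurable, so that Tonelli and Fubini apply to products with it.
\<close>

definition rough_kernel :: "(real^'n \<Rightarrow> complex) \<Rightarrow> real \<Rightarrow> bool" where
  "rough_kernel W A \<longleftrightarrow> W \<in> borel_measurable borel \<and> (\<forall>y. W (sgn y) = W y) \<and> 0 \<le> A \<and>
     (\<forall>s>0. emeasure sphere_measure {\<theta> \<in> sphere 0 1. s < norm (W \<theta>)} \<le> ennreal (A * s powr - real CARD('n)))"

text \<open>
  By polar coordinates, the cone over a null set of the sphere is a null set.
\<close>

lemma AE_lborel_of_AE_sphere_measure:
  fixes P :: "real^'n \<Rightarrow> bool"
  assumes "AE \<theta> in sphere_measure. P \<theta>"
  shows "AE y in lborel. y \<noteq> 0 \<longrightarrow> P (sgn y)"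
proof -
  obtain N where N: "{\<theta> \<in> space sphere_measure. \<not> P \<theta>} \<subseteq> N" "N \<in> null_sets sphere_measure"
    using assms unfolding eventually_ae_filter by blast
  then have "N \<in> sets (restrict_space borel (sphere (0::real^'n) 1))"
    by (auto simp: null_sets_def sets_sphere_measure)
  then have NB: "N \<in> sets borel"
    by (auto simp: sets_restrict_space)
  have sgn [measurable]: "(sgn :: real^'n \<Rightarrow> real^'n) \<in> borel_measurable borel"
    unfolding sgn_div_norm[abs_def] by measurable
  define F where "F = (\<lambda>y::real^'n. indicator N (sgn y) :: ennreal)"
  have F: "F \<in> borel_measurable borel"
    unfolding F_def using NB by measurable
  have "(\<integral>\<^sup>+y. F y \<partial>lborel) = (\<integral>\<^sup>+\<theta>. (\<integral>\<^sup>+r\<in>{0<..}. F (r *\<^sub>R \<theta>) * ennreal (r ^ (CARD('n) - 1)) \<partial>lborel) \<partial>sphere_measure)"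
    by (rule polar_coordinates[OF F])
  also have "\<dots> = (\<integral>\<^sup>+\<theta>. 0 \<partial>(sphere_measure :: (real^'n) measure))"
  proof (rule nn_integral_cong_AE)
    show "AE \<theta> in sphere_measure. (\<integral>\<^sup>+r\<in>{0<..}. F (r *\<^sub>R \<theta>) * ennreal (r ^ (CARD('n) - 1)) \<partial>lborel) = 0"
      using AE_not_in[OF N(2)] AE_space
    proof eventually_elim
      case (elim \<theta>)
      have "F (r *\<^sub>R \<theta>) * ennreal (r ^ (CARD('n) - 1)) * indicator {0<..} r = 0" for r
        using elim by (cases "0 < r") (auto simp: F_def sgn_div_norm)
      then show ?case by (simp only: nn_integral_const mult_zero_left)
    qed
  qed
  finally have "(\<integral>\<^sup>+y. F y \<partial>lborel) = 0" by simp
  then have "AE y in lborel. F y = 0"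
    using nn_integral_0_iff_AE[of F lborel] F by simp
  then show ?thesis
  proof eventually_elim
    case (elim y)
    then have "sgn y \<notin> N" by (auto simp: F_def indicator_def split: if_splits)
    moreover have "y \<noteq> 0 \<Longrightarrow> sgn y \<in> space (sphere_measure :: (real^'n) measure)" by (simp add: norm_sgn)
    ultimately show ?case using N(1) by blast
  qed
qed

lemma finite_sphere_measure: "finite_measure (sphere_measure :: (real^'n) measure)"
  using emeasure_sphere_measure_finite[where 'n='n] by (intro finite_measureI) (auto simp: less_top)

lemma weak_sphere_kernel_borel_version:
  fixes \<Omega> :: "real^'n \<Rightarrow> complex"
  assumes \<Omega>: "weak_sphere_kernel \<Omega>"
  obtains W A where "rough_kernel W A" "AE y in lborel. \<Omega> y = W y"
    "mean_zero \<Omega> \<Longrightarrow> (LINT \<theta>|sphere_measure. W \<theta>) = 0"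
proof -
  let ?\<sigma> = "sphere_measure :: (real^'n) measure" and ?n = "real CARD('n)"
  have hom: "homogeneous0 \<Omega>" and meas: "\<Omega> \<in> borel_measurable (completion ?\<sigma>)"
    and weak: "weak_norm ?n (completion ?\<sigma>) (enorm \<Omega>) < \<infinity>"
    using \<Omega> by (auto simp: weak_sphere_kernel_def)
  have "(\<lambda>\<theta>. Re (\<Omega> \<theta>)) \<in> borel_measurable (completion ?\<sigma>)" "(\<lambda>\<theta>. Im (\<Omega> \<theta>)) \<in> borel_measurable (completion ?\<sigma>)"
    using meas by measurable
  from this[THEN completion_ex_borel_measurable_real]
  obtain a b where ab: "a \<in> borel_measurable ?\<sigma>" "b \<in> borel_measurable ?\<sigma>"
    and eq: "AE \<theta> in ?\<sigma>. Re (\<Omega> \<theta>) = a \<theta>" "AE \<theta> in ?\<sigma>. Im (\<Omega> \<theta>) = b \<theta>"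
    by blast
  define S where "S = sphere (0::real^'n) 1"
  have S: "S \<inter> space borel \<in> sets borel" by (simp add: S_def)
  have restr: "f \<in> borel_measurable ?\<sigma> \<Longrightarrow> (\<lambda>\<theta>. indicator S \<theta> *\<^sub>R f \<theta>) \<in> borel_measurable borel" for f :: "real^'n \<Rightarrow> real"
    using borel_measurable_restrict_space_iff[OF S] measurable_cong_sets[OF sets_sphere_measure refl]
    unfolding S_def by blast
  have sgn [measurable]: "(sgn :: real^'n \<Rightarrow> real^'n) \<in> borel_measurable borel"
    unfolding sgn_div_norm[abs_def] by measurable
  define W where "W = (\<lambda>y. Complex (indicator S (sgn y) *\<^sub>R a (sgn y)) (indicator S (sgn y) *\<^sub>R b (sgn y)))"
  have W_meas [measurable]: "W \<in> borel_measurable borel"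
  proof -
    have "(\<lambda>y. indicator S (sgn y) *\<^sub>R a (sgn y)) \<in> borel_measurable borel"
      "(\<lambda>y. indicator S (sgn y) *\<^sub>R b (sgn y)) \<in> borel_measurable borel"
      by (rule measurable_compose[OF sgn restr[OF ab(1)]], rule measurable_compose[OF sgn restr[OF ab(2)]])
    then show ?thesis by (simp add: borel_measurable_complex_iff W_def)
  qed
  have W_sgn: "W (sgn y) = W y" for y
    by (cases "y = 0") (simp_all add: W_def sgn_div_norm)
  have W_eq: "AE \<theta> in ?\<sigma>. \<Omega> \<theta> = W \<theta>"
    using eq AE_space
  proof eventually_elim
    case (elim \<theta>)
    then have "sgn \<theta> = \<theta>" "\<theta> \<in> S" by (auto simp: S_def sgn_div_norm)
    then show ?case using elim by (simp add: W_def complex_eq_iff)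
  qed
  have "weak_norm ?n (completion ?\<sigma>) (enorm \<Omega>) \<noteq> \<infinity>" using weak by simp
  then obtain K where K: "weak_norm ?n (completion ?\<sigma>) (enorm \<Omega>) = ennreal K" "0 \<le> K"
    by (cases "weak_norm ?n (completion ?\<sigma>) (enorm \<Omega>)") auto
  have level: "emeasure ?\<sigma> {\<theta> \<in> sphere 0 1. s < norm (W \<theta>)} \<le> ennreal (K powr ?n * s powr - ?n)" if s: "0 < s" for s
  proof -
    let ?E = "{\<theta> \<in> space (completion ?\<sigma>). ennreal s < enorm \<Omega> \<theta>}"
    have [measurable]: "W \<in> borel_measurable ?\<sigma>" by (rule measurable_sphere_measure[OF W_meas])
    have EW: "{\<theta> \<in> sphere 0 1. s < norm (W \<theta>)} = {\<theta> \<in> space ?\<sigma>. s < norm (W \<theta>)}" by simp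
    have EWm: "{\<theta> \<in> sphere 0 1. s < norm (W \<theta>)} \<in> sets ?\<sigma>" unfolding EW by measurable
    have "emeasure ?\<sigma> {\<theta> \<in> sphere 0 1. s < norm (W \<theta>)} = emeasure (completion ?\<sigma>) {\<theta> \<in> sphere 0 1. s < norm (W \<theta>)}"
      using EWm by (simp add: emeasure_completion)
    also have "\<dots> = emeasure (completion ?\<sigma>) ?E"
    proof (rule emeasure_eq_AE)
      show "AE \<theta> in completion ?\<sigma>. (\<theta> \<in> {\<theta> \<in> sphere 0 1. s < norm (W \<theta>)}) = (\<theta> \<in> ?E)"
        using AE_completion[OF W_eq] by eventually_elim (use s in \<open>auto simp: enorm_def ennreal_less_iff\<close>)
      show "{\<theta> \<in> sphere 0 1. s < norm (W \<theta>)} \<in> sets (completion ?\<sigma>)" using EWm by auto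
      have "enorm \<Omega> \<in> borel_measurable (completion ?\<sigma>)" unfolding enorm_def[abs_def] using meas by measurable
      then show "?E \<in> sets (completion ?\<sigma>)" by measurable
    qed
    also have "\<dots> \<le> epowr (ennreal (K / s)) ?n"
    proof -
      have "ennreal s * epowr (emeasure (completion ?\<sigma>) ?E) (1 / ?n) \<le> ennreal K"
        unfolding K(1)[symmetric] weak_norm_def using s by (intro SUP_upper2[of s]) auto
      then have "ennreal (1 / s) * (ennreal s * epowr (emeasure (completion ?\<sigma>) ?E) (1 / ?n)) \<le> ennreal (1 / s) * ennreal K"
        by (rule mult_left_mono) simp
      then have "epowr (emeasure (completion ?\<sigma>) ?E) (1 / ?n) \<le> ennreal (K / s)"
        using s K(2) by (simp add: mult.assoc[symmetric] ennreal_mult[symmetric])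
      then show ?thesis using epowr_le_imp_le[of _ "1 / ?n"] by fastforce
    qed
    also have "\<dots> = ennreal (K powr ?n * s powr - ?n)"
      using s K(2) by (simp add: epowr_ennreal powr_divide powr_minus_divide)
    finally show ?thesis .
  qed
  show thesis
  proof
    show "rough_kernel W (K powr ?n)"
      unfolding rough_kernel_def using W_meas W_sgn level by simp
    show "AE y in lborel. \<Omega> y = W y"
      using AE_lborel_of_AE_sphere_measure[OF W_eq] AE_lborel_singleton[of 0]
    proof eventually_elim
      case (elim y)
      then have "\<Omega> (sgn y) = W (sgn y)" "y \<noteq> 0" by auto
      moreover have "\<Omega> (inverse (norm y) *\<^sub>R y) = \<Omega> y"
        using hom \<open>y \<noteq> 0\<close> unfolding homogeneous0_def by simp
      ultimately show ?case using W_sgn[of y] by (simp add: sgn_div_norm)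
    qed
    assume mz: "mean_zero \<Omega>"
    have Wm: "W \<in> borel_measurable ?\<sigma>" by (rule measurable_sphere_measure[OF W_meas])
    have "(LINT \<theta>|?\<sigma>. W \<theta>) = (LINT \<theta>|completion ?\<sigma>. W \<theta>)"
      using Wm by (rule integral_completion[symmetric])
    also have "\<dots> = (LINT \<theta>|completion ?\<sigma>. \<Omega> \<theta>)"
    proof (rule integral_cong_AE)
      show "AE \<theta> in completion ?\<sigma>. W \<theta> = \<Omega> \<theta>"
        using AE_completion[OF W_eq] by eventually_elim simp
    qed (use measurable_completion[OF Wm] meas in auto)
    also have "\<dots> = 0" using mz by (simp add: mean_zero_def)
    finally show "(LINT \<theta>|?\<sigma>. W \<theta>) = 0" .
  qed
qed

text \<open>
  By homogeneity, the ball of radius \<open>R\<close> reduces to the unit ball by scaling, and the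
  unit ball to the sphere by the definition of the surface measure.
\<close>

lemma rough_kernel_superlevel:
  fixes W :: "real^'n \<Rightarrow> complex"
  assumes W: "rough_kernel W A" and s: "0 < s" and R: "0 < R"
  shows "emeasure lborel {y \<in> ball 0 R. s < norm (W y)} \<le> ennreal (A * R ^ CARD('n) * s powr - real CARD('n))"
proof -
  have [measurable]: "W \<in> borel_measurable borel" and hom: "\<And>y. W (sgn y) = W y"
    and level: "emeasure sphere_measure {\<theta> \<in> sphere 0 1. s < norm (W \<theta>)} \<le> ennreal (A * s powr - real CARD('n))"
    using W s by (auto simp: rough_kernel_def)
  let ?F = "indicator {y \<in> ball 0 R. s < norm (W y)} :: real^'n \<Rightarrow> ennreal"
  have [measurable]: "{y \<in> ball 0 R. s < norm (W y)} \<in> sets borel" by measurable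
  have scale: "W (R *\<^sub>R y) = W y" for y
    using hom[of "R *\<^sub>R y"] hom[of y] R by (simp add: sgn_scaleR)
  have sm: "{\<theta> \<in> space sphere_measure. s < norm (W \<theta>)} \<in> sets (sphere_measure :: (real^'n) measure)"
  proof -
    have [measurable]: "W \<in> borel_measurable sphere_measure" by (rule measurable_sphere_measure) fact
    show ?thesis by measurable
  qed
  have "ennreal (1 / R ^ CARD('n)) * emeasure lborel {y \<in> ball 0 R. s < norm (W y)}
      = (\<integral>\<^sup>+y. ?F (0 + R *\<^sub>R y) \<partial>lborel)"
    using R by (subst nn_integral_lborel_affine) auto
  also have "\<dots> \<le> (\<integral>\<^sup>+y\<in>ball 0 1 - {0}. indicator {\<theta> \<in> space sphere_measure. s < norm (W \<theta>)} (sgn y) \<partial>lborel)"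
    using R by (intro nn_integral_mono_AE AE_lborel_neI[of 0])
      (auto simp: indicator_def scale hom norm_sgn)
  also have "\<dots> \<le> of_nat CARD('n) * (\<integral>\<^sup>+y\<in>ball 0 1 - {0}. indicator {\<theta> \<in> space sphere_measure. s < norm (W \<theta>)} (sgn y) \<partial>lborel)"
  proof -
    have "1 \<le> (of_nat CARD('n) :: ennreal)"
      using zero_less_card_finite[where 'a='n] by (simp add: ennreal_of_nat_eq_real_of_nat)
    from mult_right_mono[OF this] show ?thesis by force
  qed
  also have "\<dots> = (\<integral>\<^sup>+\<theta>. indicator {\<theta> \<in> space sphere_measure. s < norm (W \<theta>)} \<theta> \<partial>sphere_measure)"
    using sm by (intro nn_integral_sphere_measure[symmetric] borel_measurable_indicator)
  also have "\<dots> = emeasure sphere_measure {\<theta> \<in> sphere 0 1. s < norm (W \<theta>)}"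
    using sm by simp
  finally have "ennreal (R ^ CARD('n)) * (ennreal (1 / R ^ CARD('n)) * emeasure lborel {y \<in> ball 0 R. s < norm (W y)})
      \<le> ennreal (R ^ CARD('n)) * ennreal (A * s powr - real CARD('n))"
    using level by (intro mult_left_mono order_trans[OF _ level]) auto
  moreover have "ennreal (R ^ CARD('n)) * ennreal (1 / R ^ CARD('n)) = 1"
    using R by (simp add: ennreal_mult[symmetric])
  ultimately have "emeasure lborel {y \<in> ball 0 R. s < norm (W y)}
      \<le> ennreal (R ^ CARD('n)) * ennreal (A * s powr - real CARD('n))"
    by (simp add: mult.assoc[symmetric])
  also have "\<dots> = ennreal (R ^ CARD('n) * (A * s powr - real CARD('n)))"
    using R by (intro ennreal_mult'[symmetric]) simp
  finally show ?thesis by (simp only: mult_ac)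
qed

lemma rough_kernel_nn_integral_le:
  fixes W :: "real^'n \<Rightarrow> complex"
  assumes n: "2 \<le> CARD('n)" and W: "rough_kernel W A" and R: "0 < R"
    and E: "E \<in> sets borel" "E \<subseteq> ball 0 R"
  shows "(\<integral>\<^sup>+y\<in>E. ennreal (norm (W y)) \<partial>lborel)
       \<le> ennreal (dual_exponent CARD('n) * A powr (1 / real CARD('n)) * R)
          * epowr (emeasure lborel E) (1 / dual_exponent CARD('n))"
proof -
  let ?n = "real CARD('n)"
  note p = dual_exponent_simps[OF n]
  have [measurable]: "W \<in> borel_measurable borel" and A: "0 \<le> A"
    using W by (auto simp: rough_kernel_def)
  have "emeasure lborel E \<le> emeasure lborel (ball (0::real^'n) R)"
    using E by (intro emeasure_mono) auto
  also have "\<dots> < \<infinity>" by (rule emeasure_lborel_ball_finite)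
  finally obtain m where m: "emeasure lborel E = ennreal m" "0 \<le> m"
    by (cases "emeasure lborel E") auto
  have "(\<integral>\<^sup>+y\<in>E. ennreal (norm (W y)) \<partial>lborel)
      \<le> ennreal (?n / (?n - 1) * (A * R ^ CARD('n)) powr (1 / ?n) * m powr (1 - 1 / ?n))"
  proof (rule nn_integral_le_of_weak_type[OF sigma_finite_lborel])
    fix s :: real assume s: "0 < s"
    have "emeasure lborel {y \<in> E. ennreal s < ennreal (norm (W y))} \<le> emeasure lborel {y \<in> ball 0 R. s < norm (W y)}"
      using E s by (intro emeasure_mono) (auto simp: ennreal_less_iff)
    also have "\<dots> \<le> ennreal (A * R ^ CARD('n) * s powr - ?n)"
      by (rule rough_kernel_superlevel[OF W s R])
    finally show "emeasure lborel {y \<in> E. ennreal s < ennreal (norm (W y))} \<le> ennreal (A * R ^ CARD('n) * s powr - ?n)" .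
  qed (use n A R m E in auto)
  also have "(A * R ^ CARD('n)) powr (1 / ?n) = A powr (1 / ?n) * R"
    using A R by (simp add: powr_mult powr_realpow[symmetric] powr_powr)
  also have "ennreal (?n / (?n - 1) * (A powr (1 / ?n) * R) * m powr (1 - 1 / ?n))
      = ennreal (dual_exponent CARD('n) * A powr (1 / ?n) * R) * epowr (emeasure lborel E) (1 / dual_exponent CARD('n))"
    using A R m p by (simp add: epowr_ennreal ennreal_mult[symmetric] dual_exponent_def mult_ac)
  finally show ?thesis .
qed

lemma rough_kernel_locally_integrable:
  fixes W :: "real^'n \<Rightarrow> complex"
  assumes n: "2 \<le> CARD('n)" and W: "rough_kernel W A"
  shows "(\<integral>\<^sup>+y\<in>ball 0 R. ennreal (norm (W y)) \<partial>lborel) < \<infinity>"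
proof (cases "0 < R")
  case True
  have "(\<integral>\<^sup>+y\<in>ball 0 R. ennreal (norm (W y)) \<partial>lborel)
      \<le> ennreal (dual_exponent CARD('n) * A powr (1 / real CARD('n)) * R)
          * epowr (emeasure lborel (ball (0::real^'n) R)) (1 / dual_exponent CARD('n))"
    using rough_kernel_nn_integral_le[OF n W True, of "ball 0 R"] by simp
  also have "\<dots> < \<infinity>"
  proof -
    have "epowr (emeasure lborel (ball (0::real^'n) R)) (1 / dual_exponent CARD('n)) \<noteq> \<infinity>"
      using emeasure_lborel_ball_finite[of "0::real^'n" R] unfolding epowr_eq_top_iff by simp
    then show ?thesis by (simp add: ennreal_mult_less_top less_top)
  qed
  finally show ?thesis .
qed (simp add: ball_empty)

text \<open>
  Hoelder's inequality between weak \<open>L\<^sup>n\<close> and the Lorentz space with indices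
  \<open>n'\<close> and \<open>1\<close>, followed by the Sobolev inequality: the layer cake formula
  for \<open>\<bar>c - f\<bar>\<close> is used with the measure \<open>\<bar>W y\<bar> dy\<close>,
  and the \<open>W\<close>-mass of a superlevel set is at most a multiple of a power of its Lebesgue
  measure.
\<close>

lemma rough_kernel_local_bound:
  fixes W :: "real^'n \<Rightarrow> complex"
  assumes n: "2 \<le> CARD('n)" and W: "rough_kernel W A"
  obtains C where "0 < C" "\<And>(f :: real^'n \<Rightarrow> complex) G x R c. grad_bound f G \<Longrightarrow> 0 < R \<Longrightarrow>
    (\<integral>\<^sup>+y\<in>ball 0 R. ennreal (norm (W y) * norm (c - f (x - y))) \<partial>lborel)
      \<le> ennreal (C * R) * local_energy (\<lambda>y. c - f y) G x R"
proof -
  let ?p = "dual_exponent CARD('n)"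
  note p = dual_exponent_simps[OF n]
  have [measurable]: "W \<in> borel_measurable borel" and A: "0 \<le> A"
    using W by (auto simp: rough_kernel_def)
  obtain L where L: "0 < L" "\<And>(f :: real^'n \<Rightarrow> complex) G x R. grad_bound f G \<Longrightarrow> 0 < R \<Longrightarrow>
    (\<integral>\<^sup>+t\<in>{0<..}. epowr (emeasure lborel {y \<in> ball x R. t < norm (f y)}) (1 / ?p) \<partial>lborel)
      \<le> ennreal L * local_energy f G x R"
    using lorentz_sobolev_local[OF n, where 'b=complex] by blast
  define B where "B = ?p * A powr (1 / real CARD('n))"
  have B: "0 \<le> B" using p A by (simp add: B_def)
  show thesis
  proof
    show "0 < (B + 1) * L" using B L by simp
    fix f :: "real^'n \<Rightarrow> complex" and G and x :: "real^'n" and R :: real and c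
    assume f: "grad_bound f G" and R: "0 < R"
    define F where "F = (\<lambda>y. c - f (x - y))"
    have F: "grad_bound F (\<lambda>y. G (x - y))"
      unfolding F_def by (rule grad_bound_const_minus[OF grad_bound_reflect[OF f]])
    have [measurable]: "F \<in> borel_measurable borel" by (rule grad_bound_measurable_fun[OF F])
    have [measurable]: "G \<in> borel_measurable borel" by (rule grad_bound_measurable[OF f])
    have [measurable]: "f \<in> borel_measurable borel" by (rule grad_bound_measurable_fun[OF f])
    \<comment> \<open>the measure \<open>\<bar>W y\<bar> dy\<close> on the ball\<close>
    define M where "M = density lborel (\<lambda>y. ennreal (norm (W y)) * indicator (ball 0 R) y)"
    have eM: "emeasure M E = (\<integral>\<^sup>+y\<in>ball 0 R \<inter> E. ennreal (norm (W y)) \<partial>lborel)" if "E \<in> sets borel" for E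
      unfolding M_def using that
      by (subst emeasure_density) (auto simp: mult.assoc indicator_inter_arith)
    have "emeasure M (space M) < \<infinity>"
      using eM[of UNIV] rough_kernel_locally_integrable[OF n W, of R] by (simp add: M_def)
    then interpret M: finite_measure M by (intro finite_measureI) (simp add: less_top)
    have "(\<integral>\<^sup>+y\<in>ball 0 R. ennreal (norm (W y) * norm (F y)) \<partial>lborel) = (\<integral>\<^sup>+y. ennreal (norm (F y)) \<partial>M)"
      unfolding M_def by (subst nn_integral_density) (auto simp: ennreal_mult mult_ac intro!: nn_integral_cong)
    also have "\<dots> = (\<integral>\<^sup>+t\<in>{0<..}. emeasure M {y \<in> space M. ennreal t < ennreal (norm (F y))} \<partial>lborel)"
      by (rule nn_integral_layer_cake[OF M.sigma_finite_measure_axioms]) (simp add: M_def)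
    also have "\<dots> \<le> (\<integral>\<^sup>+t. ennreal (B * R) * (epowr (emeasure lborel {y \<in> ball 0 R. t < norm (F y)}) (1 / ?p) * indicator {0<..} t) \<partial>lborel)"
    proof (rule nn_integral_mono)
      fix t :: real
      show "emeasure M {y \<in> space M. ennreal t < ennreal (norm (F y))} * indicator {0<..} t
          \<le> ennreal (B * R) * (epowr (emeasure lborel {y \<in> ball 0 R. t < norm (F y)}) (1 / ?p) * indicator {0<..} t)"
      proof (cases "0 < t")
        case True
        have "emeasure M {y \<in> space M. ennreal t < ennreal (norm (F y))} = emeasure M {y. t < norm (F y)}"
          using True by (intro arg_cong[where f="emeasure M"]) (auto simp: M_def ennreal_less_iff)
        also have "\<dots> = (\<integral>\<^sup>+y\<in>ball 0 R \<inter> {y. t < norm (F y)}. ennreal (norm (W y)) \<partial>lborel)"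
          by (rule eM) measurable
        also have "\<dots> \<le> ennreal (B * R) * epowr (emeasure lborel (ball 0 R \<inter> {y. t < norm (F y)})) (1 / ?p)"
          unfolding B_def by (rule rough_kernel_nn_integral_le[OF n W R]) auto
        finally show ?thesis using True by (simp add: Int_def)
      qed simp
    qed
    also have "\<dots> = ennreal (B * R) * (\<integral>\<^sup>+t\<in>{0<..}. epowr (emeasure lborel {y \<in> ball 0 R. t < norm (F y)}) (1 / ?p) \<partial>lborel)"
    proof (rule nn_integral_cmult)
      have "(\<integral>\<^sup>+y. (if t < norm (F y) then indicator (ball 0 R) y else 0) \<partial>lborel)
          = emeasure lborel {y \<in> ball 0 R. t < norm (F y)}" for t
      proof -
        have "(\<integral>\<^sup>+y. (if t < norm (F y) then indicator (ball 0 R) y else 0) \<partial>lborel)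
            = (\<integral>\<^sup>+y. indicator {y \<in> ball 0 R. t < norm (F y)} y \<partial>lborel)"
          by (intro nn_integral_cong) (simp add: indicator_def)
        also have "\<dots> = emeasure lborel {y \<in> ball 0 R. t < norm (F y)}"
          by (rule nn_integral_indicator) measurable
        finally show ?thesis .
      qed
      then have eq: "(\<lambda>t. emeasure lborel {y \<in> ball 0 R. t < norm (F y)})
          = (\<lambda>t. \<integral>\<^sup>+y. (if t < norm (F y) then indicator (ball 0 R) y else 0) \<partial>lborel)"
        by simp
      have [measurable]: "(\<lambda>t. emeasure lborel {y \<in> ball 0 R. t < norm (F y)}) \<in> borel_measurable borel"
        unfolding eq by measurable
      show "(\<lambda>t. epowr (emeasure lborel {y \<in> ball 0 R. t < norm (F y)}) (1 / ?p) * indicator {0<..} t) \<in> borel_measurable lborel"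
        by measurable
    qed
    also have "\<dots> \<le> ennreal (B * R) * (ennreal L * local_energy F (\<lambda>y. G (x - y)) 0 R)"
      by (intro mult_left_mono L(2)[OF F R]) auto
    also have "local_energy F (\<lambda>y. G (x - y)) 0 R = local_energy (\<lambda>y. c - f y) G x R"
    proof -
      have shift: "(\<integral>\<^sup>+y\<in>ball 0 (2 * R). g (x - y) \<partial>lborel) = (\<integral>\<^sup>+y\<in>ball x (2 * R). g y \<partial>lborel)"
        if [measurable]: "g \<in> borel_measurable borel" for g :: "real^'n \<Rightarrow> ennreal"
        by (subst nn_integral_lborel_reflect[of "\<lambda>y. g y * indicator (ball x (2 * R)) y" x, symmetric])
           (auto simp: indicator_def dist_norm intro!: nn_integral_cong)
      show ?thesis
        using shift[of "\<lambda>y. ennreal (G y)"] shift[of "\<lambda>y. ennreal (norm (c - f y))"]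
        by (simp add: local_energy_def F_def)
    qed
    also have "ennreal (B * R) * (ennreal L * X) \<le> ennreal ((B + 1) * L * R) * X" for X
    proof -
      have "ennreal (B * R) * (ennreal L * X) = ennreal (B * R * L) * X"
        using B R L by (simp add: ennreal_mult mult.assoc)
      also have "\<dots> \<le> ennreal ((B + 1) * L * R) * X"
        using R L by (intro mult_right_mono ennreal_leI) (auto simp: algebra_simps)
      finally show ?thesis .
    qed
    finally show "(\<integral>\<^sup>+y\<in>ball 0 R. ennreal (norm (W y) * norm (c - f (x - y))) \<partial>lborel)
      \<le> ennreal ((B + 1) * L * R) * local_energy (\<lambda>y. c - f y) G x R"
      unfolding F_def .
  qed
qed

section \<open>Pointwise bounds for the maximal operators\<close>

lemma norm_integral_le_nn_integral:
  fixes f :: "'a \<Rightarrow> 'b::{banach, second_countable_topology}"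
  shows "ennreal (norm (integral\<^sup>L M f)) \<le> (\<integral>\<^sup>+x. ennreal (norm (f x)) \<partial>M)"
  by (cases "integrable M f") (simp_all add: integral_norm_bound_ennreal not_integrable_integral_eq)

text \<open>
  Every application of the maximal operator to a potential costs only a constant factor.
\<close>

lemma iterated_maximal_le_riesz:
  assumes n: "2 \<le> CARD('n)"
  obtains C where "riesz_bound (\<lambda>f :: real^'n \<Rightarrow> complex. (maximal ^^ k) (enorm f)) C"
proof -
  obtain A where "riesz_bound (\<lambda>(f :: real^'n \<Rightarrow> complex) x. ennreal (norm (f x))) A"
    using norm_le_riesz by blast
  note A = riesz_boundD[OF this]
  define B where "B = riesz_maximal_const CARD('n) + 1"
  have B: "0 < B" using riesz_maximal_const_nonneg[of "CARD('n)"] by (simp add: B_def)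
  show thesis
  proof (rule that[OF riesz_boundI])
    show "0 < A * B ^ k" using A B by simp
    fix f :: "real^'n \<Rightarrow> complex" and G x assume f: "grad_bound f G" "bounded {x. f x \<noteq> 0}"
    have [measurable]: "G \<in> borel_measurable borel" by (rule grad_bound_measurable[OF f(1)])
    let ?I = "riesz (\<lambda>y. ennreal (G y))"
    show "(maximal ^^ k) (enorm f) x \<le> ennreal (A * B ^ k) * ?I x"
    proof (induction k arbitrary: x)
      case 0
      show ?case using A(2)[OF f] by (simp add: enorm_def)
    next
      case (Suc k)
      have "(maximal ^^ Suc k) (enorm f) x \<le> maximal (\<lambda>y. ennreal (A * B ^ k) * ?I y) x"
        unfolding funpow.simps o_apply by (rule maximal_mono[OF Suc])
      also have "\<dots> \<le> ennreal (A * B ^ k) * maximal ?I x"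
        by (rule maximal_cmult_le) measurable
      also have "\<dots> \<le> ennreal (A * B ^ k) * (ennreal B * ?I x)"
      proof (rule mult_left_mono)
        have "maximal ?I x \<le> ennreal (riesz_maximal_const CARD('n)) * ?I x"
          by (rule maximal_riesz_le[OF n]) measurable
        also have "\<dots> \<le> ennreal B * ?I x"
          by (intro mult_right_mono ennreal_leI) (auto simp: B_def)
        finally show "maximal ?I x \<le> ennreal B * ?I x" .
      qed simp
      also have "\<dots> = ennreal (A * B ^ Suc k) * ?I x"
      proof -
        have "ennreal (A * B ^ k) * ennreal B = ennreal (A * B ^ Suc k)"
          using A(1) B by (simp add: ennreal_mult[symmetric] mult_ac)
        then show ?thesis by (simp only: mult.assoc[symmetric])
      qed
      finally show ?case .
    qed
  qed
qed

text \<open>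
  The second term of the local energy is an average of \<open>\<bar>f\<bar>\<close>, and therefore
  bounded by its maximal function.
\<close>

lemma local_terms_le_riesz:
  assumes n: "2 \<le> CARD('n)"
  obtains C where "0 < C" "\<And>(f :: real^'n \<Rightarrow> complex) G x R. grad_bound f G \<Longrightarrow> bounded {x. f x \<noteq> 0} \<Longrightarrow> 0 < R \<Longrightarrow>
    local_energy f G x R
      \<le> ennreal (C * R ^ (CARD('n) - 1)) * riesz (\<lambda>y. ennreal (G y)) x"
proof -
  obtain A where "riesz_bound (\<lambda>f :: real^'n \<Rightarrow> complex. (maximal ^^ 1) (enorm f)) A"
    using iterated_maximal_le_riesz[OF n] by blast
  note A = riesz_boundD[OF this]
  define C where "C = 2 ^ (CARD('n) - 1) + 4 ^ CARD('n) * A"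
  show thesis
  proof
    show "0 < C" using A by (simp add: C_def add_pos_pos)
    fix f :: "real^'n \<Rightarrow> complex" and G x and R :: real
    assume f: "grad_bound f G" "bounded {x. f x \<noteq> 0}" and R: "0 < R"
    have [measurable]: "G \<in> borel_measurable borel" by (rule grad_bound_measurable[OF f(1)])
    let ?I = "riesz (\<lambda>y. ennreal (G y)) x"
    have pw: "r ^ CARD('n) = r * r ^ (CARD('n) - 1)" for r :: real
      by (metis Suc_diff_1 power_Suc zero_less_card_finite)
    have 1: "(\<integral>\<^sup>+y\<in>ball x (2 * R). ennreal (G y) \<partial>lborel) \<le> ennreal (2 ^ (CARD('n) - 1) * R ^ (CARD('n) - 1)) * ?I"
      using nn_integral_ball_le_riesz[of "2 * R" "\<lambda>y. ennreal (G y)" x] R by (simp add: power_mult_distrib)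
    have "(\<integral>\<^sup>+y\<in>ball x (2 * R). ennreal (norm (f y)) \<partial>lborel) \<le> maximal (enorm f) x * ennreal ((2 * (2 * R)) ^ CARD('n))"
      using nn_integral_ball_le_maximal[of "2 * R" "enorm f" x] R by (simp add: enorm_def)
    also have "\<dots> \<le> ennreal A * ?I * ennreal ((2 * (2 * R)) ^ CARD('n))"
      using A(2)[OF f] by (intro mult_right_mono) auto
    finally have "ennreal (1 / R) * (\<integral>\<^sup>+y\<in>ball x (2 * R). ennreal (norm (f y)) \<partial>lborel)
        \<le> ennreal (1 / R) * (ennreal A * ?I * ennreal ((2 * (2 * R)) ^ CARD('n)))"
      by (rule mult_left_mono) simp
    also have "\<dots> = ennreal (1 / R) * ennreal A * ennreal ((4 * R) ^ CARD('n)) * ?I"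
      by (simp add: mult_ac)
    also have "ennreal (1 / R) * ennreal A * ennreal ((4 * R) ^ CARD('n)) = ennreal (4 ^ CARD('n) * A * R ^ (CARD('n) - 1))"
    proof -
      have "1 / R * A * (4 * R) ^ CARD('n) = 4 ^ CARD('n) * A * R ^ (CARD('n) - 1)"
        using R by (simp add: power_mult_distrib pw[of R])
      then show ?thesis using R A(1) by (simp add: ennreal_mult[symmetric])
    qed
    finally have 2: "ennreal (1 / R) * (\<integral>\<^sup>+y\<in>ball x (2 * R). ennreal (norm (f y)) \<partial>lborel)
        \<le> ennreal (4 ^ CARD('n) * A * R ^ (CARD('n) - 1)) * ?I" .
    have "ennreal (2 ^ (CARD('n) - 1) * R ^ (CARD('n) - 1)) * ?I + ennreal (4 ^ CARD('n) * A * R ^ (CARD('n) - 1)) * ?I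
        = ennreal (C * R ^ (CARD('n) - 1)) * ?I"
      unfolding distrib_right[symmetric] using R A(1)
      by (subst ennreal_plus[symmetric]) (simp_all add: C_def distrib_right)
    then show "local_energy f G x R
        \<le> ennreal (C * R ^ (CARD('n) - 1)) * ?I"
      using add_mono[OF 1 2] by (simp add: local_energy_def)
  qed
qed

lemma lorentz_maximal_le_riesz:
  assumes n: "2 \<le> CARD('n)"
  obtains C where "riesz_bound (lorentz_maximal :: (real^'n \<Rightarrow> complex) \<Rightarrow> _) C"
proof -
  let ?p = "dual_exponent CARD('n)" and ?m = "CARD('n) - 1"
  note p = dual_exponent_simps[OF n]
  obtain L where L: "0 < L" "\<And>(f :: real^'n \<Rightarrow> complex) G x R. grad_bound f G \<Longrightarrow> 0 < R \<Longrightarrow>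
    (\<integral>\<^sup>+t\<in>{0<..}. epowr (emeasure lborel {y \<in> ball x R. t < norm (f y)}) (1 / ?p) \<partial>lborel)
      \<le> ennreal L * local_energy f G x R"
    using lorentz_sobolev_local[OF n, where 'b=complex] by blast
  obtain A where A: "0 < A" "\<And>(f :: real^'n \<Rightarrow> complex) G x R. grad_bound f G \<Longrightarrow> bounded {x. f x \<noteq> 0} \<Longrightarrow> 0 < R \<Longrightarrow>
    local_energy f G x R
      \<le> ennreal (A * R ^ ?m) * riesz (\<lambda>y. ennreal (G y)) x"
    using local_terms_le_riesz[OF n] by blast
  define C where "C = ?p * L * A * (2 * real CARD('n)) ^ ?m"
  show thesis
  proof (rule that[OF riesz_boundI])
    show "0 < C" using p L A by (simp add: C_def)
    fix f :: "real^'n \<Rightarrow> complex" and G x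
    assume f: "grad_bound f G" "bounded {x. f x \<noteq> 0}"
    have [measurable]: "f \<in> borel_measurable borel" by (rule grad_bound_measurable_fun[OF f(1)])
    let ?I = "riesz (\<lambda>y. ennreal (G y)) x"
    show "lorentz_maximal f x \<le> ennreal C * ?I"
      unfolding lorentz_maximal_def
    proof (rule SUP_least)
      fix Q assume "Q \<in> cubes_at x"
      then obtain a l where al: "Q = cube a l" "0 < l" "x \<in> cube a l" by (rule cubes_at_cases)
      \<comment> \<open>The factor \<open>2\<close> makes the open ball of radius \<open>R\<close> around \<open>x\<close> contain the whole closed cube.\<close>
      define R where "R = 2 * real CARD('n) * l"
      have R: "0 < R" using al by (simp add: R_def)
      have sub: "Q \<subseteq> ball x R"
      proof
        fix z assume "z \<in> Q"
        then have "norm (z - x) \<le> real CARD('n) * l" using dist_cube_le[OF al(3)] al(1) by simp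
        also have "\<dots> < R" using al by (simp add: R_def)
        finally show "z \<in> ball x R" by (simp add: dist_norm norm_minus_commute)
      qed
      have [measurable]: "Q \<in> sets borel" using al by simp
      have "(\<integral>\<^sup>+t\<in>{0<..}. epowr (emeasure lebesgue {y \<in> Q. t < norm (f y)}) (1 / ?p) \<partial>lborel)
          \<le> (\<integral>\<^sup>+t\<in>{0<..}. epowr (emeasure lborel {y \<in> ball x R. t < norm (f y)}) (1 / ?p) \<partial>lborel)"
      proof (intro nn_integral_mono mult_right_mono epowr_mono)
        fix t :: real
        have "{y \<in> Q. t < norm (f y)} \<in> sets borel" by measurable
        then have "emeasure lebesgue {y \<in> Q. t < norm (f y)} = emeasure lborel {y \<in> Q. t < norm (f y)}"
          by (simp add: emeasure_completion)
        also have "\<dots> \<le> emeasure lborel {y \<in> ball x R. t < norm (f y)}"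
          using sub by (intro emeasure_mono) auto
        finally show "emeasure lebesgue {y \<in> Q. t < norm (f y)} \<le> emeasure lborel {y \<in> ball x R. t < norm (f y)}" .
      qed (use p in auto)
      also have "\<dots> \<le> ennreal L * (ennreal (A * R ^ ?m) * ?I)"
        by (rule order_trans[OF L(2)[OF f(1) R]], rule mult_left_mono[OF A(2)[OF f R]]) simp
      finally have le: "(\<integral>\<^sup>+t\<in>{0<..}. epowr (emeasure lebesgue {y \<in> Q. t < norm (f y)}) (1 / ?p) \<partial>lborel)
          \<le> ennreal L * (ennreal (A * R ^ ?m) * ?I)" .
      have "lorentz_norm ?p Q f \<le> ennreal ?p * (ennreal L * (ennreal (A * R ^ ?m) * ?I)) / epowr (emeasure lebesgue Q) (1 / ?p)"
        unfolding lorentz_norm_def by (intro divide_right_mono_ennreal mult_left_mono le) simp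
      also have "epowr (emeasure lebesgue Q) (1 / ?p) = ennreal (l ^ ?m)"
      proof -
        have "(l ^ CARD('n)) powr (1 / ?p) = l powr (real CARD('n) * (1 / ?p))"
          using al by (simp add: powr_realpow[symmetric] powr_powr)
        also have "real CARD('n) * (1 / ?p) = real ?m"
          using n p(3) by (simp add: field_simps of_nat_diff)
        also have "l powr real ?m = l ^ ?m" using al by (intro powr_realpow)
        finally show ?thesis using al by (simp add: emeasure_cube epowr_ennreal)
      qed
      also have "ennreal ?p * (ennreal L * (ennreal (A * R ^ ?m) * ?I)) / ennreal (l ^ ?m)
          = ennreal C * ?I * (ennreal (l ^ ?m) / ennreal (l ^ ?m))"
      proof -
        have "ennreal ?p * (ennreal L * ennreal (A * R ^ ?m)) = ennreal C * ennreal (l ^ ?m)"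
          using p L A R al by (simp add: ennreal_mult[symmetric] C_def R_def power_mult_distrib mult_ac)
        then have "ennreal ?p * (ennreal L * (ennreal (A * R ^ ?m) * ?I)) = ennreal C * ennreal (l ^ ?m) * ?I"
          by (simp only: mult.assoc[symmetric])
        also have "\<dots> = ennreal C * ?I * ennreal (l ^ ?m)" by (simp only: mult_ac)
        finally show ?thesis by (simp only: ennreal_times_divide)
      qed
      also have "ennreal (l ^ ?m) / ennreal (l ^ ?m) = 1"
        using al by (intro ennreal_divide_self) auto
      finally show "lorentz_norm ?p Q f \<le> ennreal C * ?I" by simp
    qed
  qed
qed

lemma spherical_maximal_le_riesz: "riesz_bound (spherical_maximal :: (real^'n \<Rightarrow> complex) \<Rightarrow> _) 1"
proof (rule riesz_boundI)
  fix f :: "real^'n \<Rightarrow> complex" and G x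
  assume f: "grad_bound f G" "bounded {x. f x \<noteq> 0}"
  have "spherical_maximal f x \<le> riesz (\<lambda>y. ennreal (G y)) x"
    unfolding spherical_maximal_def
  proof (rule SUP_least)
    fix t :: real assume "t \<in> {0<..}"
    then show "ennreal (norm (LINT y|sphere_measure. f (x - t *\<^sub>R y))) \<le> riesz (\<lambda>y. ennreal (G y)) x"
      by (intro order_trans[OF norm_integral_le_nn_integral] spherical_mean_le_riesz[OF f]) simp
  qed
  then show "spherical_maximal f x \<le> ennreal 1 * riesz (\<lambda>y. ennreal (G y)) x" by simp
qed simp

lemma rough_maximal_le_riesz:
  fixes \<Omega> :: "real^'n \<Rightarrow> complex"
  assumes n: "2 \<le> CARD('n)" and \<Omega>: "weak_sphere_kernel \<Omega>"
  obtains C where "riesz_bound (rough_maximal \<Omega>) C"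
proof -
  let ?m = "CARD('n) - 1"
  have pw: "r ^ CARD('n) = r * r ^ ?m" for r :: real
    by (metis Suc_diff_1 power_Suc zero_less_card_finite)
  obtain W K where W: "rough_kernel W K" "AE y in lborel. \<Omega> y = W y"
    using weak_sphere_kernel_borel_version[OF \<Omega>] by blast
  obtain B where B: "0 < B" "\<And>(f :: real^'n \<Rightarrow> complex) G x R c. grad_bound f G \<Longrightarrow> 0 < R \<Longrightarrow>
    (\<integral>\<^sup>+y\<in>ball 0 R. ennreal (norm (W y) * norm (c - f (x - y))) \<partial>lborel)
      \<le> ennreal (B * R) * local_energy (\<lambda>y. c - f y) G x R"
    using rough_kernel_local_bound[OF n W(1)] by blast
  obtain A where A: "0 < A" "\<And>(f :: real^'n \<Rightarrow> complex) G x R. grad_bound f G \<Longrightarrow> bounded {x. f x \<noteq> 0} \<Longrightarrow> 0 < R \<Longrightarrow>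
    local_energy f G x R
      \<le> ennreal (A * R ^ ?m) * riesz (\<lambda>y. ennreal (G y)) x"
    using local_terms_le_riesz[OF n] by blast
  show thesis
  proof (rule that[OF riesz_boundI])
    show "0 < B * A" using A B by simp
    fix f :: "real^'n \<Rightarrow> complex" and G x
    assume f: "grad_bound f G" "bounded {x. f x \<noteq> 0}"
    let ?I = "riesz (\<lambda>y. ennreal (G y)) x"
    show "rough_maximal \<Omega> f x \<le> ennreal (B * A) * ?I"
      unfolding rough_maximal_def
    proof (rule SUP_least)
      fix t :: real assume "t \<in> {0<..}"
      then have t: "0 < t" by simp
      have "(\<integral>\<^sup>+y\<in>ball 0 t. ennreal (norm (\<Omega> y * f (x - y))) \<partial>lebesgue)
          = (\<integral>\<^sup>+y\<in>ball 0 t. ennreal (norm (W y) * norm (0 - f (x - y))) \<partial>lborel)"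
        unfolding nn_integral_lebesgue_eq
        by (rule nn_integral_cong_AE) (use W(2) in eventually_elim, simp add: norm_mult)
      also have "\<dots> \<le> ennreal (B * t) * local_energy (\<lambda>y. 0 - f y) G x t"
        by (rule B(2)[OF f(1) t])
      also have "\<dots> \<le> ennreal (B * t) * (ennreal (A * t ^ ?m) * ?I)"
        using A(2)[OF f t, of x] by (intro mult_left_mono) (auto simp: local_energy_def)
      also have "\<dots> = ennreal (B * A) * ?I * ennreal (t ^ CARD('n))"
      proof -
        have "ennreal (B * t) * ennreal (A * t ^ ?m) = ennreal (B * A) * ennreal (t ^ CARD('n))"
          using A B t by (simp add: ennreal_mult[symmetric] pw[of t] mult_ac)
        then have "ennreal (B * t) * (ennreal (A * t ^ ?m) * ?I) = ennreal (B * A) * ennreal (t ^ CARD('n)) * ?I"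
          by (simp only: mult.assoc[symmetric])
        then show ?thesis by (simp only: mult_ac)
      qed
      finally have "(\<integral>\<^sup>+y\<in>ball 0 t. ennreal (norm (\<Omega> y * f (x - y))) \<partial>lebesgue) / ennreal (t ^ CARD('n))
          \<le> ennreal (B * A) * ?I * ennreal (t ^ CARD('n)) / ennreal (t ^ CARD('n))"
        by (rule divide_right_mono_ennreal)
      also have "\<dots> = ennreal (B * A) * ?I * (ennreal (t ^ CARD('n)) / ennreal (t ^ CARD('n)))"
        by (simp add: ennreal_times_divide)
      also have "ennreal (t ^ CARD('n)) / ennreal (t ^ CARD('n)) = 1"
        using t by (intro ennreal_divide_self) auto
      finally show "(\<integral>\<^sup>+y\<in>ball 0 t. ennreal (norm (\<Omega> y * f (x - y))) \<partial>lebesgue) / ennreal (t ^ CARD('n))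
          \<le> ennreal (B * A) * ?I" by simp
    qed
  qed
qed

section \<open>Pointwise bounds for the rough singular integrals\<close>

text \<open>
  In polar coordinates the integral over each sphere vanishes. Without integrability the left-hand
  side is \<open>0\<close> by convention.
\<close>

lemma rough_kernel_radial_integral_eq_0:
  fixes W :: "real^'n \<Rightarrow> complex"
  assumes W: "rough_kernel W A" and mean: "(LINT \<theta>|sphere_measure. W \<theta>) = 0"
    and \<rho> [measurable]: "\<rho> \<in> borel_measurable borel"
  shows "(LINT y|lborel. complex_of_real (\<rho> (norm y)) * W y) = 0"
proof (cases "integrable lborel (\<lambda>y. complex_of_real (\<rho> (norm y)) * W y)")
  case True
  let ?\<sigma> = "sphere_measure :: (real^'n) measure"
  have [measurable]: "W \<in> borel_measurable borel" and hom: "\<And>y. W (sgn y) = W y"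
    using W by (auto simp: rough_kernel_def)
  define P where "P = density lborel (\<lambda>r::real. ennreal (r ^ (CARD('n) - 1)) * indicator {0<..} r)"
  interpret \<sigma>: finite_measure ?\<sigma> by (rule finite_sphere_measure)
  have "AE r in lborel. ennreal (r ^ (CARD('n) - 1)) * indicator {0<..} r \<noteq> \<infinity>"
    by (rule AE_I2) (simp add: indicator_def)
  then have "sigma_finite_measure P"
    unfolding P_def by (subst sigma_finite_measure.sigma_finite_iff_density_finite[OF sigma_finite_lborel]) auto
  then interpret pair_sigma_finite P ?\<sigma>
    by (intro pair_sigma_finite.intro \<sigma>.sigma_finite_measure_axioms)
  have setsP [measurable_cong]: "sets P = sets borel" by (simp add: P_def)
  have id [measurable]: "(\<lambda>\<theta>. \<theta>) \<in> borel_measurable ?\<sigma>"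
    by (rule measurable_sphere_measure) simp
  have pol [measurable]: "(\<lambda>z. fst z *\<^sub>R snd z) \<in> borel_measurable (P \<Otimes>\<^sub>M ?\<sigma>)"
  proof -
    have "(\<lambda>z. snd z) \<in> borel_measurable (P \<Otimes>\<^sub>M ?\<sigma>)"
      using measurable_compose[OF measurable_snd id] by simp
    moreover have "(\<lambda>z. fst z) \<in> borel_measurable (P \<Otimes>\<^sub>M ?\<sigma>)"
      using measurable_fst[of P ?\<sigma>] unfolding measurable_cong_sets[OF refl setsP] by simp
    ultimately show ?thesis by (intro borel_measurable_scaleR)
  qed
  let ?d = "distr (P \<Otimes>\<^sub>M ?\<sigma>) borel (\<lambda>z. fst z *\<^sub>R snd z)"
  \<comment> \<open>polar coordinates as an identity of measures, which gives access to Fubini for complex-valued functions\<close>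
  have eq: "?d = lborel"
  proof (rule measure_eqI)
    fix S assume "S \<in> sets (?d)"
    then have S [measurable]: "S \<in> sets borel" by simp
    let ?F = "indicator S :: real^'n \<Rightarrow> ennreal"
    have F [measurable]: "?F \<in> borel_measurable borel" using S by (rule borel_measurable_indicator)
    have "emeasure (?d) S
        = (\<integral>\<^sup>+y. ?F y \<partial>?d)"
      using S by simp
    also have "\<dots> = (\<integral>\<^sup>+z. ?F (fst z *\<^sub>R snd z) \<partial>(P \<Otimes>\<^sub>M ?\<sigma>))"
      by (rule nn_integral_distr[OF pol]) simp
    also have "\<dots> = (\<integral>\<^sup>+\<theta>. (\<integral>\<^sup>+r. ?F (r *\<^sub>R \<theta>) \<partial>P) \<partial>?\<sigma>)"
      using nn_integral_snd[of "\<lambda>z. ?F (fst z *\<^sub>R snd z)"] measurable_compose[OF pol F] by simp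
    also have "\<dots> = (\<integral>\<^sup>+\<theta>. (\<integral>\<^sup>+r\<in>{0<..}. ?F (r *\<^sub>R \<theta>) * ennreal (r ^ (CARD('n) - 1)) \<partial>lborel) \<partial>?\<sigma>)"
      unfolding P_def by (intro nn_integral_cong, subst nn_integral_density) (auto simp: mult_ac)
    also have "\<dots> = (\<integral>\<^sup>+y. ?F y \<partial>lborel)"
      by (rule polar_coordinates[symmetric, OF F])
    also have "\<dots> = emeasure lborel S" using S by simp
    finally show "emeasure (?d) S = emeasure lborel S" .
  qed simp
  let ?H = "\<lambda>y. complex_of_real (\<rho> (norm y)) * W y"
  have H [measurable]: "?H \<in> borel_measurable borel" by measurable
  have int: "integrable (P \<Otimes>\<^sub>M ?\<sigma>) (\<lambda>z. ?H (fst z *\<^sub>R snd z))"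
    using True integrable_distr_eq[OF pol H] unfolding eq by simp
  have "(LINT y|lborel. ?H y) = (LINT z|(P \<Otimes>\<^sub>M ?\<sigma>). ?H (fst z *\<^sub>R snd z))"
    using integral_distr[OF pol H] unfolding eq by simp
  also have "\<dots> = (LINT r|P. LINT \<theta>|?\<sigma>. ?H (r *\<^sub>R \<theta>))"
    using integral_fst'[OF int] by simp
  also have "\<dots> = 0"
  proof (rule integral_eq_zero_AE)
    have "AE r in P. 0 < r"
      unfolding P_def by (subst AE_density) (auto simp: indicator_def)
    then show "AE r in P. (LINT \<theta>|?\<sigma>. ?H (r *\<^sub>R \<theta>)) = 0"
    proof eventually_elim
      case (elim r)
      have "(LINT \<theta>|?\<sigma>. ?H (r *\<^sub>R \<theta>)) = (LINT \<theta>|?\<sigma>. complex_of_real (\<rho> r) * W \<theta>)"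
      proof (rule Bochner_Integration.integral_cong)
        fix \<theta> :: "real^'n" assume "\<theta> \<in> space ?\<sigma>"
        then have "norm (r *\<^sub>R \<theta>) = r" "sgn (r *\<^sub>R \<theta>) = \<theta>" using elim by (simp_all add: sgn_div_norm)
        then show "?H (r *\<^sub>R \<theta>) = complex_of_real (\<rho> r) * W \<theta>"
          using hom[of "r *\<^sub>R \<theta>"] by simp
      qed simp
      also have "\<dots> = 0" using mean by simp
      finally show ?case .
    qed
  qed
  finally show ?thesis .
qed (simp add: not_integrable_integral_eq)

lemma continuous_bounded_on_cball:
  fixes f :: "'a::euclidean_space \<Rightarrow> 'b::real_normed_vector"
  assumes "continuous_on UNIV f"
  obtains M where "0 \<le> M" "\<And>y. y \<in> cball x R \<Longrightarrow> norm (f y) \<le> M"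
proof -
  have "compact (f ` cball x R)"
    by (intro compact_continuous_image continuous_on_subset[OF assms]) auto
  then obtain M where "\<forall>z\<in>f ` cball x R. norm z \<le> M"
    using compact_imp_bounded bounded_iff by blast
  then have "0 \<le> max M 0" "\<And>y. y \<in> cball x R \<Longrightarrow> norm (f y) \<le> max M 0"
    by (auto intro: max.coboundedI1)
  then show thesis using that by blast
qed

lemma rough_kernel_integrable_ball:
  fixes W :: "real^'n \<Rightarrow> complex"
  assumes n: "2 \<le> CARD('n)" and W: "rough_kernel W A"
    and g: "g \<in> borel_measurable borel" and bound: "\<And>y. norm (g y) \<le> M * indicator (ball 0 R) y"
  shows "integrable lborel (\<lambda>y. W y * g y)"
proof (rule integrableI_bounded)
  have [measurable]: "W \<in> borel_measurable borel" using W by (simp add: rough_kernel_def)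
  note [measurable] = g
  show "(\<lambda>y. W y * g y) \<in> borel_measurable lborel" by measurable
  have "(\<integral>\<^sup>+y. ennreal (norm (W y * g y)) \<partial>lborel) \<le> (\<integral>\<^sup>+y. ennreal \<bar>M\<bar> * (ennreal (norm (W y)) * indicator (ball 0 R) y) \<partial>lborel)"
  proof (rule nn_integral_mono)
    fix y
    have "norm (g y) \<le> \<bar>M\<bar> * indicator (ball 0 R) y"
      using bound[of y] by (auto simp: indicator_def split: if_splits)
    then have "norm (W y) * norm (g y) \<le> norm (W y) * (\<bar>M\<bar> * indicator (ball 0 R) y)"
      by (rule mult_left_mono) simp
    then have "ennreal (norm (W y * g y)) \<le> ennreal (\<bar>M\<bar> * (norm (W y) * indicator (ball 0 R) y))"
      by (intro ennreal_leI) (simp add: norm_mult mult_ac)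
    also have "\<dots> = ennreal \<bar>M\<bar> * (ennreal (norm (W y)) * indicator (ball 0 R) y)"
      by (simp add: ennreal_mult' indicator_def)
    finally show "ennreal (norm (W y * g y)) \<le> ennreal \<bar>M\<bar> * (ennreal (norm (W y)) * indicator (ball 0 R) y)" .
  qed
  also have "\<dots> = ennreal \<bar>M\<bar> * (\<integral>\<^sup>+y\<in>ball 0 R. ennreal (norm (W y)) \<partial>lborel)"
    by (rule nn_integral_cmult) measurable
  also have "\<dots> < \<infinity>"
    using rough_kernel_locally_integrable[OF n W, of R] by (simp add: ennreal_mult_less_top)
  finally show "(\<integral>\<^sup>+y. ennreal (norm (W y * g y)) \<partial>lborel) < \<infinity>" .
qed

text \<open>
  As \<open>W\<close> has integral zero over the annulus, any constant \<open>c\<close> may be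
  subtracted from \<open>f\<close>. The choice \<open>c = f z\<close>, averaged over all
  \<open>z\<close> in a ball, turns the zero-order term of the local energy into the double integral
  of Poincare's inequality.
\<close>

lemma rough_kernel_annulus_bound:
  fixes W :: "real^'n \<Rightarrow> complex"
  assumes n: "2 \<le> CARD('n)" and W: "rough_kernel W A" and mean: "(LINT \<theta>|sphere_measure. W \<theta>) = 0"
  obtains C where "0 < C" "\<And>(f :: real^'n \<Rightarrow> complex) G x t s. grad_bound f G \<Longrightarrow> 0 < s \<Longrightarrow>
    ennreal (norm (LINT y|lborel. W y * (indicator {y. t < norm y \<and> norm y < s} y * f (x - y))))
      \<le> ennreal (C * s) * (\<integral>\<^sup>+y\<in>ball x (2 * s). ennreal (G y) \<partial>lborel)"
proof -
  have [measurable]: "W \<in> borel_measurable borel" using W by (simp add: rough_kernel_def)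
  obtain B where B: "0 < B" "\<And>(f :: real^'n \<Rightarrow> complex) G x R c. grad_bound f G \<Longrightarrow> 0 < R \<Longrightarrow>
    (\<integral>\<^sup>+y\<in>ball 0 R. ennreal (norm (W y) * norm (c - f (x - y))) \<partial>lborel)
      \<le> ennreal (B * R) * local_energy (\<lambda>y. c - f y) G x R"
    using rough_kernel_local_bound[OF n W] by blast
  define C where "C = B * (1 + 2 ^ Suc CARD('n) * 2)"
  show thesis
  proof
    show "0 < C" unfolding C_def using B by (intro mult_pos_pos add_pos_pos) auto
    fix f :: "real^'n \<Rightarrow> complex" and G and x :: "real^'n" and t s :: real
    assume f: "grad_bound f G" and s: "0 < s"
    have f_meas [measurable]: "f \<in> borel_measurable borel" by (rule grad_bound_measurable_fun[OF f])
    have [measurable]: "G \<in> borel_measurable borel" by (rule grad_bound_measurable[OF f])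
    define \<eta> where "\<eta> = (\<lambda>y::real^'n. indicator {y. t < norm y \<and> norm y < s} y :: complex)"
    have \<eta>_meas [measurable]: "\<eta> \<in> borel_measurable borel" unfolding \<eta>_def by measurable
    have \<eta>_le: "norm (\<eta> y) \<le> 1 * indicator (ball 0 s) y" for y
      by (simp add: \<eta>_def indicator_def)
    let ?a = "LINT y|lborel. W y * (\<eta> y * f (x - y))"
    let ?B = "ball x (2 * s)"
    let ?I = "\<integral>\<^sup>+y\<in>?B. ennreal (G y) \<partial>lborel"
    let ?D = "\<lambda>z. \<integral>\<^sup>+y\<in>?B. ennreal (norm (f z - f y)) \<partial>lborel"
    obtain M where M: "0 \<le> M" "\<And>y. y \<in> cball x s \<Longrightarrow> norm (f y) \<le> M"
      using continuous_bounded_on_cball[OF grad_bound_continuous_fun[OF f]] by blast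
    have i1: "integrable lborel (\<lambda>y. W y * (\<eta> y * f (x - y)))"
    proof (rule rough_kernel_integrable_ball[OF n W, of _ M s])
      show "norm (\<eta> y * f (x - y)) \<le> M * indicator (ball 0 s) y" for y
        using M(1) M(2)[of "x - y"] by (auto simp: \<eta>_def indicator_def dist_norm)
    qed measurable
    have i2: "integrable lborel (\<lambda>y. W y * \<eta> y)"
      by (rule rough_kernel_integrable_ball[OF n W \<eta>_meas \<eta>_le])
    have zero: "(LINT y|lborel. W y * \<eta> y) = 0"
    proof -
      have "(LINT y|lborel. complex_of_real (indicator {t<..<s} (norm y)) * W y) = 0"
        by (rule rough_kernel_radial_integral_eq_0[OF W mean]) simp
      moreover have "(\<lambda>y. W y * \<eta> y) = (\<lambda>y. complex_of_real (indicator {t<..<s} (norm y)) * W y)"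
        by (simp add: \<eta>_def indicator_def fun_eq_iff)
      ultimately show ?thesis by (simp only:)
    qed
    \<comment> \<open>The left-hand side does not depend on \<open>c\<close>, which is what permits averaging over \<open>c\<close> afterwards.\<close>
    have pointwise: "ennreal (norm ?a) \<le> ennreal (B * s) * (?I + ennreal (1 / s) * (\<integral>\<^sup>+y\<in>?B. ennreal (norm (c - f y)) \<partial>lborel))" for c
    proof -
      have "(LINT y|lborel. W y * (\<eta> y * (c - f (x - y)))) = (LINT y|lborel. c * (W y * \<eta> y) - W y * (\<eta> y * f (x - y)))"
        by (rule Bochner_Integration.integral_cong) (simp_all add: algebra_simps)
      also have "\<dots> = c * (LINT y|lborel. W y * \<eta> y) - ?a"
        using i1 i2 by simp
      finally have "norm ?a = norm (LINT y|lborel. W y * (\<eta> y * (c - f (x - y))))"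
        using zero by simp
      also have "ennreal \<dots> \<le> (\<integral>\<^sup>+y. ennreal (norm (W y * (\<eta> y * (c - f (x - y))))) \<partial>lborel)"
        by (rule norm_integral_le_nn_integral)
      also have "\<dots> \<le> (\<integral>\<^sup>+y\<in>ball 0 s. ennreal (norm (W y) * norm (c - f (x - y))) \<partial>lborel)"
        by (intro nn_integral_mono) (auto simp: \<eta>_def indicator_def norm_mult)
      also have "\<dots> \<le> ennreal (B * s) * (?I + ennreal (1 / s) * (\<integral>\<^sup>+y\<in>?B. ennreal (norm (c - f y)) \<partial>lborel))"
        using B(2)[OF f s] by (simp add: local_energy_def)
      finally show ?thesis .
    qed
    have "ennreal (norm ?a) * emeasure lborel ?B = (\<integral>\<^sup>+z\<in>?B. ennreal (norm ?a) \<partial>lborel)"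
      by (simp add: nn_integral_cmult_indicator)
    also have "\<dots> \<le> (\<integral>\<^sup>+z. ennreal (B * s) * ?I * indicator ?B z
        + ennreal B * (?D z * indicator ?B z) \<partial>lborel)"
    proof (rule nn_integral_mono)
      fix z
      have "ennreal (B * s) * ennreal (1 / s) = ennreal B"
        using B s by (simp add: ennreal_mult[symmetric])
      then have "ennreal (norm ?a) \<le> ennreal (B * s) * ?I + ennreal B * ?D z"
        using pointwise[of "f z"] by (simp add: distrib_left mult.assoc[symmetric])
      then show "ennreal (norm ?a) * indicator ?B z \<le> ennreal (B * s) * ?I * indicator ?B z
        + ennreal B * (?D z * indicator ?B z)"
        by (simp add: indicator_def)
    qed
    also have "\<dots> = (\<integral>\<^sup>+z. ennreal (B * s) * ?I * indicator ?B z \<partial>lborel)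
        + (\<integral>\<^sup>+z. ennreal B * (?D z * indicator ?B z) \<partial>lborel)"
      by (rule nn_integral_add) measurable
    also have "(\<integral>\<^sup>+z. ennreal (B * s) * ?I * indicator ?B z \<partial>lborel) = ennreal (B * s) * ?I * emeasure lborel ?B"
      by (rule nn_integral_cmult_indicator) simp
    also have "(\<integral>\<^sup>+z. ennreal B * (?D z * indicator ?B z) \<partial>lborel)
        = ennreal B * (\<integral>\<^sup>+z\<in>?B. ?D z \<partial>lborel)"
      by (rule nn_integral_cmult) measurable
    also have "ennreal (B * s) * ?I * emeasure lborel ?B + ennreal B * (\<integral>\<^sup>+z\<in>?B. ?D z \<partial>lborel)
        \<le> ennreal (B * s) * ?I * emeasure lborel ?B + ennreal B * (ennreal (2 ^ Suc CARD('n) * (2 * s)) * ?I * emeasure lborel ?B)"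
      using poincare_double_integral[OF f, of "2 * s" x] s
      by (intro add_left_mono mult_left_mono) (simp_all add: norm_minus_commute)
    also have "\<dots> = ennreal (C * s) * ?I * emeasure lborel ?B"
    proof -
      have "ennreal (B * s) + ennreal B * ennreal (2 ^ Suc CARD('n) * (2 * s)) = ennreal (C * s)"
        using B s by (simp add: C_def ennreal_mult[symmetric] ennreal_plus[symmetric] algebra_simps del: ennreal_plus)
      then show ?thesis by (simp only: mult.assoc[symmetric] distrib_right[symmetric])
    qed
    finally have le: "ennreal (norm ?a) * emeasure lborel ?B \<le> ennreal (C * s) * ?I * emeasure lborel ?B" .
    define v where "v = unit_ball_vol (real CARD('n)) * (2 * s) ^ CARD('n)"
    have v: "0 < v" "emeasure lborel ?B = ennreal v"
      using s by (simp_all add: v_def emeasure_ball)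
    have "ennreal (norm ?a) * ennreal v * ennreal (1 / v) \<le> ennreal (C * s) * ?I * ennreal v * ennreal (1 / v)"
      using le unfolding v(2) by (rule mult_right_mono) simp
    moreover have "ennreal v * ennreal (1 / v) = 1" using v(1) by (simp add: ennreal_mult[symmetric])
    ultimately show "ennreal (norm (LINT y|lborel. W y * (indicator {y. t < norm y \<and> norm y < s} y * f (x - y))))
      \<le> ennreal (C * s) * ?I"
      by (simp add: mult.assoc \<eta>_def)
  qed
qed

text \<open>
  This represents \<open>\<bar>y\<bar> powr (- n)\<close> as a superposition of indicators of the
  balls with radius \<open>s\<close>.
\<close>

lemma nn_integral_radial_weight:
  fixes b :: real
  assumes "0 < b" "0 < n"
  shows "(\<integral>\<^sup>+s. ennreal (real n * s powr - (real n + 1) * indicator {b<..} s) \<partial>lborel) = ennreal (1 / b ^ n)"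
proof -
  have "(\<integral>\<^sup>+s. ennreal (real n * s powr - (real n + 1) * indicator {b<..} s) \<partial>lborel)
      = (\<integral>\<^sup>+s. ennreal (real n) * (ennreal (s powr - (real n + 1)) * indicator {b<..} s) \<partial>lborel)"
    by (intro nn_integral_cong) (simp add: indicator_def ennreal_mult)
  also have "\<dots> = ennreal (real n) * (\<integral>\<^sup>+s\<in>{b<..}. ennreal (s powr - (real n + 1)) \<partial>lborel)"
    by (rule nn_integral_cmult) measurable
  also have "\<dots> = ennreal (real n) * ennreal (b powr (1 - (real n + 1)) / (real n + 1 - 1))"
    using assms by (subst nn_integral_powr_tail_open) auto
  also have "\<dots> = ennreal (1 / b ^ n)"
    using assms by (simp add: ennreal_mult[symmetric] powr_minus_divide powr_realpow)
  finally show ?thesis .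
qed

lemma integral_radial_weight:
  fixes b :: real
  assumes "0 < b" "0 < n"
  shows "(LINT s|lborel. real n * s powr - (real n + 1) * indicator {b<..} s) = 1 / b ^ n"
proof -
  have "(LINT s|lborel. real n * s powr - (real n + 1) * indicator {b<..} s)
      = enn2real (\<integral>\<^sup>+s. ennreal (real n * s powr - (real n + 1) * indicator {b<..} s) \<partial>lborel)"
    by (rule integral_eq_nn_integral) (auto intro!: AE_I2)
  then show ?thesis using assms by (simp only: nn_integral_radial_weight) simp
qed

lemma rough_kernel_integrable_compact_support:
  fixes W f :: "real^'n \<Rightarrow> complex"
  assumes n: "2 \<le> CARD('n)" and W: "rough_kernel W A"
    and f: "continuous_on UNIV f" "bounded {x. f x \<noteq> 0}"
  shows "integrable lborel (\<lambda>y. W y * f (x - y))"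
proof -
  obtain b where b: "\<And>z. f z \<noteq> 0 \<Longrightarrow> norm z \<le> b"
    using f(2) by (auto simp: bounded_iff)
  define R where "R = norm x + \<bar>b\<bar> + 1"
  obtain M where M: "0 \<le> M" "\<And>z. z \<in> cball x R \<Longrightarrow> norm (f z) \<le> M"
    using continuous_bounded_on_cball[OF f(1)] by blast
  have [measurable]: "f \<in> borel_measurable borel" by (rule borel_measurable_continuous_onI[OF f(1)])
  show ?thesis
  proof (rule rough_kernel_integrable_ball[OF n W, of _ M R])
    show "norm (f (x - y)) \<le> M * indicator (ball 0 R) y" for y
    proof (cases "y \<in> ball 0 R")
      case True
      then show ?thesis using M(2)[of "x - y"] by (simp add: dist_norm)
    next
      case False
      have "f (x - y) = 0"
      proof (rule ccontr)
        assume "f (x - y) \<noteq> 0"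
        then have "norm (x - y) \<le> b" by (rule b)
        then have "norm y \<le> norm x + b"
          using norm_triangle_ineq4[of x "x - y"] by simp
        then show False using False by (simp add: R_def)
      qed
      then show ?thesis using M(1) by simp
    qed
  qed measurable
qed

lemma borel_measurable_completion_AE_cong:
  assumes g: "g \<in> borel_measurable (completion M)" and eq: "AE x in M. f x = g x"
  shows "f \<in> borel_measurable (completion M)"
proof (rule measurableI)
  fix S :: "'b set" assume S: "S \<in> sets borel"
  show "f -` S \<inter> space (completion M) \<in> sets (completion M)"
  proof (rule completion.in_sets_AE)
    show "g -` S \<inter> space (completion M) \<in> sets (completion M)"
      using g S by (rule measurable_sets)
    show "AE x in completion M. (x \<in> g -` S \<inter> space (completion M)) = (x \<in> f -` S \<inter> space (completion M))"
      using AE_completion[OF eq] by eventually_elim simp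
  qed simp
qed simp

lemma truncated_singular_eq_lborel:
  fixes W \<Omega> f :: "real^'n \<Rightarrow> complex"
  assumes [measurable]: "W \<in> borel_measurable borel" "f \<in> borel_measurable borel"
    and eq: "AE y in lborel. \<Omega> y = W y"
  shows "truncated_singular \<Omega> t f x
       = (LINT y|lborel. indicator {y. t < norm y} y *\<^sub>R (W y / of_real (norm y ^ CARD('n)) * f (x - y)))"
proof -
  let ?F = "\<lambda>\<Omega> y. indicator {y. t < norm y} y *\<^sub>R (\<Omega> y / of_real (norm y ^ CARD('n)) * f (x - y))"
  have W: "?F W \<in> borel_measurable lborel" by measurable
  then have W': "?F W \<in> borel_measurable lebesgue" by (rule measurable_completion)
  have eq': "AE y in lborel. ?F \<Omega> y = ?F W y" using eq by eventually_elim simp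
  have "truncated_singular \<Omega> t f x = (LINT y|lebesgue. ?F \<Omega> y)"
    by (simp add: truncated_singular_def set_lebesgue_integral_def)
  also have "\<dots> = (LINT y|lebesgue. ?F W y)"
    by (rule integral_cong_AE[OF borel_measurable_completion_AE_cong[OF W' eq'] W' AE_completion[OF eq']])
  also have "\<dots> = (LINT y|lborel. ?F W y)"
    by (rule integral_completion[OF W])
  finally show ?thesis .
qed

text \<open>
  Inserting the representation of \<open>\<bar>y\<bar> powr (- n)\<close> by balls and exchanging
  the integrals writes the truncated singular integral as the integral, over \<open>s > t\<close>
  with weight \<open>n * s powr - (n + 1)\<close>, of the integrals over the annuli \<open>t <
  \<bar>y\<bar> < s\<close>. Each of these is at most \<open>C * s\<close> times the integral of
  \<open>G\<close> over a ball of radius \<open>2 * s\<close>, and integrating \<open>s powr -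
  n\<close> over \<open>s > \<bar>x - y\<bar> / 2\<close> gives a multiple of the Riesz kernel.
\<close>

lemma borel_singular_le_riesz:
  fixes W :: "real^'n \<Rightarrow> complex"
  assumes n: "2 \<le> CARD('n)" and W: "rough_kernel W A" and mean: "(LINT \<theta>|sphere_measure. W \<theta>) = 0"
  obtains C where "riesz_bound (maximal_rough_singular W) C"
proof -
  let ?n = "CARD('n)"
  have [measurable]: "W \<in> borel_measurable borel" using W by (simp add: rough_kernel_def)
  obtain B where B: "0 < B" "\<And>(f :: real^'n \<Rightarrow> complex) G x t s. grad_bound f G \<Longrightarrow> 0 < s \<Longrightarrow>
    ennreal (norm (LINT y|lborel. W y * (indicator {y. t < norm y \<and> norm y < s} y * f (x - y))))
      \<le> ennreal (B * s) * (\<integral>\<^sup>+y\<in>ball x (2 * s). ennreal (G y) \<partial>lborel)"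
    using rough_kernel_annulus_bound[OF n W mean] by blast
  define C where "C = real ?n * B * 2 ^ (?n - 1) / (real ?n - 1)"
  have C: "0 < C" using B n by (simp add: C_def)
  have main: "ennreal (norm (truncated_singular W t f x)) \<le> ennreal C * riesz (\<lambda>y. ennreal (G y)) x"
    if f: "grad_bound f G" "bounded {x. f x \<noteq> 0}" and t: "0 < t"
    for f :: "real^'n \<Rightarrow> complex" and G x and t :: real
  proof -
    have [measurable]: "f \<in> borel_measurable borel" by (rule grad_bound_measurable_fun[OF f(1)])
    have [measurable]: "G \<in> borel_measurable borel" by (rule grad_bound_measurable[OF f(1)])
    define u where "u = (\<lambda>y. W y * f (x - y))"
    have [measurable]: "u \<in> borel_measurable borel" unfolding u_def by measurable
    have u: "integrable lborel u"
      unfolding u_def by (rule rough_kernel_integrable_compact_support[OF n W grad_bound_continuous_fun[OF f(1)] f(2)])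
    let ?a = "\<lambda>s y. indicator {y. t < norm y \<and> norm y < s} y * f (x - y)"
    let ?j = "\<lambda>s y. ennreal (s powr - real ?n) * (if norm (x - y) < 2 * s then 1 else 0)"
    let ?c = "\<lambda>y. ennreal (real ?n * B) * ennreal (G y)"
    let ?w = "\<lambda>(y::real^'n) s. real ?n * s powr - (real ?n + 1) * indicator {norm y<..} s"
    define g where "g = (\<lambda>s::real. real ?n * s powr - (real ?n + 1))"
    have g: "0 \<le> g s" for s by (simp add: g_def)
    have [measurable]: "g \<in> borel_measurable borel" unfolding g_def by measurable
    define h where "h = (\<lambda>s y. if t < norm y \<and> norm y < s then complex_of_real (g s) * u y else 0)"
    have [measurable]: "(\<lambda>(s, y). h s y) \<in> borel_measurable (lborel \<Otimes>\<^sub>M lborel)"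
      unfolding h_def by measurable
    have h_eq: "h s y = complex_of_real (?w y s) * (if t < norm y then u y else 0)" for s y
      by (simp add: h_def g_def indicator_def)
    have h_int: "integrable (lborel \<Otimes>\<^sub>M lborel) (\<lambda>(s, y). h s y)"
    proof (rule integrableI_bounded)
      have "(\<integral>\<^sup>+z. ennreal (norm (case z of (s, y) \<Rightarrow> h s y)) \<partial>(lborel \<Otimes>\<^sub>M lborel))
          = (\<integral>\<^sup>+y. (\<integral>\<^sup>+s. ennreal (norm (h s y)) \<partial>lborel) \<partial>lborel)"
        by (subst lborel_pair.nn_integral_snd[symmetric]) auto
      also have "\<dots> \<le> (\<integral>\<^sup>+y. ennreal (1 / t ^ ?n) * ennreal (norm (u y)) \<partial>lborel)"
      proof (rule nn_integral_mono)
        fix y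
        show "(\<integral>\<^sup>+s. ennreal (norm (h s y)) \<partial>lborel) \<le> ennreal (1 / t ^ ?n) * ennreal (norm (u y))"
        proof (cases "t < norm y")
          case True
          then have y: "0 < norm y" using t by linarith
          have "(\<integral>\<^sup>+s. ennreal (norm (h s y)) \<partial>lborel)
              = (\<integral>\<^sup>+s. ennreal (?w y s) * ennreal (norm (u y)) \<partial>lborel)"
            using True by (intro nn_integral_cong) (simp add: h_eq norm_mult ennreal_mult)
          also have "\<dots> = (\<integral>\<^sup>+s. ennreal (?w y s) \<partial>lborel) * ennreal (norm (u y))"
            by (rule nn_integral_multc) measurable
          also have "\<dots> = ennreal (1 / norm y ^ ?n) * ennreal (norm (u y))"
            using y by (subst nn_integral_radial_weight) auto
          also have "\<dots> \<le> ennreal (1 / t ^ ?n) * ennreal (norm (u y))"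
            using True t y by (intro mult_right_mono ennreal_leI divide_left_mono power_mono mult_pos_pos zero_less_power) auto
          finally show ?thesis .
        qed (simp add: h_def)
      qed
      also have "\<dots> = ennreal (1 / t ^ ?n) * (\<integral>\<^sup>+y. ennreal (norm (u y)) \<partial>lborel)"
        by (rule nn_integral_cmult) measurable
      also have "\<dots> < \<infinity>"
        using u unfolding integrable_iff_bounded by (simp add: ennreal_mult_less_top)
      finally show "(\<integral>\<^sup>+z. ennreal (norm (case z of (s, y) \<Rightarrow> h s y)) \<partial>(lborel \<Otimes>\<^sub>M lborel)) < \<infinity>" .
    qed measurable
    have "truncated_singular W t f x = (LINT y|lborel. LINT s|lborel. h s y)"
      unfolding truncated_singular_eq_lborel[OF \<open>W \<in> borel_measurable borel\<close> \<open>f \<in> borel_measurable borel\<close> AE_I2[OF refl]]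
    proof (rule Bochner_Integration.integral_cong)
      fix y
      have "(LINT s|lborel. h s y) = complex_of_real (LINT s|lborel. ?w y s)
          * (if t < norm y then u y else 0)"
        unfolding h_eq by (simp only: integral_mult_left_zero integral_complex_of_real)
      also have "\<dots> = indicator {y. t < norm y} y *\<^sub>R (W y / of_real (norm y ^ ?n) * f (x - y))"
      proof (cases "t < norm y")
        case True
        then have "0 < norm y" using t by linarith
        then have "(LINT s|lborel. ?w y s) = 1 / norm y ^ ?n"
          by (intro integral_radial_weight) auto
        then show ?thesis using True by (simp add: u_def)
      qed simp
      finally show "indicator {y. t < norm y} y *\<^sub>R (W y / of_real (norm y ^ ?n) * f (x - y)) = (LINT s|lborel. h s y)" by simp
    qed simp
    also have "\<dots> = (LINT s|lborel. LINT y|lborel. h s y)"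
      by (rule lborel_pair.Fubini_integral[OF h_int])
    finally have "ennreal (norm (truncated_singular W t f x))
        \<le> (\<integral>\<^sup>+s. ennreal (norm (LINT y|lborel. h s y)) \<partial>lborel)"
      using norm_integral_le_nn_integral[of lborel "\<lambda>s. LINT y|lborel. h s y"] by simp
    also have "\<dots> \<le> (\<integral>\<^sup>+s. (\<integral>\<^sup>+y. ?c y
        * ?j s y \<partial>lborel) \<partial>lborel)"
    proof (rule nn_integral_mono)
      fix s :: real
      show "ennreal (norm (LINT y|lborel. h s y)) \<le> (\<integral>\<^sup>+y. ?c y
        * ?j s y \<partial>lborel)"
      proof (cases "0 < s")
        case s: True
        have "(LINT y|lborel. h s y) = (LINT y|lborel. complex_of_real (g s) * (W y * ?a s y))"
          by (rule Bochner_Integration.integral_cong) (simp_all add: h_def u_def indicator_def)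
        also have "\<dots> = complex_of_real (g s) * (LINT y|lborel. W y * ?a s y)"
          by simp
        finally have "ennreal (norm (LINT y|lborel. h s y))
            = ennreal (g s) * ennreal (norm (LINT y|lborel. W y * ?a s y))"
          using g[of s] by (simp add: norm_mult ennreal_mult)
        also have "\<dots> \<le> ennreal (g s) * (ennreal (B * s) * (\<integral>\<^sup>+y\<in>ball x (2 * s). ennreal (G y) \<partial>lborel))"
          by (rule mult_left_mono[OF B(2)[OF f(1) s]]) simp
        also have "\<dots> = ennreal (g s) * ennreal (B * s) * (\<integral>\<^sup>+y\<in>ball x (2 * s). ennreal (G y) \<partial>lborel)"
          by (simp only: mult.assoc)
        also have "ennreal (g s) * ennreal (B * s) = ennreal (real ?n * B) * ennreal (s powr - real ?n)"
        proof -
          have "s powr - (real ?n + 1) * s = s powr - real ?n"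
            using s by (simp add: powr_diff)
          then have "g s * (B * s) = real ?n * B * s powr - real ?n" by (simp add: g_def)
          then show ?thesis using g[of s] s B(1) by (simp add: ennreal_mult[symmetric])
        qed
        also have "ennreal (real ?n * B) * ennreal (s powr - real ?n) * (\<integral>\<^sup>+y\<in>ball x (2 * s). ennreal (G y) \<partial>lborel)
            = (\<integral>\<^sup>+y. ennreal (real ?n * B) * ennreal (s powr - real ?n) * (ennreal (G y) * indicator (ball x (2 * s)) y) \<partial>lborel)"
          by (rule nn_integral_cmult[symmetric]) measurable
        also have "\<dots> = (\<integral>\<^sup>+y. ?c y
            * ?j s y \<partial>lborel)"
          by (intro nn_integral_cong) (simp add: indicator_def dist_norm mult_ac)
        finally show ?thesis .
      next
        case False
        then have "h s y = 0" for y using t by (simp add: h_def)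
        then show ?thesis by simp
      qed
    qed
    also have "\<dots> = (\<integral>\<^sup>+y. (\<integral>\<^sup>+s. ?c y
        * ?j s y \<partial>lborel) \<partial>lborel)"
      by (rule lborel_pair.Fubini') measurable
    also have "\<dots> = (\<integral>\<^sup>+y. ennreal C * (ennreal (G y) * riesz_kernel (x - y)) \<partial>lborel)"
    proof (intro nn_integral_cong_AE AE_lborel_neI[of x])
      fix y assume "y \<noteq> x"
      then have d: "0 < norm (x - y) / 2" by simp
      have "(\<integral>\<^sup>+s. ?c y * ?j s y \<partial>lborel)
          = ?c y * (\<integral>\<^sup>+s. ennreal (s powr - real ?n) * (if norm (x - y) < 2 * s then 1 else 0) \<partial>lborel)"
        by (rule nn_integral_cmult) measurable
      also have "(\<integral>\<^sup>+s. ennreal (s powr - real ?n) * (if norm (x - y) < 2 * s then 1 else 0) \<partial>lborel)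
          = (\<integral>\<^sup>+s\<in>{norm (x - y) / 2<..}. ennreal (s powr - real ?n) \<partial>lborel)"
        by (intro nn_integral_cong) (auto simp: indicator_def)
      also have "\<dots> = ennreal ((norm (x - y) / 2) powr (1 - real ?n) / (real ?n - 1))"
        using n d by (intro nn_integral_powr_tail_open) auto
      also have "(norm (x - y) / 2) powr (1 - real ?n) = 2 ^ (?n - 1) / norm (x - y) ^ (?n - 1)"
      proof -
        have "1 - real ?n = - real (?n - 1)" using n by (simp add: of_nat_diff)
        then have "(norm (x - y) / 2) powr (1 - real ?n) = 1 / (norm (x - y) / 2) ^ (?n - 1)"
          using d by (simp only: powr_minus_divide powr_realpow)
        then show ?thesis by (simp add: power_divide)
      qed
      also have "?c y * ennreal (2 ^ (?n - 1) / norm (x - y) ^ (?n - 1) / (real ?n - 1))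
          = ennreal C * (ennreal (G y) * riesz_kernel (x - y))"
      proof -
        have "real ?n * B * G y * (2 ^ (?n - 1) / norm (x - y) ^ (?n - 1) / (real ?n - 1)) = C * (G y * (1 / norm (x - y) ^ (?n - 1)))"
          by (simp add: C_def mult_ac)
        moreover have "0 \<le> C" using C by simp
        ultimately show ?thesis
          unfolding riesz_kernel_def
          using n B(1) grad_bound_nonneg[OF f(1), of y] by (simp add: ennreal_mult[symmetric] del: times_divide_eq_right)
      qed
      finally show "(\<integral>\<^sup>+s. ?c y * ?j s y \<partial>lborel)
          = ennreal C * (ennreal (G y) * riesz_kernel (x - y))" .
    qed
    also have "\<dots> = ennreal C * riesz (\<lambda>y. ennreal (G y)) x"
      unfolding riesz_def by (rule nn_integral_cmult) measurable
    finally show ?thesis .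
  qed
  show thesis
  proof (rule that[OF riesz_boundI[OF C]])
    fix f :: "real^'n \<Rightarrow> complex" and G x assume "grad_bound f G" "bounded {x. f x \<noteq> 0}"
    then show "maximal_rough_singular W f x \<le> ennreal C * riesz (\<lambda>y. ennreal (G y)) x"
      unfolding maximal_rough_singular_def by (intro SUP_least main) auto
  qed
qed

text \<open>
  In polar coordinates the Riesz kernel cancels the Jacobian, which leaves the integral of
  \<open>\<bar>W\<bar>\<close> over the sphere.
\<close>

lemma rough_kernel_riesz_kernel_finite:
  fixes W :: "real^'n \<Rightarrow> complex"
  assumes n: "2 \<le> CARD('n)" and W: "rough_kernel W A"
  shows "(\<integral>\<^sup>+y\<in>ball 0 1. ennreal (norm (W y)) * riesz_kernel y \<partial>lborel) < \<infinity>"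
proof -
  have [measurable]: "W \<in> borel_measurable borel" and hom: "\<And>y. W (sgn y) = W y"
    using W by (auto simp: rough_kernel_def)
  have Wm [measurable]: "W \<in> borel_measurable sphere_measure" by (rule measurable_sphere_measure) fact
  let ?h = "\<lambda>\<theta> r. ennreal (norm (W (r *\<^sub>R \<theta>))) * riesz_kernel (r *\<^sub>R \<theta>) * indicator (ball 0 1) (r *\<^sub>R \<theta>) * ennreal (r ^ (CARD('n) - 1))"
  have "(\<integral>\<^sup>+y\<in>ball 0 1. ennreal (norm (W y)) * riesz_kernel y \<partial>lborel)
      = (\<integral>\<^sup>+\<theta>. (\<integral>\<^sup>+r\<in>{0<..}. ?h \<theta> r \<partial>lborel) \<partial>sphere_measure)"
    by (rule polar_coordinates) measurable
  also have "\<dots> \<le> (\<integral>\<^sup>+\<theta>. ennreal (norm (W \<theta>)) \<partial>(sphere_measure :: (real^'n) measure))"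
  proof (rule nn_integral_mono)
    fix \<theta> :: "real^'n" assume "\<theta> \<in> space sphere_measure"
    then have \<theta>: "norm \<theta> = 1" by simp
    have "(\<integral>\<^sup>+r\<in>{0<..}. ?h \<theta> r \<partial>lborel) \<le> (\<integral>\<^sup>+r. ennreal (norm (W \<theta>)) * indicator {0..1::real} r \<partial>lborel)"
    proof (rule nn_integral_mono)
      fix r :: real
      show "?h \<theta> r * indicator {0<..} r \<le> ennreal (norm (W \<theta>)) * indicator {0..1} r"
      proof (cases "0 < r \<and> r < 1")
        case True
        have "riesz_kernel (r *\<^sub>R \<theta>) * ennreal (r ^ (CARD('n) - 1)) = 1"
          unfolding riesz_kernel_def using True \<theta> by (subst ennreal_mult[symmetric]) auto
        moreover have "W (r *\<^sub>R \<theta>) = W \<theta>"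
          using hom[of "r *\<^sub>R \<theta>"] True \<theta> by (simp add: sgn_div_norm)
        ultimately show ?thesis using True \<theta> by (simp add: mult.assoc)
      next
        case False
        then show ?thesis using \<theta> by (auto simp: indicator_def)
      qed
    qed
    also have "\<dots> = ennreal (norm (W \<theta>))"
      by (simp add: nn_integral_cmult_indicator)
    finally show "(\<integral>\<^sup>+r\<in>{0<..}. ?h \<theta> r \<partial>lborel) \<le> ennreal (norm (W \<theta>))" .
  qed
  also have "\<dots> = of_nat CARD('n) * (\<integral>\<^sup>+y\<in>ball 0 1 - {0}. ennreal (norm (W (sgn y))) \<partial>lborel)"
    by (rule nn_integral_sphere_measure) measurable
  also have "\<dots> \<le> of_nat CARD('n) * (\<integral>\<^sup>+y\<in>ball 0 1. ennreal (norm (W y)) \<partial>lborel)"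
    by (intro mult_left_mono nn_integral_mono) (auto simp: hom indicator_def)
  also have "\<dots> < \<infinity>"
    using rough_kernel_locally_integrable[OF n W, of 1] by (simp add: ennreal_mult_less_top of_nat_less_top)
  finally show ?thesis .
qed

text \<open>
  Since \<open>W\<close> has mean zero, \<open>f (x - y)\<close> may be replaced by \<open>f (x - y)
  - f x\<close> inside the unit ball. This difference is of order \<open>\<bar>y\<bar>\<close>, so
  that the new integrand is integrable and dominates its truncations.
\<close>

lemma truncated_singular_convergent:
  fixes W f :: "real^'n \<Rightarrow> complex"
  assumes n: "2 \<le> CARD('n)" and W: "rough_kernel W A" and mean: "(LINT \<theta>|sphere_measure. W \<theta>) = 0"
    and f: "grad_bound f G" "bounded {x. f x \<noteq> 0}"
  obtains l where "((\<lambda>t. truncated_singular W t f x) \<longlongrightarrow> l) (at_right 0)"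
proof -
  let ?n = "CARD('n)"
  have pw: "r ^ ?n = r * r ^ (?n - 1)" for r :: real
    by (metis Suc_diff_1 power_Suc zero_less_card_finite)
  have [measurable]: "W \<in> borel_measurable borel" using W by (simp add: rough_kernel_def)
  have [measurable]: "f \<in> borel_measurable borel" by (rule grad_bound_measurable_fun[OF f(1)])
  have u: "integrable lborel (\<lambda>y. W y * f (x - y))"
    by (rule rough_kernel_integrable_compact_support[OF n W grad_bound_continuous_fun[OF f(1)] f(2)])
  obtain L where L: "0 \<le> L" "\<And>z. z \<in> cball x 1 \<Longrightarrow> norm (G z) \<le> L"
    using continuous_bounded_on_cball[OF grad_bound_continuous[OF f(1)]] by blast
  have lip: "norm (f (x - y) - f x) \<le> L * norm y" if "norm y \<le> 1" for y
  proof -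
    have "ennreal (norm (f (x - y) - f x)) \<le> ennreal (norm y) * (\<integral>\<^sup>+s\<in>{0..1}. ennreal (G (x + s *\<^sub>R (- y))) \<partial>lborel)"
      using grad_bound_segment[OF f(1), of 0 1 x "- y"] by simp
    also have "\<dots> \<le> ennreal (norm y) * (\<integral>\<^sup>+s. ennreal L * indicator {0..1::real} s \<partial>lborel)"
    proof (intro mult_left_mono nn_integral_mono)
      fix s :: real
      show "ennreal (G (x + s *\<^sub>R (- y))) * indicator {0..1} s \<le> ennreal L * indicator {0..1} s"
      proof (cases "s \<in> {0..1}")
        case True
        then have "\<bar>s\<bar> * norm y \<le> 1 * 1" using that by (intro mult_mono) auto
        then have "norm (G (x + s *\<^sub>R (- y))) \<le> L"
          by (intro L(2)) (simp add: dist_norm)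
        then show ?thesis using True by (auto intro!: ennreal_leI)
      qed simp
    qed simp
    also have "\<dots> = ennreal (L * norm y)"
      using L(1) by (simp add: nn_integral_cmult_indicator ennreal_mult mult.commute)
    finally show ?thesis using L(1) by simp
  qed
  define k where "k = (\<lambda>y. W y / of_real (norm y ^ ?n) * (f (x - y) - f x * indicator (ball 0 1) y))"
  have [measurable]: "k \<in> borel_measurable borel" unfolding k_def by measurable
  have k: "integrable lborel k"
  proof (rule integrableI_bounded)
    have "(\<integral>\<^sup>+y. ennreal (norm (k y)) \<partial>lborel)
        \<le> (\<integral>\<^sup>+y. ennreal L * (ennreal (norm (W y)) * riesz_kernel y * indicator (ball 0 1) y)
            + ennreal (norm (W y * f (x - y))) \<partial>lborel)"
    proof (rule nn_integral_mono)
      fix y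
      show "ennreal (norm (k y)) \<le> ennreal L * (ennreal (norm (W y)) * riesz_kernel y * indicator (ball 0 1) y)
            + ennreal (norm (W y * f (x - y)))"
      proof (cases "norm y < 1")
        case True
        have "norm (k y) = norm (W y) / norm y ^ ?n * norm (f (x - y) - f x)"
          using True by (simp add: k_def norm_mult norm_divide norm_power)
        also have "\<dots> \<le> norm (W y) / norm y ^ ?n * (L * norm y)"
          using lip[of y] True by (intro mult_left_mono) auto
        also have "\<dots> = L * (norm (W y) * (1 / norm y ^ (?n - 1)))"
          using n by (cases "y = 0") (simp_all add: pw[of "norm y"])
        finally have "ennreal (norm (k y)) \<le> ennreal (L * (norm (W y) * (1 / norm y ^ (?n - 1))))"
          by (rule ennreal_leI)
        also have "\<dots> = ennreal L * (ennreal (norm (W y)) * riesz_kernel y)"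
          using L(1) unfolding riesz_kernel_def by (simp only: ennreal_mult' norm_ge_zero)
        finally show ?thesis using True by (simp add: add_increasing2)
      next
        case False
        then have "1 \<le> norm y ^ ?n" by (simp add: one_le_power)
        then have "norm (W y * f (x - y)) / norm y ^ ?n \<le> norm (W y * f (x - y)) / 1"
          by (intro divide_left_mono) auto
        moreover have "norm (k y) = norm (W y * f (x - y)) / norm y ^ ?n"
          using False by (simp add: k_def norm_mult norm_divide norm_power)
        ultimately have "ennreal (norm (k y)) \<le> ennreal (norm (W y * f (x - y)))"
          by (intro ennreal_leI) simp
        then show ?thesis by (rule add_increasing[OF zero_le])
      qed
    qed
    also have "\<dots> = (\<integral>\<^sup>+y. ennreal L * (ennreal (norm (W y)) * riesz_kernel y * indicator (ball 0 1) y) \<partial>lborel)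
            + (\<integral>\<^sup>+y. ennreal (norm (W y * f (x - y))) \<partial>lborel)"
      by (rule nn_integral_add) measurable
    also have "(\<integral>\<^sup>+y. ennreal L * (ennreal (norm (W y)) * riesz_kernel y * indicator (ball 0 1) y) \<partial>lborel)
        = ennreal L * (\<integral>\<^sup>+y\<in>ball 0 1. ennreal (norm (W y)) * riesz_kernel y \<partial>lborel)"
      by (rule nn_integral_cmult) measurable
    also have "\<dots> + (\<integral>\<^sup>+y. ennreal (norm (W y * f (x - y))) \<partial>lborel) < \<infinity>"
      using rough_kernel_riesz_kernel_finite[OF n W] u unfolding integrable_iff_bounded
      by (simp add: ennreal_mult_less_top)
    finally show "(\<integral>\<^sup>+y. ennreal (norm (k y)) \<partial>lborel) < \<infinity>" .
  qed measurable
  note singular_eq = truncated_singular_eq_lborel[OF \<open>W \<in> borel_measurable borel\<close> \<open>f \<in> borel_measurable borel\<close> AE_I2[OF refl]]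
  have truncated_eq: "truncated_singular W t f x
      = (LINT y|lborel. indicator {y. t < norm y} y *\<^sub>R k y)" if t: "0 < t" "t < 1" for t
  proof -
    \<comment> \<open>the radial function that is integrated against \<open>W\<close> when the constant \<open>f x\<close> is subtracted\<close>
    define \<rho> where "\<rho> = (\<lambda>r::real. indicator {t<..<1} r / r ^ ?n)"
    have [measurable]: "\<rho> \<in> borel_measurable borel" unfolding \<rho>_def by measurable
    have i1: "integrable lborel (\<lambda>y. indicator {y. t < norm y} y *\<^sub>R k y)"
      using k by (rule integrable_mult_indicator[rotated]) measurable
    have "norm (complex_of_real (\<rho> (norm y))) \<le> 1 / t ^ ?n * indicator (ball 0 1) y" for y :: "real^'n"
    proof (cases "t < norm y \<and> norm y < 1")
      case True
      then have "1 / norm y ^ ?n \<le> 1 / t ^ ?n"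
        using t by (intro divide_left_mono power_mono mult_pos_pos zero_less_power) linarith+
      then show ?thesis using True by (simp add: \<rho>_def norm_divide norm_power)
    next
      case False
      then show ?thesis using t by (auto simp: \<rho>_def indicator_def)
    qed
    then have i2: "integrable lborel (\<lambda>y. W y * complex_of_real (\<rho> (norm y)))"
      by (intro rough_kernel_integrable_ball[OF n W]) measurable
    have "truncated_singular W t f x
        = (LINT y|lborel. indicator {y. t < norm y} y *\<^sub>R k y + f x * (W y * complex_of_real (\<rho> (norm y))))"
      unfolding singular_eq
    proof (rule Bochner_Integration.integral_cong)
      fix y
      show "indicator {y. t < norm y} y *\<^sub>R (W y / of_real (norm y ^ ?n) * f (x - y))
          = indicator {y. t < norm y} y *\<^sub>R k y + f x * (W y * complex_of_real (\<rho> (norm y)))"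
        by (auto simp: k_def \<rho>_def indicator_def algebra_simps)
    qed simp
    also have "\<dots> = (LINT y|lborel. indicator {y. t < norm y} y *\<^sub>R k y) + f x * (LINT y|lborel. W y * complex_of_real (\<rho> (norm y)))"
      using i1 i2 by simp
    also have "(LINT y|lborel. W y * complex_of_real (\<rho> (norm y))) = 0"
      using rough_kernel_radial_integral_eq_0[OF W mean, of \<rho>] by (simp add: mult.commute)
    finally show ?thesis by simp
  qed
  have "((\<lambda>t. truncated_singular W t f x) \<longlongrightarrow> integral\<^sup>L lborel k) (at_right 0)"
  proof (rule tendsto_at_right_sequentially[of 0 1])
    fix S :: "nat \<Rightarrow> real" assume S: "\<And>i. 0 < S i" "\<And>i. S i < 1" "S \<longlonglongrightarrow> 0"
    have "(\<lambda>i. LINT y|lborel. indicator {y. S i < norm y} y *\<^sub>R k y) \<longlonglongrightarrow> integral\<^sup>L lborel k"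
    proof (rule integral_dominated_convergence)
      show "integrable lborel (\<lambda>y. norm (k y))" using k by simp
      show "AE y in lborel. (\<lambda>i. indicator {y. S i < norm y} y *\<^sub>R k y) \<longlonglongrightarrow> k y"
      proof (rule AE_lborel_neI[of 0])
        fix y :: "real^'n" assume "y \<noteq> 0"
        then have "eventually (\<lambda>i. S i < norm y) sequentially"
          using S(3) by (intro order_tendstoD(2)) auto
        then have "eventually (\<lambda>i. indicator {y. S i < norm y} y *\<^sub>R k y = k y) sequentially"
          by eventually_elim simp
        then show "(\<lambda>i. indicator {y. S i < norm y} y *\<^sub>R k y) \<longlonglongrightarrow> k y"
          by (rule tendsto_eventually)
      qed
      show "AE y in lborel. norm (indicator {y. S i < norm y} y *\<^sub>R k y) \<le> norm (k y)" for i
        by (rule AE_I2) (simp add: indicator_def)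
    qed measurable
    then show "(\<lambda>i. truncated_singular W (S i) f x) \<longlonglongrightarrow> integral\<^sup>L lborel k"
      using truncated_eq[OF S(1,2)] by simp
  qed simp
  then show thesis by (rule that)
qed

text \<open>
  The principal value is the limit of truncations, so it inherits their common bound.
\<close>

lemma rough_singular_le_riesz:
  fixes \<Omega> :: "real^'n \<Rightarrow> complex"
  assumes n: "2 \<le> CARD('n)" and \<Omega>: "weak_sphere_kernel \<Omega>" "mean_zero \<Omega>"
  obtains C where "riesz_bound (maximal_rough_singular \<Omega>) C" "riesz_bound (\<lambda>f. enorm (rough_singular \<Omega> f)) C"
proof -
  obtain W A where W: "rough_kernel W A" "AE y in lborel. \<Omega> y = W y" "(LINT \<theta>|sphere_measure. W \<theta>) = 0"
    using weak_sphere_kernel_borel_version[OF \<Omega>(1)] \<Omega>(2) by metis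
  have Wm: "W \<in> borel_measurable borel" using W(1) by (simp add: rough_kernel_def)
  obtain C where "riesz_bound (maximal_rough_singular W) C"
    using borel_singular_le_riesz[OF n W(1,3)] by blast
  note C = riesz_boundD[OF this]
  have eq: "truncated_singular \<Omega> t f x = truncated_singular W t f x" if "grad_bound f G" for t f G x
    using truncated_singular_eq_lborel[OF Wm grad_bound_measurable_fun[OF that]] W(2) by simp
  show thesis
  proof (rule that; rule riesz_boundI[OF C(1)])
    fix f :: "real^'n \<Rightarrow> complex" and G x
    assume f: "grad_bound f G" "bounded {x. f x \<noteq> 0}"
    let ?I = "ennreal C * riesz (\<lambda>y. ennreal (G y)) x"
    show le: "maximal_rough_singular \<Omega> f x \<le> ?I"
      using C(2)[OF f] by (simp add: maximal_rough_singular_def eq[OF f(1)])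
    obtain l where lim: "((\<lambda>t. truncated_singular \<Omega> t f x) \<longlongrightarrow> l) (at_right 0)"
      unfolding eq[OF f(1)] using truncated_singular_convergent[OF n W(1,3) f] by blast
    have "ennreal (norm l) \<le> ?I"
    proof (rule tendsto_upperbound)
      show "((\<lambda>t. ennreal (norm (truncated_singular \<Omega> t f x))) \<longlongrightarrow> ennreal (norm l)) (at_right 0)"
        by (intro tendsto_intros lim)
      have "ennreal (norm (truncated_singular \<Omega> t f x)) \<le> ?I" if "0 < t" for t
        using that by (intro order_trans[OF _ le]) (auto simp: maximal_rough_singular_def intro: SUP_upper)
      then show "eventually (\<lambda>t. ennreal (norm (truncated_singular \<Omega> t f x)) \<le> ?I) (at_right 0)"
        unfolding eventually_at_right_field by (intro exI[of _ 1]) auto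
    qed simp
    then show "enorm (rough_singular \<Omega> f) x \<le> ?I"
      using tendsto_Lim[OF _ lim] by (simp add: enorm_def rough_singular_def)
  qed
qed

section \<open>Test functions, weights and the conclusion\<close>

lemma frechet_derivative_le_grad:
  assumes "f differentiable (at x)"
  shows "norm (frechet_derivative f (at x) v) \<le> norm (grad f x) * norm v"
proof -
  let ?D = "frechet_derivative f (at x)"
  have lin: "linear ?D" using assms frechet_derivative_works has_derivative_linear by blast
  have "v = (\<Sum>i\<in>UNIV. v $ i *\<^sub>R axis i 1)"
    by (simp add: vec_eq_iff axis_def if_distrib cong: if_cong)
  then have "?D v = ?D (\<Sum>i\<in>UNIV. v $ i *\<^sub>R axis i 1)" by simp
  also have "\<dots> = (\<Sum>i\<in>UNIV. v $ i *\<^sub>R partial_deriv f i x)"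
    using lin by (simp add: linear_sum linear_scale partial_deriv_def)
  also have "norm \<dots> \<le> (\<Sum>i\<in>UNIV. \<bar>v $ i\<bar> * norm (partial_deriv f i x))"
    by (rule order_trans[OF norm_sum]) simp
  also have "\<dots> = (\<Sum>i\<in>UNIV. \<bar>norm (grad f x $ i)\<bar> * \<bar>norm (v $ i)\<bar>)"
    by (simp add: grad_def mult.commute)
  also have "\<dots> \<le> L2_set (\<lambda>i. norm (grad f x $ i)) UNIV * L2_set (\<lambda>i. norm (v $ i)) UNIV"
    by (rule L2_set_mult_ineq)
  finally show ?thesis by (simp add: norm_vec_def)
qed

lemma test_function_grad_bound:
  assumes f: "test_function f"
  shows "grad_bound f (\<lambda>x. norm (grad f x))" "bounded {x. f x \<noteq> 0}"
proof -
  have "Ck (Suc 0) f" using f by (simp add: test_function_def)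
  then have d: "f differentiable (at x)" and c: "continuous_on UNIV (partial_deriv f i)" for x i
    by auto
  have "continuous_on UNIV (\<lambda>x. norm (grad f x))"
    unfolding grad_def by (intro continuous_intros c)
  moreover have "\<exists>D. (f has_derivative D) (at x) \<and> (\<forall>v. norm (D v) \<le> norm (grad f x) * norm v)" for x
    using d[of x] frechet_derivative_le_grad[OF d] frechet_derivative_works by blast
  ultimately show "grad_bound f (\<lambda>x. norm (grad f x))" by (simp add: grad_bound_def)
  show "bounded {x. f x \<noteq> 0}"
    using f bounded_subset[OF compact_imp_bounded closure_subset] by (auto simp: test_function_def)
qed

text \<open>
  The image of \<open>\<nu>\<close> under the identity is the restriction of \<open>\<nu>\<close> to
  the Borel sets. In this form the lemma covers both Borel measures and densities with respect to
  Lebesgue measure on the Lebesgue measurable sets.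
\<close>

lemma weak_norm_le_of_riesz_bound:
  fixes g :: "real^'n \<Rightarrow> ennreal" and h :: "real^'n \<Rightarrow> ennreal"
  assumes n: "2 \<le> CARD('n)" and \<nu>: "(\<lambda>x. x) \<in> measurable \<nu> borel" and h [measurable]: "h \<in> borel_measurable borel"
    and K: "0 < K" and le: "\<And>x. g x \<le> ennreal K * riesz h x"
  shows "weak_norm (dual_exponent CARD('n)) \<nu> g
       \<le> ennreal (K * (real CARD('n) * 2 ^ (CARD('n) - 1)))
          * (\<integral>\<^sup>+y. h y * epowr (maximal_measure (distr \<nu> borel (\<lambda>x. x)) y) (1 / dual_exponent CARD('n)) \<partial>lborel)"
  unfolding weak_norm_def
proof (rule SUP_least)
  let ?p = "dual_exponent CARD('n)" and ?\<mu> = "distr \<nu> borel (\<lambda>x. x)"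
  let ?C = "real CARD('n) * 2 ^ (CARD('n) - 1)"
  let ?R = "\<integral>\<^sup>+y. h y * epowr (maximal_measure ?\<mu> y) (1 / ?p) \<partial>lborel"
  fix t :: real assume "t \<in> {0<..}"
  then have t: "0 < t" by simp
  let ?E = "{x. ennreal (t / K) < riesz h x}"
  have E: "?E \<in> sets borel" by measurable
  have sub: "{x \<in> space \<nu>. ennreal t < g x} \<subseteq> (\<lambda>x. x) -` ?E \<inter> space \<nu>"
  proof
    fix x assume x: "x \<in> {x \<in> space \<nu>. ennreal t < g x}"
    then have lt: "ennreal t < ennreal K * riesz h x" using le[of x] by auto
    have "\<not> riesz h x \<le> ennreal (t / K)"
    proof
      assume "riesz h x \<le> ennreal (t / K)"
      then have "ennreal K * riesz h x \<le> ennreal K * ennreal (t / K)" by (rule mult_left_mono) simp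
      also have "\<dots> = ennreal t" using t K by (simp add: ennreal_mult[symmetric])
      finally show False using lt by simp
    qed
    then show "x \<in> (\<lambda>x. x) -` ?E \<inter> space \<nu>" using x by auto
  qed
  have "emeasure \<nu> {x \<in> space \<nu>. ennreal t < g x} \<le> emeasure ?\<mu> ?E"
    unfolding emeasure_distr[OF \<nu> E] by (rule emeasure_mono[OF sub measurable_sets[OF \<nu> E]])
  then have "ennreal t * epowr (emeasure \<nu> {x \<in> space \<nu>. ennreal t < g x}) (1 / ?p)
      \<le> ennreal t * epowr (emeasure ?\<mu> ?E) (1 / ?p)"
    using dual_exponent_simps[OF n] by (intro mult_left_mono epowr_mono) auto
  also have "\<dots> = ennreal K * (ennreal (t / K) * epowr (emeasure ?\<mu> ?E) (1 / ?p))"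
  proof -
    have "ennreal t = ennreal K * ennreal (t / K)" using t K by (simp add: ennreal_mult[symmetric])
    then show ?thesis by (simp only: mult.assoc)
  qed
  also have "\<dots> \<le> ennreal K * (ennreal ?C * ?R)"
    using t K by (intro mult_left_mono riesz_weak_type[OF n]) auto
  also have "\<dots> = ennreal (K * ?C) * ?R"
    using K by (simp add: ennreal_mult mult.assoc)
  finally show "ennreal t * epowr (emeasure \<nu> {x \<in> space \<nu>. ennreal t < g x}) (1 / ?p) \<le> ennreal (K * ?C) * ?R" .
qed

lemma weight_measurable:
  fixes w :: "real^'n \<Rightarrow> real"
  assumes w: "weight w"
  shows "w \<in> borel_measurable lebesgue"
proof (rule borel_measurable_LIMSEQ_real)
  fix x :: "real^'n"
  obtain k :: nat where k: "norm x < real k" using reals_Archimedean2 by blast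
  have "eventually (\<lambda>i::nat. indicator (cball 0 (real i)) x *\<^sub>R w x = w x) sequentially"
    using eventually_ge_at_top[of k] by eventually_elim (use k in auto)
  then show "(\<lambda>i::nat. indicator (cball 0 (real i)) x *\<^sub>R w x) \<longlonglongrightarrow> w x"
    by (rule tendsto_eventually)
next
  fix i :: nat
  have "set_integrable lebesgue (cball 0 (real i)) w" using w compact_cball by (simp add: weight_def)
  then show "(\<lambda>x. indicator (cball 0 (real i)) x *\<^sub>R w x) \<in> borel_measurable lebesgue"
    unfolding set_integrable_def by (rule borel_measurable_integrable)
qed

lemma maximal_measure_density:
  assumes "v \<in> borel_measurable lebesgue"
  shows "maximal_measure (distr (density lebesgue v) borel (\<lambda>x. x)) x = maximal v x"
  unfolding maximal_measure_def maximal_def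
proof (intro SUP_cong refl arg_cong2[where f="(/)"])
  fix Q assume "Q \<in> cubes_at x"
  then obtain a l where "Q = cube a l" by (rule cubes_at_cases)
  then have Q: "Q \<in> sets borel" by simp
  have id: "(\<lambda>x. x) \<in> measurable (density lebesgue v) borel"
    using measurable_completion[of "\<lambda>x. x" lborel borel] by simp
  have "emeasure (distr (density lebesgue v) borel (\<lambda>x. x)) Q = emeasure (density lebesgue v) Q"
    using Q by (simp add: emeasure_distr[OF id])
  also have "\<dots> = (\<integral>\<^sup>+y\<in>Q. v y \<partial>lebesgue)"
    using Q assms by (intro emeasure_density) auto
  finally show "emeasure (distr (density lebesgue v) borel (\<lambda>x. x)) Q = (\<integral>\<^sup>+y\<in>Q. v y \<partial>lebesgue)" .
qed

text \<open>
  Where \<open>v\<close> vanishes, the quotient in the definition of the constant is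
  \<open>0\<close> or \<open>\<infinity>\<close>; finiteness of the essential supremum leaves only
  \<open>0\<close>, that is, the maximal function vanishes as well.
\<close>

lemma A1_const_pointwise:
  assumes "A1_const v < \<infinity>"
  shows "AE x in lebesgue. maximal (\<lambda>y. ennreal (v y)) x \<le> A1_const v * ennreal (v x)"
proof -
  have "AE x in lebesgue. maximal (\<lambda>y. ennreal (v y)) x / ennreal (v x) \<le> A1_const v"
    unfolding A1_const_def by (rule esssup_AE)
  then show ?thesis
  proof eventually_elim
    case (elim x)
    let ?m = "maximal (\<lambda>y. ennreal (v y)) x"
    show ?case
    proof (cases "ennreal (v x) = 0")
      case True
      have "?m = 0"
      proof (rule ccontr)
        assume "?m \<noteq> 0"
        then have "?m / ennreal (v x) = \<infinity>" using True by (simp add: ennreal_divide_zero)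
        then show False using elim assms by (simp add: top_unique)
      qed
      then show ?thesis by simp
    next
      case False
      have "?m = ?m / ennreal (v x) * ennreal (v x)"
        using False by (simp add: ennreal_divide_times ennreal_times_divide[symmetric] ennreal_divide_self)
      also have "\<dots> \<le> A1_const v * ennreal (v x)" by (rule mult_right_mono[OF elim]) simp
      finally show ?thesis .
    qed
  qed
qed

theorem corollary5p1:
  fixes T :: "(real^'n \<Rightarrow> complex) \<Rightarrow> real^'n \<Rightarrow> ennreal" and n' :: real
  assumes n: "CARD('n) \<ge> 2"
    and n': "n' = dual_exponent CARD('n)"
    and T: "T = HL_maximal
      \<or> (\<exists>k\<ge>1. T = iterated_maximal k)
      \<or> T = lorentz_maximal
      \<or> T = spherical_maximal
      \<or> (\<exists>\<Omega>. weak_sphere_kernel \<Omega> \<and> T = rough_maximal \<Omega>)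
      \<or> (\<exists>\<Omega>. weak_sphere_kernel \<Omega> \<and> mean_zero \<Omega> \<and> T = (\<lambda>f. enorm (rough_singular \<Omega> f)))
      \<or> (\<exists>\<Omega>. weak_sphere_kernel \<Omega> \<and> mean_zero \<Omega> \<and> T = maximal_rough_singular \<Omega>)"
  shows "\<exists>C::real. 0 \<le> C \<and>
    (\<forall>\<mu> f. sets \<mu> = sets borel \<longrightarrow> test_function f \<longrightarrow>
       weak_norm n' \<mu> (T f)
         \<le> ennreal C * (\<integral>\<^sup>+x. ennreal (norm (grad f x)) * epowr (maximal_measure \<mu> x) (1 / n') \<partial>lebesgue)) \<and>
    (\<forall>w f. A1p_weight n' w \<longrightarrow> test_function f \<longrightarrow>
       weak_norm n' (density lebesgue (\<lambda>x. ennreal (w x powr n'))) (T f)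
         \<le> ennreal C * epowr (A1p_const n' w) (1 / n')
             * (\<integral>\<^sup>+x. ennreal (norm (grad f x)) * ennreal (w x) \<partial>lebesgue))"
proof -
  let ?p = "dual_exponent CARD('n)"
  note p = dual_exponent_simps[OF n]
  have "\<exists>K. riesz_bound T K"
    using T
  proof (elim disjE exE conjE)
    assume "T = HL_maximal"
    then have "T = (\<lambda>f. (maximal ^^ 1) (enorm f))" by (simp add: fun_eq_iff HL_maximal_def)
    then show ?thesis using iterated_maximal_le_riesz[OF n, of 1] by metis
  next
    fix k assume "T = iterated_maximal k"
    then have "T = (\<lambda>f. (maximal ^^ k) (enorm f))" by (simp add: fun_eq_iff iterated_maximal_def)
    then show ?thesis using iterated_maximal_le_riesz[OF n, of k] by metis
  qed (use lorentz_maximal_le_riesz[OF n] spherical_maximal_le_riesz rough_maximal_le_riesz[OF n]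
      rough_singular_le_riesz[OF n] in metis)+
  then obtain K where "riesz_bound T K" by blast
  note K = riesz_boundD[OF this]
  define C where "C = K * (real CARD('n) * 2 ^ (CARD('n) - 1))"
  have weak: "weak_norm n' \<nu> (T f) \<le> ennreal C
      * (\<integral>\<^sup>+y. ennreal (norm (grad f y)) * epowr (maximal_measure (distr \<nu> borel (\<lambda>x. x)) y) (1 / n') \<partial>lborel)"
    if f: "test_function f" and \<nu>: "(\<lambda>x. x) \<in> measurable \<nu> borel" for f and \<nu> :: "(real^'n) measure"
  proof -
    note gf = test_function_grad_bound[OF f]
    have "(\<lambda>y. ennreal (norm (grad f y))) \<in> borel_measurable borel"
      using grad_bound_measurable[OF gf(1)] by measurable
    from weak_norm_le_of_riesz_bound[OF n \<nu> this K(1) K(2)[OF gf]]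
    show ?thesis by (simp only: C_def n')
  qed
  show ?thesis
  proof (intro exI[of _ C] conjI allI impI)
    show "0 \<le> C" using K(1) by (simp add: C_def)
  next
    fix \<mu> :: "(real^'n) measure" and f :: "real^'n \<Rightarrow> complex"
    assume \<mu>: "sets \<mu> = sets borel" and f: "test_function f"
    have "(\<lambda>x. x) \<in> measurable \<mu> borel" by (simp add: measurable_cong_sets[OF \<mu> refl])
    moreover have "distr \<mu> borel (\<lambda>x. x) = \<mu>" using \<mu> by (intro distr_id2) simp
    ultimately show "weak_norm n' \<mu> (T f)
        \<le> ennreal C * (\<integral>\<^sup>+x. ennreal (norm (grad f x)) * epowr (maximal_measure \<mu> x) (1 / n') \<partial>lebesgue)"
      using weak[OF f, of \<mu>] by (simp add: nn_integral_lebesgue_eq)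
  next
    fix w :: "real^'n \<Rightarrow> real" and f :: "real^'n \<Rightarrow> complex"
    assume w: "A1p_weight n' w" and f: "test_function f"
    define v where "v = (\<lambda>x. w x powr n')"
    have ww: "weight w" "weight v" and A1: "A1_const v < \<infinity>" "A1p_const n' w = A1_const v"
      using w by (auto simp: A1p_weight_def A1_weight_def A1p_const_def v_def)
    have w0: "0 \<le> w x" for x using ww(1) by (simp add: weight_def)
    have [measurable]: "w \<in> borel_measurable lebesgue" "v \<in> borel_measurable lebesgue"
      by (rule weight_measurable[OF ww(1)], rule weight_measurable[OF ww(2)])
    have gm [measurable]: "(\<lambda>y. norm (grad f y)) \<in> borel_measurable lebesgue"
      using grad_bound_measurable[OF test_function_grad_bound(1)[OF f]] measurable_completion[of _ lborel] by simp
    let ?\<nu> = "density lebesgue (\<lambda>x. ennreal (v x))"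
    have "(\<lambda>x. x) \<in> measurable ?\<nu> borel"
      using measurable_completion[of "\<lambda>x. x" lborel borel] by simp
    from weak[OF f this]
    have "weak_norm n' ?\<nu> (T f)
        \<le> ennreal C * (\<integral>\<^sup>+y. ennreal (norm (grad f y)) * epowr (maximal (\<lambda>x. ennreal (v x)) y) (1 / n') \<partial>lebesgue)"
      by (simp add: maximal_measure_density nn_integral_lebesgue_eq)
    also have "\<dots> \<le> ennreal C * (\<integral>\<^sup>+y. epowr (A1_const v) (1 / n') * (ennreal (norm (grad f y)) * ennreal (w y)) \<partial>lebesgue)"
    proof (intro mult_left_mono nn_integral_mono_AE)
      show "AE y in lebesgue. ennreal (norm (grad f y)) * epowr (maximal (\<lambda>x. ennreal (v x)) y) (1 / n')
          \<le> epowr (A1_const v) (1 / n') * (ennreal (norm (grad f y)) * ennreal (w y))"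
        using A1_const_pointwise[OF A1(1)]
      proof eventually_elim
        case (elim y)
        have "epowr (maximal (\<lambda>x. ennreal (v x)) y) (1 / n') \<le> epowr (A1_const v * ennreal (v y)) (1 / n')"
          using elim p(4) by (intro epowr_mono) (simp_all add: n')
        also have "\<dots> = epowr (A1_const v) (1 / n') * ennreal ((w y powr n') powr (1 / n'))"
          using p(4) by (simp add: epowr_mult epowr_ennreal n' v_def)
        also have "(w y powr n') powr (1 / n') = w y"
          using p(4) w0[of y] by (simp add: powr_powr n')
        finally have "ennreal (norm (grad f y)) * epowr (maximal (\<lambda>x. ennreal (v x)) y) (1 / n')
            \<le> ennreal (norm (grad f y)) * (epowr (A1_const v) (1 / n') * ennreal (w y))"
          by (rule mult_left_mono) simp
        then show ?case by (simp only: mult_ac)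
      qed
    qed simp
    also have "\<dots> = ennreal C * (epowr (A1_const v) (1 / n') * (\<integral>\<^sup>+y. ennreal (norm (grad f y)) * ennreal (w y) \<partial>lebesgue))"
      by (subst nn_integral_cmult) auto
    finally show "weak_norm n' (density lebesgue (\<lambda>x. ennreal (w x powr n'))) (T f)
         \<le> ennreal C * epowr (A1p_const n' w) (1 / n')
             * (\<integral>\<^sup>+x. ennreal (norm (grad f x)) * ennreal (w x) \<partial>lebesgue)"
      by (simp only: A1(2) v_def mult.assoc)
  qed
qed

end
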